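(* Let $n \ge 2$, let $\mathcal{S} = \{p_1,\dots,p_r\}$ be a finite set of distinct primes, and let $\mu_1,\dots,\mu_r$ be (not necessarily distinct) partitions of $n$. Then the following are equivalent: (1) $\nu_{n,p_i}^{\ast}(C_{\mu_i}) > 0$ for all $1 \le i \le r$. (2) There exists an $S_n$-number field $K$ with the properties: (P1) $K$ contains a monogenic order $O = \mathbb{Z}[1,\theta,\dots,\theta^{n-1}]$ whose discriminant is relatively prime to $p_1p_2\cdots p_r$; (P2) the Galois closure $K^{spl}$ of $K/\mathbb{Q}$ is unramified at all primes above those in $\mathcal{S}$, and the Artin symbols satisfy $\left[\frac{K^{spl}/\mathbb{Q}}{(p_i)}\right] = C_{\mu_i}$ for $1 \le i \le r$. (3) There exist infinitely many $S_n$-number fields $K$ having properties (P1) and (P2).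
   Context: An $S_n$-number field is a number field $K$ with $[K:\mathbb{Q}]=n$ whose Galois closure over $\mathbb{Q}$ has Galois group $S_n$. The Galois group is viewed as a permutation group on the $n$ embeddings of $K$ (equivalently the roots of a defining polynomial), so its conjugacy classes are identified with conjugacy classes $C_\mu$ of $S_n$, indexed by cycle types $\mu \vdash n$; the Artin symbol of an unramified prime $p$ is the conjugacy class of its Frobenius elements. For $m\ge1$, $M_m(X) = \frac{1}{m}\sum_{d\mid m}\mu(d)X^{m/d}$ ($\mu$ the Möbius function); $\binom{w}{k} = \frac{w(w-1)\cdots(w-k+1)}{k!}$; $c_i(\mu)$ is the number of parts of $\mu$ equal to $i$; and $\nu_{n,p}^{\ast}(C_\mu) = \frac{1}{p^{n-1}(p-1)}\prod_{i=1}^n \binom{M_i(p)}{c_i(\mu)}$. *)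

theory Defs
  imports
    Complex_Main
    "HOL-Computational_Algebra.Squarefree"
    "HOL-Combinatorics.Orbits"
    "HOL-Algebra.Bij"
    "HOL-Algebra.Sym_Groups"
    "HOL-Algebra.Ideal_Product"
    "HOL-Algebra.Embedded_Algebras"
    "HOL-Algebra.Algebraic_Closure_Type"
    "Jordan_Normal_Form.Determinant"
begin

section \<open>Partitions and the splitting densities\<close>

text \<open>A partition of \<open>n\<close> is the multiset of its parts, so \<open>c\<^sub>i(\<mu>)\<close> is \<open>count \<mu> i\<close>.\<close>

definition partition_of :: "nat \<Rightarrow> nat multiset \<Rightarrow> bool" where
  "partition_of n \<mu> \<longleftrightarrow> 0 \<notin># \<mu> \<and> sum_mset \<mu> = n"

definition moebius_mu :: "nat \<Rightarrow> int" where
  "moebius_mu d = (if squarefree d then (- 1) ^ card (prime_factors d) else 0)"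

definition necklace :: "nat \<Rightarrow> real \<Rightarrow> real" where
  "necklace m x = (1 / real m) * (\<Sum>d | d dvd m. of_int (moebius_mu d) * x ^ (m div d))"

definition nu_star :: "nat \<Rightarrow> nat \<Rightarrow> nat multiset \<Rightarrow> real" where
  "nu_star n p \<mu> =
     1 / (real p ^ (n - 1) * (real p - 1)) * (\<Prod>i = 1..n. necklace i (real p) gchoose count \<mu> i)"

definition cycle_type :: "('a \<Rightarrow> 'a) \<Rightarrow> 'a set \<Rightarrow> nat multiset" where
  "cycle_type f A = image_mset card (mset_set (Orbits.orbit f ` A))"

section \<open>Number fields\<close>

text \<open>Number fields are realised as subfields of the complex numbers.\<close>

abbreviation CC :: "complex ring" where
  "CC \<equiv> ring_of_type_algebra"

abbreviation ring_on :: "complex set \<Rightarrow> complex ring" where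
  "ring_on A \<equiv> CC\<lparr>carrier := A\<rparr>"

definition number_field :: "complex set \<Rightarrow> bool" where
  "number_field K \<longleftrightarrow> subfield K CC \<and> ring.finite_dimension CC \<rat> K"

definition embeddings :: "complex set \<Rightarrow> (complex \<Rightarrow> complex) set" where
  "embeddings K = Ring.ring_hom (ring_on K) CC \<inter> extensional K"

text \<open>Ring automorphisms fix \<open>\<rat>\<close> pointwise, so this is the group \<open>Aut(L/\<rat>)\<close>.\<close>

definition gal_group :: "complex set \<Rightarrow> (complex \<Rightarrow> complex) monoid" where
  "gal_group L = (BijGroup L)\<lparr>carrier := Ring.ring_hom (ring_on L) (ring_on L) \<inter> Bij L\<rparr>"

definition galois_over_Q :: "complex set \<Rightarrow> bool" where
  "galois_over_Q L \<longleftrightarrow> number_field L \<and> {x \<in> L. \<forall>\<sigma> \<in> carrier (gal_group L). \<sigma> x = x} = \<rat>"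

definition galois_closure :: "complex set \<Rightarrow> complex set" where
  "galois_closure K = \<Inter>{L. galois_over_Q L \<and> K \<subseteq> L}"

definition Sn_number_field :: "nat \<Rightarrow> complex set \<Rightarrow> bool" where
  "Sn_number_field n K \<longleftrightarrow>
     number_field K \<and> ring.dimension CC n \<rat> K \<and> gal_group (galois_closure K) \<cong> sym_group n"

section \<open>Orders and discriminants\<close>

definition int_span :: "complex list \<Rightarrow> complex set" where
  "int_span ws = {(\<Sum>i<length ws. of_int (a i) * ws ! i) | a :: nat \<Rightarrow> int. True}"

definition int_basis :: "complex set \<Rightarrow> complex list \<Rightarrow> bool" where
  "int_basis M ws \<longleftrightarrow> M = int_span ws \<and>
     (\<forall>a :: nat \<Rightarrow> int. (\<Sum>i<length ws. of_int (a i) * ws ! i) = 0 \<longrightarrow> (\<forall>i<length ws. a i = 0))"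

definition order_in :: "complex set \<Rightarrow> complex set \<Rightarrow> bool" where
  "order_in K A \<longleftrightarrow>
     subring A CC \<and> A \<subseteq> K \<and> (\<exists>ws. int_basis A ws \<and> ring.dimension CC (length ws) \<rat> K)"

definition field_trace :: "complex set \<Rightarrow> complex \<Rightarrow> complex" where
  "field_trace K x = (\<Sum>\<phi> \<in> embeddings K. \<phi> x)"

definition basis_disc :: "complex set \<Rightarrow> complex list \<Rightarrow> complex" where
  "basis_disc K ws =
     det (mat (length ws) (length ws) (\<lambda>(i, j). field_trace K (ws ! i * ws ! j)))"

text \<open>For an order the discriminant of an integral basis is a rational integer and does not depend
  on the basis.\<close>

definition order_disc :: "complex set \<Rightarrow> complex set \<Rightarrow> int" where
  "order_disc K A = (THE d. \<exists>ws. int_basis A ws \<and> of_int d = basis_disc K ws)"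

section \<open>Ramification and Artin symbols\<close>

definition ring_of_integers :: "complex set \<Rightarrow> complex set" where
  "ring_of_integers L = {x \<in> L. algebraic_int x}"

definition primes_above :: "complex set \<Rightarrow> nat \<Rightarrow> complex set set" where
  "primes_above L p = {P. primeideal P (ring_on (ring_of_integers L)) \<and> of_nat p \<in> P}"

definition ramification_index :: "complex set \<Rightarrow> nat \<Rightarrow> complex set \<Rightarrow> nat" where
  "ramification_index L p P =
     (GREATEST e. of_nat p \<in> P [^]\<^bsub>ideals_set (ring_on (ring_of_integers L))\<^esub> (e :: nat))"

text \<open>The residue fields are finite, hence perfect, so only the ramification index matters.\<close>

definition unramified_at :: "complex set \<Rightarrow> nat \<Rightarrow> bool" where
  "unramified_at L p \<longleftrightarrow> (\<forall>P \<in> primes_above L p. ramification_index L p P = 1)"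

definition frobenius_at :: "complex set \<Rightarrow> nat \<Rightarrow> complex set \<Rightarrow> (complex \<Rightarrow> complex) \<Rightarrow> bool" where
  "frobenius_at L p P \<sigma> \<longleftrightarrow>
     \<sigma> \<in> carrier (gal_group L) \<and> (\<forall>x \<in> ring_of_integers L. \<sigma> x - x ^ p \<in> P)"

definition artin_symbol :: "complex set \<Rightarrow> nat \<Rightarrow> (complex \<Rightarrow> complex) set" where
  "artin_symbol L p = {\<sigma>. \<exists>P \<in> primes_above L p. frobenius_at L p P \<sigma>}"

text \<open>The class \<open>C\<^sub>\<mu>\<close>, viewed inside the Galois group of the Galois closure of \<open>K\<close> through its action
  \<open>\<sigma> \<cdot> \<phi> = \<sigma> \<circ> \<phi>\<close> on the embeddings of \<open>K\<close>, all of which have image in the Galois closure.\<close>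

definition cycle_class :: "complex set \<Rightarrow> nat multiset \<Rightarrow> (complex \<Rightarrow> complex) set" where
  "cycle_class K \<mu> =
     {\<sigma> \<in> carrier (gal_group (galois_closure K)). cycle_type (compose K \<sigma>) (embeddings K) = \<mu>}"

section \<open>The two properties\<close>

definition has_P1 :: "nat \<Rightarrow> nat \<Rightarrow> (nat \<Rightarrow> nat) \<Rightarrow> complex set \<Rightarrow> bool" where
  "has_P1 n r p K \<longleftrightarrow>
     (\<exists>\<theta> A. A = int_span (map (\<lambda>i. \<theta> ^ i) [0..<n]) \<and> order_in K A \<and>
        coprime (order_disc K A) (\<Prod>i = 1..r. int (p i)))"

definition has_P2 :: "nat \<Rightarrow> (nat \<Rightarrow> nat) \<Rightarrow> (nat \<Rightarrow> nat multiset) \<Rightarrow> complex set \<Rightarrow> bool" where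
  "has_P2 r p \<mu> K \<longleftrightarrow>
     (\<forall>i \<in> {1..r}. unramified_at (galois_closure K) (p i) \<and>
        artin_symbol (galois_closure K) (p i) = cycle_class K (\<mu> i))"

end

theory Submission
  imports
    Defs
    "Jordan_Normal_Form.Char_Poly"
    "HOL-Number_Theory.Residues"
    "HOL-Computational_Algebra.Fundamental_Theorem_Algebra"
begin

text \<open>Everything takes place inside the complex numbers. For a prime \<open>p\<close> fix a prime ideal \<open>M\<close> above
  \<open>p\<close> of the ring of all algebraic integers. The solutions of \<open>x\<^bsup>p^m\<^esup> = x\<close> represent the elements of
  the field with \<open>p\<^sup>m\<close> elements modulo \<open>M\<close>, and counting the orbits of \<open>x \<mapsto> x\<^sup>p\<close> of size \<open>i\<close> by Moebius
  inversion gives \<open>M\<^sub>i(p)\<close>. Hence \<open>\<nu>\<^sup>*(C\<^sub>\<mu>) > 0\<close> says that some finite set \<open>S\<close> of such elements is stable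
  under \<open>x \<mapsto> x\<^sup>p\<close> with cycle type \<open>\<mu>\<close>.

  Given the sets \<open>S\<close> for finitely many primes, \<open>\<Prod>\<^sub>s (X - s)\<close> is congruent modulo \<open>M\<close> to an integer
  polynomial, and the Chinese remainder theorem glues these polynomials. The Frobenius elements of the
  splitting field then permute the roots with the prescribed cycle types. Auxiliary primes with cycle
  types \<open>(n)\<close>, \<open>(1, n - 1)\<close> and \<open>(2, 1, \<dots>, 1)\<close> force the Galois group to be \<open>S\<^sub>n\<close>, and further primes
  with types \<open>(n)\<close> and \<open>(1, \<dots>, 1)\<close> separate infinitely many fields. Conversely, if the discriminant of
  a monogenic order is prime to \<open>p\<close>, the roots inject equivariantly into the representatives of
  the algebraic closure of the prime field, which bounds the cycle counts by \<open>M\<^sub>i(p)\<close>.\<close>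

section \<open>Algebraic integers and prime ideals\<close>

text \<open>A prime \<open>M\<close> of the ring of all algebraic integers makes congruences
  comparable across number fields; a field \<open>L\<close> meets it in \<open>M \<inter> L\<close>.
  Stability of \<open>S\<close> under \<open>x ^ p\<close> makes the coefficients of the product
  over \<open>S\<close> fixed by Frobenius modulo \<open>M\<close>, and such elements are congruent
  to integers. The construction controls Frobenius elements at one prime above \<open>p\<close>, but
  \<open>artin_symbol\<close> collects them over all primes above \<open>p\<close>, so the Galois
  group must be transitive on these. Transitivity and the existence of Frobenius elements are proved
  alike: the failures for all group elements become coefficients of one polynomial, whose norm or
  characteristic polynomial has integer coefficients, and Gauss's lemma selects one group element.
  Auxiliary primes \<open>q \<ge> n\<close> suffice because \<open>M_1(q) = q\<close> and
  \<open>M_i(q) \<ge> 1\<close>. Fields are told apart because the class of type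
  \<open>(1, ..., 1)\<close> contains the identity and that of type \<open>(n)\<close> does not. In
  the converse, equality of classes yields a Frobenius element only since the class is nonempty,
  which uses the full group \<open>S_n\<close>.\<close>

lemma algebraic_int_if_stabilises_module:
  fixes w :: "nat \<Rightarrow> complex" and c :: "nat \<Rightarrow> nat \<Rightarrow> int"
  assumes "k < n" "w k \<noteq> 0"
    and "\<And>i. i < n \<Longrightarrow> x * w i = (\<Sum>j<n. of_int (c i j) * w j)"
  shows "algebraic_int x"
proof -
  define B where "B = mat n n (\<lambda>(i, j). c i j)"
  let ?B = "map_mat complex_of_int B"
  have B: "B \<in> carrier_mat n n" by (simp add: B_def)
  have "vec n w $ k \<noteq> 0\<^sub>v n $ k" using assms(1,2) by simp
  hence "vec n w \<noteq> 0\<^sub>v n" by auto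
  moreover have "?B *\<^sub>v vec n w = x \<cdot>\<^sub>v vec n w"
    using assms(3)
    by (intro eq_vecI) (auto simp: B_def scalar_prod_def atLeast0LessThan)
  \<comment> \<open>The generators form an eigenvector of an integer matrix, so \<open>x\<close> is
    a root of its characteristic polynomial, which is monic with integer coefficients.\<close>
  ultimately have "eigenvalue ?B x"
    unfolding eigenvalue_def eigenvector_def
    by (intro exI[of _ "vec n w"]) (simp add: B_def)
  hence "poly (char_poly ?B) x = 0"
    using eigenvalue_root_char_poly[of ?B n x] B by simp
  hence "poly (map_poly of_int (char_poly B)) x = 0"
    by (simp add: of_int_hom.char_poly_hom[OF B])
  moreover have "lead_coeff (char_poly B) = 1"
    using degree_monic_char_poly[OF B] by simp
  ultimately show ?thesis unfolding algebraic_int_altdef_ipoly by blast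
qed

lemma algebraic_int_if_stabilises_finite_module:
  fixes w :: "'i \<Rightarrow> complex" and c :: "'i \<Rightarrow> 'i \<Rightarrow> int"
  assumes "finite I" "k \<in> I" "w k \<noteq> 0"
    and "\<And>i. i \<in> I \<Longrightarrow> x * w i = (\<Sum>j\<in>I. of_int (c i j) * w j)"
  shows "algebraic_int x"
proof -
  obtain b where b: "bij_betw b {..<card I} I"
    using ex_bij_betw_nat_finite[OF assms(1)] by (auto simp: atLeast0LessThan)
  hence "k \<in> b ` {..<card I}" using assms(2) by (simp add: bij_betw_def)
  then obtain k' where k': "k' < card I" "b k' = k" by auto
  show ?thesis
  proof (rule algebraic_int_if_stabilises_module[of k' "card I" "w \<circ> b" x "\<lambda>i j. c (b i) (b j)"])
    fix i assume "i < card I"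
    hence "b i \<in> I" using b by (auto simp: bij_betw_def)
    thus "x * (w \<circ> b) i = (\<Sum>j<card I. of_int (c (b i) (b j)) * (w \<circ> b) j)"
      using assms(4) sum.reindex_bij_betw[OF b, of "\<lambda>j. of_int (c (b i) j) * w j"] by simp
  qed (use k' assms(3) in auto)
qed

text \<open>The generators are an indexed family rather than a list, so that products of two
  families can be indexed by pairs.\<close>

definition int_comb :: "('i \<Rightarrow> complex) \<Rightarrow> 'i set \<Rightarrow> complex set" where
  "int_comb w I = {\<Sum>i\<in>I. of_int (a i) * w i | a :: 'i \<Rightarrow> int. True}"

lemma int_comb_add: "x \<in> int_comb w I \<Longrightarrow> y \<in> int_comb w I \<Longrightarrow> x + y \<in> int_comb w I"
proof -
  assume "x \<in> int_comb w I" "y \<in> int_comb w I"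
  then obtain a b where "x = (\<Sum>i\<in>I. of_int (a i) * w i)" "y = (\<Sum>i\<in>I. of_int (b i) * w i)"
    unfolding int_comb_def by auto
  hence "x + y = (\<Sum>i\<in>I. of_int (a i + b i) * w i)"
    by (simp add: sum.distrib distrib_right)
  thus ?thesis unfolding int_comb_def mem_Collect_eq by (intro exI[of _ "\<lambda>i. a i + b i"] conjI TrueI)
qed

lemma int_comb_of_int_mult: "x \<in> int_comb w I \<Longrightarrow> of_int k * x \<in> int_comb w I"
proof -
  assume "x \<in> int_comb w I"
  then obtain a where "x = (\<Sum>i\<in>I. of_int (a i) * w i)"
    unfolding int_comb_def by auto
  hence "of_int k * x = (\<Sum>i\<in>I. of_int (k * a i) * w i)"
    by (simp add: sum_distrib_left mult.assoc)
  thus ?thesis unfolding int_comb_def mem_Collect_eq by (intro exI[of _ "\<lambda>i. k * a i"] conjI TrueI)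
qed

lemma int_comb_0: "0 \<in> int_comb w I"
  unfolding int_comb_def by (auto intro!: exI[of _ "\<lambda>_. 0"])

lemma int_comb_sum: "(\<And>j. j \<in> J \<Longrightarrow> g j \<in> int_comb w I) \<Longrightarrow> sum g J \<in> int_comb w I"
  by (induction J rule: infinite_finite_induct) (auto simp: int_comb_0 int_comb_add)

lemma int_comb_gen: "finite I \<Longrightarrow> i \<in> I \<Longrightarrow> w i \<in> int_comb w I"
  unfolding int_comb_def
  by (auto intro!: exI[of _ "\<lambda>j. if j = i then 1 else 0"] simp: if_distrib if_distribR sum.delta cong: if_cong)

lemma int_comb_mult_closed:
  assumes "\<And>i. i \<in> I \<Longrightarrow> x * w i \<in> int_comb w I" "y \<in> int_comb w I"
  shows "x * y \<in> int_comb w I"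
proof -
  obtain a where y: "y = (\<Sum>i\<in>I. of_int (a i) * w i)"
    using assms(2) unfolding int_comb_def by auto
  have "x * y = (\<Sum>i\<in>I. of_int (a i) * (x * w i))"
    unfolding y sum_distrib_left by (simp add: mult_ac)
  thus ?thesis using assms(1) by (auto intro!: int_comb_sum int_comb_of_int_mult)
qed

lemma algebraic_int_if_int_comb:
  assumes "finite I" "k \<in> I" "w k \<noteq> 0" "\<And>i. i \<in> I \<Longrightarrow> x * w i \<in> int_comb w I"
  shows "algebraic_int x"
proof -
  have "\<forall>i\<in>I. \<exists>a :: 'a \<Rightarrow> int. x * w i = (\<Sum>j\<in>I. of_int (a j) * w j)"
    using assms(4) unfolding int_comb_def by blast
  then obtain c where "\<forall>i\<in>I. x * w i = (\<Sum>j\<in>I. of_int (c i j :: int) * w j)"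
    by metis
  thus ?thesis using algebraic_int_if_stabilises_finite_module[of I k w x c] assms(1-3) by blast
qed

lemma algebraic_int_power_int_comb:
  fixes x :: complex
  assumes "algebraic_int x"
  obtains d where "d > 0" "x ^ d \<in> int_comb (\<lambda>i. x ^ i) {..<d}"
proof -
  obtain q :: "int poly" where q: "poly (map_poly of_int q) x = 0" "lead_coeff q = 1"
    using assms unfolding algebraic_int_altdef_ipoly by auto
  let ?d = "degree q"
  have d: "?d > 0"
  proof (rule ccontr)
    assume "\<not> ?d > 0"
    hence "q = 1" using q(2) by (metis degree_0_id gr_zeroI one_pCons of_int_hom.hom_one)
    thus False using q(1) by simp
  qed
  have "(\<Sum>i\<le>?d. of_int (coeff q i) * x ^ i) = 0"
    using q(1) by (simp add: poly_altdef)
  also have "{..?d} = insert ?d {..<?d}" by auto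
  finally have "x ^ ?d = (\<Sum>i<?d. of_int (- coeff q i) * x ^ i)"
    using q(2) by (simp add: sum_negf eq_neg_iff_add_eq_0)
  hence "x ^ ?d \<in> int_comb (\<lambda>i. x ^ i) {..<?d}"
    unfolding int_comb_def by (auto intro!: exI[of _ "\<lambda>i. - coeff q i"])
  with d show thesis using that by blast
qed

text \<open>The products \<open>x ^ i * y ^ j\<close> with \<open>i < d\<close> and
  \<open>j < e\<close> generate a group that multiplication by \<open>x\<close> and by
  \<open>y\<close> maps into itself, so multiplication by \<open>x + y\<close> and
  \<open>x * y\<close> does so too.\<close>

lemma algebraic_int_plus_times:
  fixes x y :: complex
  assumes "algebraic_int x" "algebraic_int y"
  shows "algebraic_int (x + y)" "algebraic_int (x * y)"
proof -
  obtain d where d: "d > 0" "x ^ d \<in> int_comb (\<lambda>i. x ^ i) {..<d}"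
    using algebraic_int_power_int_comb[OF assms(1)] .
  obtain e where e: "e > 0" "y ^ e \<in> int_comb (\<lambda>i. y ^ i) {..<e}"
    using algebraic_int_power_int_comb[OF assms(2)] .
  define w where "w = (\<lambda>(i, j). x ^ i * y ^ j)"
  define I where "I = {..<d} \<times> {..<e}"
  have fin: "finite I" by (simp add: I_def)
  have gen: "i < d \<Longrightarrow> j < e \<Longrightarrow> x ^ i * y ^ j \<in> int_comb w I" for i j
    using int_comb_gen[OF fin, of "(i, j)" w] by (simp add: I_def w_def)
  have X: "x * w k \<in> int_comb w I" if k: "k \<in> I" for k
  proof -
    obtain i j where ij: "k = (i, j)" "i < d" "j < e" using k by (auto simp: I_def)
    show ?thesis
    proof (cases "Suc i < d")
      case True
      thus ?thesis using gen[of "Suc i" j] ij by (simp add: w_def mult_ac)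
    next
      case False
      hence "x * w k = x ^ d * y ^ j"
        using ij by (cases d) (auto simp: w_def less_Suc_eq)
      moreover obtain a where "x ^ d = (\<Sum>i<d. of_int (a i :: int) * x ^ i)"
        using d(2) unfolding int_comb_def by auto
      ultimately have "x * w k = (\<Sum>i<d. of_int (a i) * (x ^ i * y ^ j))"
        by (simp add: sum_distrib_right mult.assoc)
      thus ?thesis using gen ij by (auto intro!: int_comb_sum int_comb_of_int_mult)
    qed
  qed
  have Y: "y * w k \<in> int_comb w I" if k: "k \<in> I" for k
  proof -
    obtain i j where ij: "k = (i, j)" "i < d" "j < e" using k by (auto simp: I_def)
    show ?thesis
    proof (cases "Suc j < e")
      case True
      thus ?thesis using gen[of i "Suc j"] ij by (simp add: w_def mult_ac)
    next
      case False
      hence "y * w k = x ^ i * y ^ e"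
        using ij by (cases e) (auto simp: w_def less_Suc_eq)
      moreover obtain a where "y ^ e = (\<Sum>j<e. of_int (a j :: int) * y ^ j)"
        using e(2) unfolding int_comb_def by auto
      ultimately have "y * w k = (\<Sum>j<e. of_int (a j) * (x ^ i * y ^ j))"
        by (simp add: sum_distrib_left mult_ac)
      thus ?thesis using gen ij by (auto intro!: int_comb_sum int_comb_of_int_mult)
    qed
  qed
  \<comment> \<open>The generator with index \<open>(0, 0)\<close> is \<open>1\<close>; it witnesses
    that the module is nonzero.\<close>
  have k0: "(0, 0) \<in> I" "w (0, 0) \<noteq> 0" using d e by (auto simp: I_def w_def)
  show "algebraic_int (x + y)"
    using X Y by (intro algebraic_int_if_int_comb[of I "(0, 0)" w, OF fin k0]) (auto simp: distrib_right intro: int_comb_add)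
  show "algebraic_int (x * y)"
    using int_comb_mult_closed[of I x w] X Y
    by (intro algebraic_int_if_int_comb[of I "(0, 0)" w, OF fin k0]) (auto simp: mult.assoc)
qed

section \<open>Subrings and prime ideals as sets\<close>

text \<open>Sets in a type with class \<open>comm_ring_1\<close> keep the ordinary arithmetic
  usable. The type is arbitrary because the same locale is instantiated with sets of polynomials and
  with sets of polynomials over polynomials.\<close>

locale subring_set =
  fixes S :: "'a :: comm_ring_1 set"
  assumes one_S [simp, intro]: "1 \<in> S"
    and diff_S [intro]: "x \<in> S \<Longrightarrow> y \<in> S \<Longrightarrow> x - y \<in> S"
    and mult_S [intro]: "x \<in> S \<Longrightarrow> y \<in> S \<Longrightarrow> x * y \<in> S"
begin

lemma zero_S [simp, intro]: "0 \<in> S"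
  using diff_S[of 1 1] by simp

lemma uminus_S [intro]: "x \<in> S \<Longrightarrow> - x \<in> S"
  using diff_S[of 0 x] by simp

lemma plus_S [intro]: "x \<in> S \<Longrightarrow> y \<in> S \<Longrightarrow> x + y \<in> S"
  using diff_S[of x "- y"] uminus_S[of y] by simp

lemma sum_S [intro]: "(\<And>i. i \<in> I \<Longrightarrow> g i \<in> S) \<Longrightarrow> sum g I \<in> S"
  by (induction I rule: infinite_finite_induct) auto

lemma prod_S [intro]: "(\<And>i. i \<in> I \<Longrightarrow> g i \<in> S) \<Longrightarrow> prod g I \<in> S"
  by (induction I rule: infinite_finite_induct) auto

lemma power_S [intro]: "x \<in> S \<Longrightarrow> x ^ k \<in> S"
  by (induction k) auto

lemma of_nat_S [simp, intro]: "of_nat k \<in> S"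
  by (induction k) auto

lemma of_int_S [simp, intro]: "of_int k \<in> S"
  by (cases k) auto

end

lemma subring_set_alg_ints: "subring_set {x :: complex. algebraic_int x}"
proof
  fix x y :: complex assume "x \<in> {x. algebraic_int x}" "y \<in> {x. algebraic_int x}"
  thus "x - y \<in> {x. algebraic_int x}" "x * y \<in> {x. algebraic_int x}"
    using algebraic_int_plus_times[of x "- y"] algebraic_int_plus_times[of x y] by auto
qed auto

locale prime_set = subring_set S for S :: "'a :: comm_ring_1 set" +
  fixes P :: "'a set"
  assumes P_sub: "P \<subseteq> S"
    and one_P: "1 \<notin> P"
    and zero_P [simp, intro]: "0 \<in> P"
    and plus_P [intro]: "x \<in> P \<Longrightarrow> y \<in> P \<Longrightarrow> x + y \<in> P"
    and mult_P [intro]: "x \<in> P \<Longrightarrow> a \<in> S \<Longrightarrow> a * x \<in> P"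
    and prime_P: "x \<in> S \<Longrightarrow> y \<in> S \<Longrightarrow> x * y \<in> P \<Longrightarrow> x \<in> P \<or> y \<in> P"
begin

lemma mult_P' [intro]: "x \<in> P \<Longrightarrow> a \<in> S \<Longrightarrow> x * a \<in> P"
  using mult_P[of x a] by (metis mult.commute)

lemma uminus_P [intro]: "x \<in> P \<Longrightarrow> - x \<in> P"
  using mult_P[of x "- 1"] by auto

lemma uminus_P_iff [simp]: "- x \<in> P \<longleftrightarrow> x \<in> P"
  using uminus_P[of x] uminus_P[of "- x"] by auto

lemma diff_P [intro]: "x \<in> P \<Longrightarrow> y \<in> P \<Longrightarrow> x - y \<in> P"
  using plus_P[of x "- y"] by auto

lemma sum_P [intro]: "(\<And>i. i \<in> I \<Longrightarrow> g i \<in> P) \<Longrightarrow> sum g I \<in> P"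
  by (induction I rule: infinite_finite_induct) auto

lemma prod_in_P: "finite I \<Longrightarrow> (\<And>i. i \<in> I \<Longrightarrow> g i \<in> S) \<Longrightarrow> prod g I \<in> P \<Longrightarrow> \<exists>i\<in>I. g i \<in> P"
proof (induction I rule: finite_induct)
  case empty
  thus ?case using one_P by simp
next
  case (insert i I)
  hence "g i \<in> P \<or> prod g I \<in> P" by (intro prime_P) auto
  thus ?case using insert by auto
qed

lemma power_in_P: "x \<in> S \<Longrightarrow> x ^ k \<in> P \<Longrightarrow> x \<in> P"
  by (induction k) (use one_P prime_P in auto)

lemma trans_P: "x - y \<in> P \<Longrightarrow> y - z \<in> P \<Longrightarrow> x - z \<in> P"
  using plus_P[of "x - y" "y - z"] by simp

lemma sym_P: "x - y \<in> P \<Longrightarrow> y - x \<in> P"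
  using uminus_P[of "x - y"] by simp

lemma cong_mult_P:
  "x - y \<in> P \<Longrightarrow> x' - y' \<in> P \<Longrightarrow> x' \<in> S \<Longrightarrow> y \<in> S \<Longrightarrow> x * x' - y * y' \<in> P"
proof -
  assume a: "x - y \<in> P" "x' - y' \<in> P" "x' \<in> S" "y \<in> S"
  have "x * x' - y * y' = x' * (x - y) + y * (x' - y')" by (simp add: algebra_simps)
  thus ?thesis using a by auto
qed

lemma cong_power_P: "x - y \<in> P \<Longrightarrow> x \<in> S \<Longrightarrow> y \<in> S \<Longrightarrow> x ^ k - y ^ k \<in> P"
  by (induction k) (auto intro: cong_mult_P)

lemma cong_sum_P: "(\<And>i. i \<in> I \<Longrightarrow> g i - h i \<in> P) \<Longrightarrow> sum g I - sum h I \<in> P"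
  by (simp flip: sum_subtractf) auto

lemma cong_prod_P:
  "(\<And>i. i \<in> I \<Longrightarrow> g i - h i \<in> P \<and> g i \<in> S \<and> h i \<in> S) \<Longrightarrow> prod g I - prod h I \<in> P"
  by (induction I rule: infinite_finite_induct) (auto intro!: cong_mult_P)

end

locale prime_set_over = prime_set S P for S P :: "'a :: comm_ring_1 set" +
  fixes p :: nat
  assumes prime_p: "prime p" and p_P: "of_nat p \<in> P"
begin

lemma p_gt_0 [simp]: "p > 0" and p_ne_0 [simp]: "p \<noteq> 0"
  using prime_gt_0_nat[OF prime_p] by auto

lemma p_dvd_of_nat_P: "p dvd k \<Longrightarrow> of_nat k \<in> P"
  using mult_P'[OF p_P of_nat_S] by (auto elim!: dvdE)

text \<open>An integer prime to \<open>p\<close> generates \<open>1\<close> together with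
  \<open>p\<close>, and \<open>1\<close> is not in \<open>P\<close>.\<close>

lemma of_int_P_iff: "of_int k \<in> P \<longleftrightarrow> int p dvd k"
proof
  assume k: "of_int k \<in> P"
  show "int p dvd k"
  proof (rule ccontr)
    assume "\<not> int p dvd k"
    hence "coprime k (int p)"
      using prime_p by (metis coprime_commute prime_imp_coprime prime_nat_int_transfer)
    then obtain a b where "a * k + b * int p = 1"
      using bezout_int[of k "int p"] by (metis coprime_imp_gcd_eq_1)
    hence "of_int a * of_int k + of_int b * (of_nat p :: 'a) = 1"
      by (metis of_int_1 of_int_add of_int_mult of_int_of_nat_eq)
    moreover have "of_int a * of_int k + of_int b * (of_nat p :: 'a) \<in> P"
      using k p_P by auto
    ultimately show False using one_P by simp
  qed
next
  assume "int p dvd k"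
  then obtain m where "k = int p * m" by auto
  thus "of_int k \<in> P" using p_P by auto
qed

lemma fermat_P: "of_int k ^ p - (of_int k :: 'a) \<in> P"
proof -
  have "int p dvd k ^ p - k"
  proof (cases "int p dvd k")
    case True
    thus ?thesis by (intro dvd_diff dvd_trans[OF _ dvd_power[of p k]]) auto
  next
    case False
    define a where "a = nat (k mod int p)"
    have a: "int a = k mod int p" by (simp add: a_def)
    have "\<not> p dvd a" using False a by (metis dvd_mod_iff dvd_refl int_dvd_int_iff)
    hence "[a ^ (p - 1) = 1] (mod p)"
      using fermat_theorem[of p a] prime_p by simp
    hence "[a * a ^ (p - 1) = a * 1] (mod p)" by (rule cong_scalar_left)
    hence "[a ^ p = a] (mod p)"
      using p_gt_0 by (metis power_eq_if mult_1_right p_ne_0)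
    hence "[int a ^ p = int a] (mod int p)" by (metis cong_int_iff of_nat_power)
    moreover have "[k = int a] (mod int p)" by (simp add: a cong_def)
    hence "[k ^ p = int a ^ p] (mod int p)" by (rule cong_pow)
    ultimately have "[k ^ p = k] (mod int p)"
      using \<open>[k = int a] (mod int p)\<close> by (meson cong_sym cong_trans)
    thus ?thesis by (simp add: cong_iff_dvd_diff)
  qed
  thus ?thesis using of_int_P_iff[of "k ^ p - k"] by simp
qed

text \<open>The inner binomial coefficients are divisible by \<open>p\<close>.\<close>

lemma frobenius_add_P:
  assumes "x \<in> S" "y \<in> S"
  shows "(x + y) ^ p - (x ^ p + y ^ p) \<in> P"
proof -
  let ?t = "\<lambda>k. of_nat (p choose k) * x ^ k * y ^ (p - k)"
  have "(x + y) ^ p = (\<Sum>k\<le>p. ?t k)" by (rule binomial_ring)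
  also have "{..p} = insert 0 (insert p {1..<p})" using p_gt_0 by auto
  also have "sum ?t \<dots> = y ^ p + (x ^ p + sum ?t {1..<p})"
    using p_gt_0 by (subst sum.insert) (auto simp: sum.insert)
  finally have "(x + y) ^ p - (x ^ p + y ^ p) = sum ?t {1..<p}" by simp
  moreover have "?t k \<in> P" if "k \<in> {1..<p}" for k
  proof -
    have "p dvd (p choose k)" using that prime_p by (intro dvd_choose_prime) auto
    hence "of_nat (p choose k) \<in> P" by (rule p_dvd_of_nat_P)
    thus ?thesis using assms by (auto simp: mult.assoc)
  qed
  ultimately show ?thesis by auto
qed

lemma frobenius_sum_P:
  assumes "\<And>i. i \<in> I \<Longrightarrow> g i \<in> S"
  shows "(sum g I) ^ p - (\<Sum>i\<in>I. g i ^ p) \<in> P"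
  using assms
proof (induction I rule: infinite_finite_induct)
  case (insert i I)
  have "(g i + sum g I) ^ p - (g i ^ p + sum g I ^ p) \<in> P"
    using insert by (intro frobenius_add_P) auto
  moreover have "(g i ^ p + sum g I ^ p) - (g i ^ p + (\<Sum>i\<in>I. g i ^ p)) \<in> P"
    using insert by auto
  ultimately show ?case using insert trans_P by (simp add: sum.insert)
qed (use p_gt_0 in \<open>simp_all add: power_0_left\<close>)

end

section \<open>Existence of a prime ideal above p in the ring of all algebraic integers\<close>

text \<open>Zorn's lemma gives a maximal element among the proper ideals containing
  \<open>p\<close>, and maximal ideals are prime. The set \<open>F\<close> is nonempty since
  \<open>p\<close> is not a unit of the algebraic integers.\<close>

lemma prime_over_exists:
  assumes "prime p"
  shows "\<exists>M. prime_set_over {x :: complex. algebraic_int x} M p"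
proof -
  let ?A = "{x :: complex. algebraic_int x}"
  interpret subring_set ?A by (rule subring_set_alg_ints)
  define F where "F = {I. I \<subseteq> ?A \<and> 1 \<notin> I \<and> of_nat p \<in> I \<and> 0 \<in> I \<and>
     (\<forall>x\<in>I. \<forall>y\<in>I. x + y \<in> I) \<and> (\<forall>x\<in>I. \<forall>a\<in>?A. a * x \<in> I)}"
  have FI: "I \<in> F" if "I \<subseteq> ?A" "1 \<notin> I" "of_nat p \<in> I" "0 \<in> I" "\<And>x y. x \<in> I \<Longrightarrow> y \<in> I \<Longrightarrow> x + y \<in> I"
      "\<And>x a. x \<in> I \<Longrightarrow> a \<in> ?A \<Longrightarrow> a * x \<in> I" for I
    using that by (simp add: F_def)
  have FD: "I \<subseteq> ?A" "1 \<notin> I" "of_nat p \<in> I" "0 \<in> I" if "I \<in> F" for I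
    using that by (simp_all add: F_def)
  have FD': "x + y \<in> I" if "I \<in> F" "x \<in> I" "y \<in> I" for I x y
    using that by (simp add: F_def)
  have FD'': "a * x \<in> I" if "I \<in> F" "x \<in> I" "a \<in> ?A" for I x a
    using that by (simp add: F_def)
  have p0: "p > 1" using assms prime_gt_1_nat by blast
  have "{a * of_nat p | a. a \<in> ?A} \<in> F"
  proof -
    have "1 \<notin> {a * of_nat p | a. a \<in> ?A}"
    proof
      assume "1 \<in> {a * of_nat p | a. a \<in> ?A}"
      then obtain a :: complex where a: "algebraic_int a" "a * of_nat p = 1" by auto
      \<comment> \<open>A rational algebraic integer is an integer, and \<open>1 / p\<close> is not
        one.\<close>
      hence "a = 1 / of_nat p" using p0 by (simp add: field_simps)
      hence "a \<in> \<rat>" by simp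
      hence "a \<in> \<int>" using a rational_algebraic_int_is_int by blast
      then obtain k where "a = of_int k" by (auto elim: Ints_cases)
      hence "complex_of_int (k * int p) = of_int 1" using a by simp
      hence "k * int p = 1" using of_int_eq_iff by blast
      have "int p dvd 1" using \<open>k * int p = 1\<close> by (metis dvd_triv_right)
      thus False using p0 by simp
    qed
    moreover have "of_nat p \<in> {a * of_nat p | a. a \<in> ?A}" by (auto intro!: exI[of _ 1])
    moreover have "0 \<in> {a * of_nat p | a. a \<in> ?A}" by (auto intro!: exI[of _ 0])
    moreover have "x + y \<in> {a * of_nat p | a. a \<in> ?A}"
      if xy: "x \<in> {a * of_nat p | a. a \<in> ?A}" "y \<in> {a * of_nat p | a. a \<in> ?A}" for x y
    proof -
      obtain a b where "x = a * of_nat p" "y = b * of_nat p" "a \<in> ?A" "b \<in> ?A" using xy by blast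
      thus ?thesis using plus_S[of a b] by (auto simp flip: distrib_right)
    qed
    moreover have "c * x \<in> {a * of_nat p | a. a \<in> ?A}"
      if xc: "x \<in> {a * of_nat p | a. a \<in> ?A}" "c \<in> ?A" for x c
    proof -
      obtain a where "x = a * of_nat p" "a \<in> ?A" using xc by blast
      thus ?thesis using mult_S[of c a] xc(2) by (auto simp flip: mult.assoc)
    qed
    moreover have "{a * of_nat p | a. a \<in> ?A} \<subseteq> ?A" using mult_S of_nat_S by auto
    ultimately show ?thesis by (intro FI)
  qed
  hence "F \<noteq> {}" by blast
  moreover have "\<Union>C \<in> F" if C: "C \<noteq> {}" "subset.chain F C" for C
  proof -
    have CF: "C \<subseteq> F" and lin: "\<And>U Y. U \<in> C \<Longrightarrow> Y \<in> C \<Longrightarrow> U \<subseteq> Y \<or> Y \<subseteq> U"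
      using C(2) by (auto simp: subset_chain_def)
    obtain U where U: "U \<in> C" "U \<in> F" using C(1) CF by blast
    have "x + y \<in> \<Union>C" if xy: "x \<in> \<Union>C" "y \<in> \<Union>C" for x y
    proof -
      obtain U Y where UY: "U \<in> C" "Y \<in> C" "x \<in> U" "y \<in> Y" using xy by blast
      then obtain Z where "Z \<in> C" "x \<in> Z" "y \<in> Z" using lin by blast
      thus ?thesis using CF FD'[of Z x y] by auto
    qed
    moreover have "a * x \<in> \<Union>C" if ax: "x \<in> \<Union>C" "a \<in> ?A" for a x
    proof -
      obtain Z where "Z \<in> C" "x \<in> Z" using ax by blast
      thus ?thesis using CF FD''[of Z x a] ax by auto
    qed
    moreover have "\<Union>C \<subseteq> ?A" "1 \<notin> \<Union>C" using CF FD(1,2) by (meson Sup_least UnionE in_mono)+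
    moreover have "of_nat p \<in> \<Union>C" "0 \<in> \<Union>C" using U FD(3,4) by auto
    ultimately show ?thesis by (intro FI)
  qed
  ultimately obtain M where M: "M \<in> F" "\<forall>I\<in>F. M \<subseteq> I \<longrightarrow> I = M"
    using subset_Zorn_nonempty[of F] by blast
  note Mp = FD[OF M(1)] FD'[OF M(1)] FD''[OF M(1)]
  \<comment> \<open>By maximality, \<open>M\<close> and any further algebraic integer
    \<open>x\<close> generate the unit ideal.\<close>
  have ext: "\<exists>m\<in>M. \<exists>a\<in>?A. m + a * x = 1" if x: "x \<in> ?A" "x \<notin> M" for x
  proof -
    define U where "U = {m + a * x | m a. m \<in> M \<and> a \<in> ?A}"
    have "m \<in> U" if "m \<in> M" for m
      unfolding U_def mem_Collect_eq using that by (intro exI[of _ m] exI[of _ 0]) auto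
    hence "M \<subseteq> U" by blast
    moreover have "x \<in> U"
      unfolding U_def mem_Collect_eq using Mp(4) by (intro exI[of _ 0] exI[of _ 1]) auto
    ultimately have "U \<notin> F" using M(2) x(2) by blast
    have 1: "U \<subseteq> ?A"
    proof
      fix u assume "u \<in> U"
      then obtain m a where "u = m + a * x" "m \<in> M" "a \<in> ?A" unfolding U_def by blast
      thus "u \<in> ?A" using plus_S[of m "a * x"] mult_S[of a x] Mp(1) x(1) by blast
    qed
    have 2: "u + v \<in> U" if uv: "u \<in> U" "v \<in> U" for u v
    proof -
      obtain m a m' a' where "u = m + a * x" "v = m' + a' * x" "m \<in> M" "m' \<in> M" "a \<in> ?A" "a' \<in> ?A"
        using uv unfolding U_def by blast
      hence "u + v = (m + m') + (a + a') * x" "m + m' \<in> M" "a + a' \<in> ?A"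
        using Mp(5) plus_S by (auto simp: algebra_simps)
      thus ?thesis unfolding U_def by blast
    qed
    have 3: "c * u \<in> U" if uv: "u \<in> U" "c \<in> ?A" for u c
    proof -
      obtain m a where u: "u = m + a * x" "m \<in> M" "a \<in> ?A"
        using uv(1) unfolding U_def by blast
      have "c * u = c * m + (c * a) * x" unfolding u(1) by (simp add: distrib_left mult.assoc)
      moreover have "c * m \<in> M" by (rule Mp(6)[OF u(2) uv(2)])
      moreover have "c * a \<in> ?A" by (rule mult_S[OF uv(2) u(3)])
      ultimately show ?thesis unfolding U_def by blast
    qed
    have "1 \<in> U"
    proof (rule ccontr)
      assume "1 \<notin> U"
      hence "U \<in> F" using \<open>M \<subseteq> U\<close> Mp(3,4) by (intro FI 1 2 3) auto
      thus False using \<open>U \<notin> F\<close> by simp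
    qed
    then obtain m a where "m \<in> M" "a \<in> ?A" "1 = m + a * x" unfolding U_def by blast
    thus ?thesis by metis
  qed
  have "prime_set ?A M"
  proof (unfold_locales)
    fix x y assume xy: "x \<in> ?A" "y \<in> ?A" "x * y \<in> M"
    show "x \<in> M \<or> y \<in> M"
    proof (rule ccontr)
      assume "\<not> (x \<in> M \<or> y \<in> M)"
      then obtain m a m' a' where m: "m \<in> M" "m' \<in> M" "a \<in> ?A" "a' \<in> ?A"
        "m + a * x = 1" "m' + a' * y = 1"
        using ext xy by meson
      have "1 = (m + a * x) * (m' + a' * y)" using m by simp
      also have "\<dots> = (m' + a' * y) * m + ((a * x) * m' + (a * a') * (x * y))"
        by (simp add: algebra_simps)
      also have "\<dots> \<in> M"
        using m xy by (intro Mp(5) Mp(6)[OF m(1)] Mp(6)[OF m(2)] Mp(6)[OF xy(3)] plus_S mult_S) (use Mp(1) in blast)+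
      finally show False using Mp by simp
    qed
  qed (use Mp in auto)
  thus ?thesis using assms Mp by (auto simp: prime_set_over_def prime_set_over_axioms_def)
qed

section \<open>Permutations of finite sets and cycle types\<close>

text \<open>Only the behaviour on \<open>A\<close> is prescribed: field automorphisms and
  \<open>x \<mapsto> x ^ p\<close> are in general not the identity outside the finite sets that they
  permute, so \<open>permutes\<close> would not fit.\<close>

locale fin_perm =
  fixes f :: "'a \<Rightarrow> 'a" and A :: "'a set"
  assumes finite_A: "finite A" and bij_A: "bij_betw f A A"
begin

lemma f_in [intro, simp]: "x \<in> A \<Longrightarrow> f x \<in> A"
  using bij_A by (auto simp: bij_betw_def)

lemma f_inj: "x \<in> A \<Longrightarrow> y \<in> A \<Longrightarrow> f x = f y \<Longrightarrow> x = y"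
  using bij_A by (auto simp: bij_betw_def inj_on_def)

lemma funpow_in [intro, simp]: "x \<in> A \<Longrightarrow> (f ^^ k) x \<in> A"
  by (induction k) auto

lemma funpow_inj: "x \<in> A \<Longrightarrow> y \<in> A \<Longrightarrow> (f ^^ k) x = (f ^^ k) y \<Longrightarrow> x = y"
proof (induction k)
  case (Suc k)
  thus ?case using f_inj[of "(f ^^ k) x" "(f ^^ k) y"] by simp
qed auto

lemma funpow_eq_diff: "x \<in> A \<Longrightarrow> i \<le> j \<Longrightarrow> (f ^^ i) x = (f ^^ j) x \<longleftrightarrow> (f ^^ (j - i)) x = x"
proof -
  assume x: "x \<in> A" and ij: "i \<le> j"
  have "(f ^^ j) x = (f ^^ (i + (j - i))) x" using ij by simp
  also have "\<dots> = (f ^^ i) ((f ^^ (j - i)) x)" by (simp add: funpow_add)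
  finally show ?thesis using funpow_inj[of x "(f ^^ (j - i)) x" i] x by auto
qed

text \<open>Two of the first \<open>card A + 1\<close> iterates coincide, and injectivity cancels
  the common initial steps.\<close>

lemma funpow_return: "x \<in> A \<Longrightarrow> \<exists>m>0. (f ^^ m) x = x"
proof -
  assume x: "x \<in> A"
  have "\<not> inj_on (\<lambda>m. (f ^^ m) x) {..card A}"
  proof
    assume "inj_on (\<lambda>m. (f ^^ m) x) {..card A}"
    hence "card {..card A} \<le> card A"
      using x finite_A by (intro card_inj_on_le) auto
    thus False by simp
  qed
  then obtain i j where "i \<noteq> j" "(f ^^ i) x = (f ^^ j) x" unfolding inj_on_def by blast
  then obtain i j where "i < j" "(f ^^ i) x = (f ^^ j) x" by (metis nat_neq_iff)
  thus ?thesis using funpow_eq_diff[OF x, of i j] by (intro exI[of _ "j - i"]) auto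
qed

definition per :: "'a \<Rightarrow> nat" where "per x = (LEAST m. m > 0 \<and> (f ^^ m) x = x)"

lemma per: "x \<in> A \<Longrightarrow> per x > 0" "x \<in> A \<Longrightarrow> (f ^^ per x) x = x"
  using LeastI_ex[OF funpow_return[of x]] by (auto simp: per_def)

lemma per_least: "0 < m \<Longrightarrow> m < per x \<Longrightarrow> (f ^^ m) x \<noteq> x"
  using not_less_Least[of m "\<lambda>m. m > 0 \<and> (f ^^ m) x = x"] by (auto simp: per_def)

lemma funpow_per_mult: "x \<in> A \<Longrightarrow> (f ^^ (per x * k)) x = x"
  by (induction k) (auto simp: funpow_add per)

lemma funpow_mod_per: "x \<in> A \<Longrightarrow> (f ^^ (k mod per x)) x = (f ^^ k) x"
proof -
  assume x: "x \<in> A"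
  have "(f ^^ k) x = (f ^^ (k mod per x + per x * (k div per x))) x" by simp
  also have "\<dots> = (f ^^ (k mod per x)) x"
    by (simp only: funpow_add o_apply funpow_per_mult[OF x])
  finally show ?thesis by simp
qed

lemma funpow_fix_iff_per: "x \<in> A \<Longrightarrow> (f ^^ m) x = x \<longleftrightarrow> per x dvd m"
proof
  assume x: "x \<in> A" and "(f ^^ m) x = x"
  hence "(f ^^ (m mod per x)) x = x" using funpow_mod_per by simp
  hence "m mod per x = 0" using per_least[of "m mod per x" x] per(1)[OF x] by auto
  thus "per x dvd m" by auto
qed (auto simp: funpow_per_mult elim!: dvdE)

lemma orbit_eq_per: "x \<in> A \<Longrightarrow> orbit f x = (\<lambda>k. (f ^^ k) x) ` {..<per x}"
proof
  assume x: "x \<in> A"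
  show "orbit f x \<subseteq> (\<lambda>k. (f ^^ k) x) ` {..<per x}"
  proof
    fix y assume "y \<in> orbit f x"
    then obtain k where "y = (f ^^ k) x" by (auto simp: orbit_altdef)
    thus "y \<in> (\<lambda>k. (f ^^ k) x) ` {..<per x}"
      using funpow_mod_per[OF x, of k] per(1)[OF x] by (intro image_eqI[of _ _ "k mod per x"]) auto
  qed
  show "(\<lambda>k. (f ^^ k) x) ` {..<per x} \<subseteq> orbit f x"
  proof
    fix y assume "y \<in> (\<lambda>k. (f ^^ k) x) ` {..<per x}"
    then obtain k where "y = (f ^^ k) x" by auto
    \<comment> \<open>\<open>orbit f x\<close> consists of the iterates with positive exponent;
      adding a full period makes \<open>k\<close> positive.\<close>
    hence "y = (f ^^ (k + per x)) x" using per(2)[OF x] by (simp add: funpow_add)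
    thus "y \<in> orbit f x" using per(1)[OF x] by (auto simp: orbit_altdef)
  qed
qed

lemma card_orbit: "x \<in> A \<Longrightarrow> card (orbit f x) = per x"
proof -
  assume x: "x \<in> A"
  have "inj_on (\<lambda>k. (f ^^ k) x) {..<per x}"
  proof (rule linorder_inj_onI)
    fix i j assume ij: "i < j" "i \<in> {..<per x}" "j \<in> {..<per x}"
    thus "(f ^^ i) x \<noteq> (f ^^ j) x"
      using funpow_eq_diff[OF x, of i j] per_least[of "j - i" x] by auto
  qed auto
  thus ?thesis using card_image orbit_eq_per[OF x] by fastforce
qed

lemma funpow_fix_iff: "x \<in> A \<Longrightarrow> (f ^^ m) x = x \<longleftrightarrow> card (orbit f x) dvd m"
  using funpow_fix_iff_per card_orbit by simp

lemma card_orbit_pos: "x \<in> A \<Longrightarrow> card (orbit f x) > 0"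
  using card_orbit per by simp

lemma self_in_orbit: "x \<in> A \<Longrightarrow> x \<in> orbit f x"
  using orbit_eq_per[of x] per(1)[of x] by (auto intro!: image_eqI[of _ _ 0])

lemma orbit_sub: "x \<in> A \<Longrightarrow> orbit f x \<subseteq> A"
  using orbit_eq_per[of x] by auto

lemma orbit_funpow: "x \<in> A \<Longrightarrow> y \<in> orbit f x \<Longrightarrow> \<exists>k. y = (f ^^ k) x"
  using orbit_eq_per[of x] by auto

lemma orbit_eq: "x \<in> A \<Longrightarrow> y \<in> orbit f x \<Longrightarrow> orbit f y = orbit f x"
proof -
  assume x: "x \<in> A" and y: "y \<in> orbit f x"
  obtain k where k: "y = (f ^^ k) x" using orbit_funpow[OF x y] by blast
  \<comment> \<open>Any multiple of the period that is at least \<open>k\<close> allows forward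
    iteration to undo \<open>k\<close> steps.\<close>
  have "x = (f ^^ (per x * Suc k - k)) y"
  proof -
    have le: "k \<le> per x * Suc k" using per(1)[OF x] by (cases "per x") auto
    have "(f ^^ (per x * Suc k - k)) y = (f ^^ (per x * Suc k - k + k)) x"
      unfolding k by (simp only: funpow_add o_apply)
    also have "\<dots> = x" using le funpow_per_mult[OF x, of "Suc k"] by simp
    finally show ?thesis by simp
  qed
  moreover have "y \<in> A" using y orbit_sub[OF x] by auto
  ultimately have "x \<in> orbit f y"
    using self_in_orbit[of y] funpow_in_orbit by metis
  show ?thesis
  proof
    show "orbit f y \<subseteq> orbit f x" using y orbit_trans by fast
    show "orbit f x \<subseteq> orbit f y" using \<open>x \<in> orbit f y\<close> orbit_trans by fast
  qed
qed

lemma f_orbit: "x \<in> A \<Longrightarrow> orbit f (f x) = orbit f x"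
  using orbit_eq[of x "f x"] by (auto intro: orbit.base)

lemma funpow_eq_iff: "x \<in> A \<Longrightarrow> (f ^^ i) x = (f ^^ j) x \<longleftrightarrow> i mod card (orbit f x) = j mod card (orbit f x)"
proof -
  assume x: "x \<in> A"
  have *: "(f ^^ i) x = (f ^^ j) x \<longleftrightarrow> i mod per x = j mod per x" if "i \<le> j" for i j
  proof -
    have "(f ^^ i) x = (f ^^ j) x \<longleftrightarrow> per x dvd (j - i)"
      using funpow_eq_diff[OF x that] funpow_fix_iff_per[OF x] by simp
    also have "\<dots> \<longleftrightarrow> i mod per x = j mod per x"
      using that by (metis mod_eq_dvd_iff_nat)
    finally show ?thesis .
  qed
  show ?thesis using *[of i j] *[of j i] card_orbit[OF x] by (cases "i \<le> j") auto
qed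

lemma finite_orbits: "finite (orbit f ` A)"
  using finite_A by auto

lemma orbits_union: "\<Union>(orbit f ` A) = A"
  using orbit_sub self_in_orbit by blast

lemma orbits_disjoint: "o1 \<in> orbit f ` A \<Longrightarrow> o2 \<in> orbit f ` A \<Longrightarrow> o1 \<noteq> o2 \<Longrightarrow> o1 \<inter> o2 = {}"
  using orbit_eq by blast

lemma sum_cycle_type: "sum_mset (cycle_type f A) = card A"
proof -
  have "sum_mset (cycle_type f A) = (\<Sum>W\<in>orbit f ` A. card W)"
    by (simp add: cycle_type_def sum_unfold_sum_mset)
  also have "\<dots> = card (\<Union>(orbit f ` A))"
    using orbit_sub finite_A orbits_disjoint
    by (intro card_Union_disjoint[symmetric]) (auto simp: pairwise_def disjnt_def intro: finite_subset)
  finally show ?thesis using orbits_union by simp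
qed

lemma count_cycle_type: "count (cycle_type f A) i = card {W \<in> orbit f ` A. card W = i}"
proof -
  have "count (cycle_type f A) i = sum (count (mset_set (orbit f ` A))) (card -` {i} \<inter> orbit f ` A)"
    by (simp only: cycle_type_def count_image_mset finite_set_mset_mset_set[OF finite_orbits])
  also have "card -` {i} \<inter> orbit f ` A = {x \<in> orbit f ` A. card x = i}" by blast
  also have "sum (count (mset_set (orbit f ` A))) {x \<in> orbit f ` A. card x = i} = (\<Sum>x\<in>{x \<in> orbit f ` A. card x = i}. 1)"
    using finite_orbits by (intro sum.cong) auto
  finally show ?thesis by simp
qed

lemma card_eq_orbits: "card {x \<in> A. card (orbit f x) = i} = i * card {W \<in> orbit f ` A. card W = i}"
proof -
  let ?S = "{W \<in> orbit f ` A. card W = i}"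
  have "{x \<in> A. card (orbit f x) = i} = \<Union>?S"
  proof (intro equalityI subsetI)
    fix x assume "x \<in> {x \<in> A. card (orbit f x) = i}"
    thus "x \<in> \<Union>?S" using self_in_orbit[of x] by blast
  next
    fix x assume "x \<in> \<Union>?S"
    then obtain y where y: "y \<in> A" "card (orbit f y) = i" "x \<in> orbit f y" by blast
    thus "x \<in> {x \<in> A. card (orbit f x) = i}"
      using orbit_sub[OF y(1)] orbit_eq[OF y(1,3)] by auto
  qed
  moreover have "card (\<Union>?S) = (\<Sum>W\<in>?S. card W)"
    using orbit_sub finite_A orbits_disjoint
    by (intro card_Union_disjoint) (auto simp: pairwise_def disjnt_def intro: finite_subset)
  ultimately show ?thesis by simp
qed

end

section \<open>Equivariant maps and conjugacy of permutations\<close>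

lemma equivariant_funpow:
  assumes "fin_perm f A" "\<And>x. x \<in> A \<Longrightarrow> h (f x) = g (h x)" "x \<in> A"
  shows "h ((f ^^ k) x) = (g ^^ k) (h x)"
proof (induction k)
  case (Suc k)
  have "(f ^^ k) x \<in> A" using assms fin_perm.funpow_in by metis
  thus ?case using Suc assms(2) by simp
qed auto

lemma equivariant_orbit:
  assumes "fin_perm f A" "\<And>x. x \<in> A \<Longrightarrow> h (f x) = g (h x)" "x \<in> A"
  shows "orbit g (h x) = h ` orbit f x"
proof -
  have "h ((f ^^ k) x) = (g ^^ k) (h x)" for k
    using equivariant_funpow[of f A h g x k] assms by blast
  thus ?thesis unfolding orbit_altdef by (auto simp: image_iff) metis
qed

lemma equivariant_orbits:
  assumes "fin_perm f A" "\<And>x. x \<in> A \<Longrightarrow> h (f x) = g (h x)"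
  shows "orbit g ` (h ` A) = (\<lambda>W. h ` W) ` (orbit f ` A)"
proof -
  have "orbit g (h x) = h ` orbit f x" if "x \<in> A" for x
    using equivariant_orbit[of f A h g x] assms that by blast
  thus ?thesis by (auto simp: image_iff)
qed

lemma fin_perm_equivariant:
  assumes "fin_perm f A" "\<And>x. x \<in> A \<Longrightarrow> h (f x) = g (h x)" "inj_on h A"
  shows "fin_perm g (h ` A)"
proof -
  interpret fin_perm f A by fact
  have "g ` h ` A = h ` f ` A" using assms(2) by (auto simp: image_iff)
  hence "g ` h ` A = h ` A" using bij_A by (simp add: bij_betw_def)
  thus ?thesis using finite_A
    by unfold_locales (auto simp: bij_betw_def intro!: eq_card_imp_inj_on)
qed

text \<open>Injectivity keeps distinct orbits distinct and preserves their sizes. This transports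
  cycle types between the roots of a polynomial, their representatives modulo \<open>M\<close> and
  the embeddings of a field.\<close>

lemma cycle_type_equivariant:
  assumes "fin_perm f A" "\<And>x. x \<in> A \<Longrightarrow> h (f x) = g (h x)" "inj_on h A"
  shows "cycle_type g (h ` A) = cycle_type f A"
proof -
  interpret fin_perm f A by fact
  have inj: "inj_on (\<lambda>W. h ` W) (orbit f ` A)"
    using assms(3) orbit_sub by (intro inj_onI) (metis (no_types, lifting) imageE inj_on_image_eq_iff)
  have "cycle_type g (h ` A) = image_mset card (mset_set ((\<lambda>W. h ` W) ` (orbit f ` A)))"
    using equivariant_orbits[of f A h g] assms(1,2) by (simp add: cycle_type_def)
  also have "\<dots> = image_mset (\<lambda>W. card (h ` W)) (mset_set (orbit f ` A))"
    using inj by (simp add: image_mset_mset_set[symmetric] multiset.map_comp o_def)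
  also have "\<dots> = image_mset card (mset_set (orbit f ` A))"
  proof (rule image_mset_cong)
    fix S assume "S \<in># mset_set (orbit f ` A)"
    hence "S \<subseteq> A" using orbit_sub finite_orbits by auto
    thus "card (h ` S) = card S" using assms(3) by (meson card_image inj_on_subset)
  qed
  finally show ?thesis by (simp add: cycle_type_def)
qed

lemma cycle_type_cong:
  assumes "fin_perm f A" "\<And>x. x \<in> A \<Longrightarrow> f x = g x"
  shows "cycle_type g A = cycle_type f A" "fin_perm g A"
  using cycle_type_equivariant[OF assms(1), of "\<lambda>x. x" g] fin_perm_equivariant[OF assms(1), of "\<lambda>x. x" g]
    assms(2) by auto

lemma cycle_type_Un:
  assumes "fin_perm f A" "fin_perm f B" "A \<inter> B = {}"
  shows "cycle_type f (A \<union> B) = cycle_type f A + cycle_type f B" "fin_perm f (A \<union> B)"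
proof -
  interpret A: fin_perm f A by fact
  interpret B: fin_perm f B by fact
  have "orbit f ` A \<inter> orbit f ` B = {}"
    using A.orbit_sub B.orbit_sub A.self_in_orbit assms(3) by blast
  thus "cycle_type f (A \<union> B) = cycle_type f A + cycle_type f B"
    unfolding cycle_type_def image_Un using A.finite_orbits B.finite_orbits
    by (subst mset_set_Union) auto
  show "fin_perm f (A \<union> B)"
    using A.finite_A B.finite_A bij_betw_combine[OF A.bij_A B.bij_A assms(3)] by unfold_locales auto
qed

text \<open>Matched elements are removed one at a time. Applied with \<open>card\<close> on both
  sides, this pairs the orbits of two permutations of equal cycle type.\<close>

lemma image_mset_eq_imp_bij:
  assumes "finite U" "finite Y" "image_mset k (mset_set U) = image_mset k' (mset_set Y)"
  shows "\<exists>\<beta>. bij_betw \<beta> U Y \<and> (\<forall>x\<in>U. k' (\<beta> x) = k x)"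
  using assms
proof (induction U arbitrary: Y rule: finite_induct)
  case empty
  hence "mset_set Y = {#}" by simp
  hence "Y = {}" using empty by (simp add: mset_set_empty_iff)
  thus ?case by (intro exI[of _ "\<lambda>_. undefined"]) (auto simp: bij_betw_def)
next
  case (insert x S)
  hence "k x \<in># image_mset k' (mset_set Y)" by (metis finite.insertI finite_set_mset_mset_set image_eqI insertI1 set_image_mset)
  then obtain y where y: "y \<in> Y" "k' y = k x" using insert.prems by auto
  have "mset_set Y = add_mset y (mset_set (Y - {y}))"
    using y insert.prems by (intro mset_set.remove) auto
  hence "image_mset k (mset_set S) = image_mset k' (mset_set (Y - {y}))"
    using insert y by simp
  then obtain \<beta> where \<beta>: "bij_betw \<beta> S (Y - {y})" "\<forall>z\<in>S. k' (\<beta> z) = k z"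
    using insert.IH[of "Y - {y}"] insert.prems by auto
  have "bij_betw (\<beta>(x := y)) S (Y - {y})"
    using \<beta>(1) insert.hyps(2) by (subst bij_betw_cong[of S _ \<beta>]) auto
  hence "bij_betw (\<beta>(x := y)) (S \<union> {x}) ((Y - {y}) \<union> {y})"
    by (rule bij_betw_combine) auto
  moreover have "(Y - {y}) \<union> {y} = Y" "S \<union> {x} = insert x S" using y by auto
  ultimately have "bij_betw (\<beta>(x := y)) (insert x S) Y" by simp
  moreover have "\<forall>z\<in>insert x S. k' ((\<beta>(x := y)) z) = k z" using \<beta>(2) y insert.hyps(2) by auto
  ultimately show ?case by blast
qed

text \<open>Match the orbits by size, choose a base point in each, and send the \<open>k\<close>-th
  iterate of a base point to the \<open>k\<close>-th iterate of its counterpart.\<close>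

lemma cycle_type_eq_imp_conjugate:
  assumes "fin_perm f A" "fin_perm g B" "cycle_type f A = cycle_type g B"
  shows "\<exists>h. bij_betw h A B \<and> (\<forall>x\<in>A. h (f x) = g (h x))"
proof -
  interpret A: fin_perm f A by fact
  interpret B: fin_perm g B by fact
  obtain \<beta> where \<beta>: "bij_betw \<beta> (orbit f ` A) (orbit g ` B)"
      "\<And>W. W \<in> orbit f ` A \<Longrightarrow> card (\<beta> W) = card W"
    using image_mset_eq_imp_bij[OF A.finite_orbits B.finite_orbits, of card card] assms(3)
    unfolding cycle_type_def by blast
  define b where "b W = (SOME x. x \<in> W \<and> x \<in> A)" for W
  define b' where "b' W = (SOME x. x \<in> W \<and> x \<in> B)" for W
  define k where "k x = (SOME k. (f ^^ k) (b (orbit f x)) = x)" for x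
  define h where "h x = (g ^^ k x) (b' (\<beta> (orbit f x)))" for x
  have b: "b (orbit f x) \<in> A" "orbit f (b (orbit f x)) = orbit f x" if x: "x \<in> A" for x
  proof -
    have "b (orbit f x) \<in> orbit f x \<and> b (orbit f x) \<in> A"
      unfolding b_def using A.self_in_orbit[OF x] x
      by (intro someI[of "\<lambda>y. y \<in> orbit f x \<and> y \<in> A" x] conjI)
    thus "b (orbit f x) \<in> A" "orbit f (b (orbit f x)) = orbit f x"
      using A.orbit_eq[OF x] by auto
  qed
  have k: "(f ^^ k x) (b (orbit f x)) = x" if x: "x \<in> A" for x
  proof -
    have "\<exists>k. (f ^^ k) (b (orbit f x)) = x"
      using A.orbit_funpow[OF b(1)[OF x], of x] b(2)[OF x] A.self_in_orbit[OF x] by metis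
    thus ?thesis unfolding k_def by (rule someI_ex)
  qed
  have b': "b' (\<beta> (orbit f x)) \<in> B" "orbit g (b' (\<beta> (orbit f x))) = \<beta> (orbit f x)" if x: "x \<in> A" for x
  proof -
    have "\<beta> (orbit f x) \<in> orbit g ` B" using \<beta>(1) x by (auto simp: bij_betw_def)
    then obtain y where y: "y \<in> B" "\<beta> (orbit f x) = orbit g y" by auto
    have "b' (orbit g y) \<in> orbit g y \<and> b' (orbit g y) \<in> B"
      unfolding b'_def using B.self_in_orbit[OF y(1)] y
      by (intro someI[of "\<lambda>z. z \<in> orbit g y \<and> z \<in> B" y] conjI)
    thus "b' (\<beta> (orbit f x)) \<in> B" "orbit g (b' (\<beta> (orbit f x))) = \<beta> (orbit f x)"
      using B.orbit_eq[OF y(1)] y by auto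
  qed
  have hB: "h x \<in> B" "orbit g (h x) = \<beta> (orbit f x)" if x: "x \<in> A" for x
  proof -
    show "h x \<in> B" unfolding h_def using b'[OF x] by simp
    have "h x \<in> orbit g (b' (\<beta> (orbit f x)))"
      unfolding h_def using B.self_in_orbit[OF b'(1)[OF x]] by (rule funpow_in_orbit)
    thus "orbit g (h x) = \<beta> (orbit f x)" using B.orbit_eq[OF b'(1)[OF x]] b'(2)[OF x] by simp
  qed
  \<comment> \<open>On either side equality of iterates means equality of the exponents modulo the
    orbit size, and matched orbits have the same size. This gives independence of the chosen
    exponent as well as injectivity.\<close>
  have transfer: "(f ^^ i) (b (orbit f x)) = (f ^^ j) (b (orbit f x)) \<longleftrightarrow>
      (g ^^ i) (b' (\<beta> (orbit f x))) = (g ^^ j) (b' (\<beta> (orbit f x)))" if x: "x \<in> A" for x i j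
    using A.funpow_eq_iff[OF b(1)[OF x], of i j] B.funpow_eq_iff[OF b'(1)[OF x], of i j]
      b(2)[OF x] b'(2)[OF x] \<beta>(2)[of "orbit f x"] x by simp
  have equiv: "h (f x) = g (h x)" if x: "x \<in> A" for x
  proof -
    have "(f ^^ k (f x)) (b (orbit f x)) = (f ^^ Suc (k x)) (b (orbit f x))"
      using k[OF x] k[of "f x"] A.f_orbit[OF x] x by simp
    hence "(g ^^ k (f x)) (b' (\<beta> (orbit f x))) = (g ^^ Suc (k x)) (b' (\<beta> (orbit f x)))"
      using transfer[OF x] by blast
    thus ?thesis unfolding h_def A.f_orbit[OF x] by simp
  qed
  have inj: "inj_on h A"
  proof (rule inj_onI)
    fix x y assume x: "x \<in> A" and y: "y \<in> A" and eq: "h x = h y"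
    have "\<beta> (orbit f x) = \<beta> (orbit f y)" using hB(2)[OF x] hB(2)[OF y] eq by simp
    hence o: "orbit f x = orbit f y" using \<beta>(1) x y by (auto simp: bij_betw_def inj_on_def)
    have "(f ^^ k x) (b (orbit f x)) = (f ^^ k y) (b (orbit f x))"
      using transfer[OF x, of "k x" "k y"] eq o unfolding h_def by simp
    also have "\<dots> = y" unfolding o by (rule k[OF y])
    finally show "x = y" unfolding k[OF x] .
  qed
  have "card A = card B" using A.sum_cycle_type B.sum_cycle_type assms(3) by simp
  moreover have "h ` A \<subseteq> B" using hB by auto
  ultimately have "h ` A = B" using inj B.finite_A by (metis card_image card_subset_eq)
  thus ?thesis using inj equiv unfolding bij_betw_def by blast
qed

section \<open>Permutations of prescribed cycle type\<close>

text \<open>The successor modulo \<open>card A\<close> is transported along an enumeration of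
  \<open>A\<close>.\<close>

lemma ex_single_cycle:
  assumes "finite A" "card A > 0"
  shows "\<exists>f. fin_perm f A \<and> cycle_type f A = {#card A#}"
proof -
  define m where "m = card A"
  have m: "m > 0" using assms by (simp add: m_def)
  define s where "s = (\<lambda>i. Suc i mod m)"
  have "inj_on s {..<m}"
  proof (rule inj_onI)
    fix x y assume "x \<in> {..<m}" "y \<in> {..<m}" "s x = s y"
    thus "x = y" unfolding s_def by (auto simp: mod_Suc split: if_splits)
  qed
  moreover have "s ` {..<m} \<subseteq> {..<m}" using m by (auto simp: s_def)
  ultimately have "bij_betw s {..<m} {..<m}"
    by (simp add: bij_betw_def endo_inj_surj)
  then interpret s: fin_perm s "{..<m}" by unfold_locales auto
  have pow: "(s ^^ k) 0 = k mod m" for k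
    by (induction k) (use m in \<open>auto simp: s_def mod_Suc_eq\<close>)
  have "i \<in> orbit s 0" if "i < m" for i
    using funpow_in_orbit[OF s.self_in_orbit[of 0], of i] that m pow by simp
  hence "orbit s 0 = {..<m}" using s.orbit_sub[of 0] m by auto
  hence "orbit s i = {..<m}" if "i < m" for i using s.orbit_eq[of 0 i] that m by auto
  hence "orbit s ` {..<m} = {{..<m}}" using m by auto
  hence ct: "cycle_type s {..<m} = {#m#}" by (simp add: cycle_type_def)
  obtain h where h: "bij_betw h {..<m} A"
    using ex_bij_betw_nat_finite[OF assms(1)] by (auto simp: atLeast0LessThan m_def)
  define f where "f = (\<lambda>x. h (s (inv_into {..<m} h x)))"
  have "h (s i) = f (h i)" if "i \<in> {..<m}" for i
    using h that unfolding f_def by (simp add: bij_betw_inv_into_left)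
  hence "cycle_type f (h ` {..<m}) = {#m#}" "fin_perm f (h ` {..<m})"
    using cycle_type_equivariant[OF s.fin_perm_axioms, of h f] ct h
      fin_perm_equivariant[OF s.fin_perm_axioms, of h f] by (auto simp: bij_betw_def)
  thus ?thesis using h by (auto simp: bij_betw_def m_def)
qed

lemma ex_perm_of_cycle_type:
  assumes "finite A" "0 \<notin># \<mu>" "sum_mset \<mu> = card A"
  shows "\<exists>f. fin_perm f A \<and> cycle_type f A = \<mu>"
  using assms
proof (induction \<mu> arbitrary: A)
  case empty
  hence "A = {}" by simp
  thus ?case by (auto simp: cycle_type_def fin_perm_def)
next
  case (add m \<mu>)
  then obtain B where B: "B \<subseteq> A" "card B = m"
    by (metis le_add1 obtain_subset_with_card_n sum_mset.add_mset)
  have fin: "finite B" "finite (A - B)" using B add.prems finite_subset by auto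
  have "card (A - B) = sum_mset \<mu>" using B add.prems fin by (simp add: card_Diff_subset)
  then obtain f where f: "fin_perm f (A - B)" "cycle_type f (A - B) = \<mu>"
    using add.IH[of "A - B"] add.prems fin by auto
  obtain g where g: "fin_perm g B" "cycle_type g B = {#m#}"
    using ex_single_cycle[OF fin(1)] B(2) add.prems by auto
  define h where "h x = (if x \<in> B then g x else f x)" for x
  have "fin_perm h (A - B)" "cycle_type h (A - B) = \<mu>" "fin_perm h B" "cycle_type h B = {#m#}"
    using cycle_type_cong[OF f(1), of h] cycle_type_cong[OF g(1), of h] f g by (auto simp: h_def)
  moreover have "(A - B) \<union> B = A" using B by auto
  ultimately show ?case using cycle_type_Un[of h "A - B" B] by auto
qed

lemma (in fin_perm) cycle_type_singleton:
  assumes "cycle_type f A = {#m#}" "x \<in> A"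
  shows "orbit f x = A"
proof -
  have "card (orbit f x) \<in># cycle_type f A" using assms(2) finite_orbits by (auto simp: cycle_type_def)
  hence "card (orbit f x) = card A" using assms(1) sum_cycle_type by auto
  thus ?thesis using orbit_sub[OF assms(2)] finite_A card_subset_eq by blast
qed

lemma (in fin_perm) ex_orbit_of_card: "m \<in># cycle_type f A \<Longrightarrow> \<exists>x\<in>A. card (orbit f x) = m"
  using finite_orbits by (auto simp: cycle_type_def)

lemma (in fin_perm) two_orbits_cycle_type:
  assumes "W \<in> orbit f ` A" "W' \<in> orbit f ` A" "W \<noteq> W'"
  shows "{#card W, card W'#} \<subseteq># cycle_type f A"
proof -
  have "mset_set {W, W'} \<subseteq># mset_set (orbit f ` A)"
    using assms finite_orbits by (intro subset_imp_msubset_mset_set) auto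
  hence "image_mset card (mset_set {W, W'}) \<subseteq># cycle_type f A"
    unfolding cycle_type_def by (rule image_mset_subseteq_mono)
  thus ?thesis using assms(3) by simp
qed

text \<open>For \<open>m = 1\<close> both orbits are singletons and cannot be told apart by their
  size. Hence the argument compares the contribution of two distinct orbits with the multiset of
  sizes.\<close>

lemma (in fin_perm) fixed_and_cycle:
  assumes "cycle_type f A = {#1, m#}"
  shows "\<exists>a\<in>A. f a = a \<and> (\<forall>x\<in>A - {a}. orbit f x = A - {a})"
proof -
  obtain a where a: "a \<in> A" "card (orbit f a) = 1" using assms ex_orbit_of_card[of 1] by auto
  hence fa: "f a = a" using funpow_fix_iff[of a 1] by simp
  have oa: "orbit f a = {a}" using fa orbit_eq_singleton_iff by metis
  have cA: "card A = m + 1" using sum_cycle_type assms by simp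
  have "orbit f x = A - {a}" if x: "x \<in> A" "x \<noteq> a" for x
  proof -
    have ne: "orbit f x \<noteq> orbit f a" using x self_in_orbit[OF x(1)] oa by auto
    hence sub: "orbit f x \<subseteq> A - {a}" using orbit_sub[OF x(1)] orbit_eq[OF x(1)] by blast
    have "{#card (orbit f a), card (orbit f x)#} \<subseteq># cycle_type f A"
      using ne a x by (intro two_orbits_cycle_type) auto
    hence "{#card (orbit f x)#} \<subseteq># {#m#}" using a(2) assms by simp
    hence "card (orbit f x) = m" by simp
    thus ?thesis using sub cA a finite_A by (intro card_subset_eq) auto
  qed
  thus ?thesis using a fa by auto
qed

lemma (in fin_perm) transposition_of_type:
  assumes "cycle_type f A = add_mset 2 (replicate_mset m 1)"
  shows "\<exists>u\<in>A. \<exists>v\<in>A. u \<noteq> v \<and> f u = v \<and> f v = u \<and> (\<forall>x\<in>A - {u, v}. f x = x)"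
proof -
  obtain u where u: "u \<in> A" "card (orbit f u) = 2" using assms ex_orbit_of_card[of 2] by auto
  have "\<not> (f ^^ 1) u = u" "(f ^^ 2) u = u" using funpow_fix_iff[OF u(1), of 1] funpow_fix_iff[OF u(1), of 2] u(2) by simp_all
  hence fu: "f u \<noteq> u" "f (f u) = u" by (simp_all add: numeral_2_eq_2)
  have ou: "orbit f u = {u, f u}"
    using u fu orbit.base[of f u] self_in_orbit[OF u(1)]
    by (metis card_2_iff doubleton_eq_iff insert_iff singletonD)
  have "f x = x" if x: "x \<in> A" "x \<noteq> u" "x \<noteq> f u" for x
  proof -
    have ne: "orbit f x \<noteq> orbit f u" using x self_in_orbit[OF x(1)] ou by auto
    have "{#card (orbit f u), card (orbit f x)#} \<subseteq># cycle_type f A"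
      using ne u x by (intro two_orbits_cycle_type) auto
    hence "{#card (orbit f x)#} \<subseteq># replicate_mset m 1" using u(2) assms by simp
    hence "card (orbit f x) = 1"
      using mset_subset_eqD[of "{#card (orbit f x)#}" _ "card (orbit f x)"] by (auto split: if_splits)
    thus ?thesis using funpow_fix_iff[OF x(1), of 1] by simp
  qed
  thus ?thesis using u fu f_in[OF u(1)] by (intro bexI[of _ u] bexI[of _ "f u"]) auto
qed

section \<open>Polynomials over a ring modulo a prime ideal\<close>

text \<open>A polynomial serves as a container for finitely many elements that are to be handled
  simultaneously. The coefficient type is arbitrary, so the construction can be iterated.\<close>

definition polys_over :: "'a :: comm_ring_1 set \<Rightarrow> 'a poly set" where
  "polys_over S = {q. \<forall>i. coeff q i \<in> S}"

lemma (in subring_set) subring_polys_over: "subring_set (polys_over S)"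
  by unfold_locales (auto simp: polys_over_def coeff_mult coeff_1)

text \<open>Gauss's lemma: if \<open>i\<close> and \<open>j\<close> are the lowest positions with
  coefficients outside \<open>P\<close>, then modulo \<open>P\<close> the coefficient of the product
  at \<open>i + j\<close> is the product of these two coefficients.\<close>

lemma (in prime_set) prime_polys_over: "prime_set (polys_over S) (polys_over P)"
proof -
  interpret pol: subring_set "polys_over S" by (rule subring_polys_over)
  show ?thesis
  proof unfold_locales
    show "polys_over P \<subseteq> polys_over S" using P_sub by (auto simp: polys_over_def)
    have "coeff 1 0 \<notin> P" using one_P by simp
    thus "1 \<notin> polys_over P" unfolding polys_over_def by blast
    show "a * q \<in> polys_over P" if "q \<in> polys_over P" "a \<in> polys_over S" for q a
      using that by (auto simp: polys_over_def coeff_mult)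
    fix q r assume q: "q \<in> polys_over S" and r: "r \<in> polys_over S" and qr: "q * r \<in> polys_over P"
    show "q \<in> polys_over P \<or> r \<in> polys_over P"
    proof (rule ccontr)
      assume "\<not> ?thesis"
      hence ex: "\<exists>i. coeff q i \<notin> P" "\<exists>i. coeff r i \<notin> P" by (auto simp: polys_over_def)
      define i where "i = (LEAST i. coeff q i \<notin> P)"
      define j where "j = (LEAST i. coeff r i \<notin> P)"
      have i: "coeff q i \<notin> P" "\<And>k. k < i \<Longrightarrow> coeff q k \<in> P"
        using LeastI_ex[OF ex(1)] not_less_Least unfolding i_def by blast+
      have j: "coeff r j \<notin> P" "\<And>k. k < j \<Longrightarrow> coeff r k \<in> P"
        using LeastI_ex[OF ex(2)] not_less_Least unfolding j_def by blast+
      let ?t = "\<lambda>k. coeff q k * coeff r (i + j - k)"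
      have "coeff (q * r) (i + j) = sum ?t {..i + j}" by (simp add: coeff_mult)
      also have "\<dots> = ?t i + sum ?t ({..i + j} - {i})" by (subst sum.remove[of _ i]) auto
      finally have "?t i = coeff (q * r) (i + j) - sum ?t ({..i + j} - {i})" by simp
      moreover have "?t k \<in> P" if "k \<in> {..i + j} - {i}" for k
      proof (cases "k < i")
        case True
        thus ?thesis using i(2) r by (intro mult_P') (auto simp: polys_over_def)
      next
        case False
        hence "i + j - k < j" using that by auto
        thus ?thesis using j(2) q by (intro mult_P) (auto simp: polys_over_def)
      qed
      hence "sum ?t ({..i + j} - {i}) \<in> P" by (rule sum_P)
      ultimately have "coeff q i * coeff r j \<in> P" using qr by (auto simp: polys_over_def)
      moreover have "coeff q i \<in> S" "coeff r j \<in> S" using q r by (simp_all add: polys_over_def)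
      ultimately show False using prime_P[of "coeff q i" "coeff r j"] i(1) j(1) by blast
    qed
  qed (auto simp: polys_over_def)
qed

lemma coeff_of_nat: "coeff (of_nat k) i = (if i = 0 then of_nat k else 0)"
  by (simp add: of_nat_poly coeff_pCons split: nat.split)

lemma (in prime_set_over) prime_over_polys: "prime_set_over (polys_over S) (polys_over P) p"
  unfolding prime_set_over_def prime_set_over_axioms_def
  using prime_polys_over prime_p p_P by (auto simp: polys_over_def coeff_of_nat)

context prime_set_over
begin

text \<open>Frobenius acts on the coefficients only and leaves the variable alone; modulo
  \<open>P\<close> this is a ring homomorphism.\<close>

definition frob_poly :: "'a poly \<Rightarrow> 'a poly" where
  "frob_poly q = map_poly (\<lambda>x. x ^ p) q"

lemma coeff_frob_poly: "coeff (frob_poly q) i = coeff q i ^ p"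
  unfolding frob_poly_def by (subst coeff_map_poly) (auto simp: power_0_left)

lemma frob_poly_in: "q \<in> polys_over S \<Longrightarrow> frob_poly q \<in> polys_over S"
  by (auto simp: polys_over_def coeff_frob_poly)

lemma frob_poly_mult:
  assumes "q \<in> polys_over S" "r \<in> polys_over S"
  shows "frob_poly (q * r) - frob_poly q * frob_poly r \<in> polys_over P"
proof -
  have "coeff (frob_poly (q * r) - frob_poly q * frob_poly r) i \<in> P" for i
  proof -
    have "(\<Sum>k\<le>i. coeff q k * coeff r (i - k)) ^ p - (\<Sum>k\<le>i. (coeff q k * coeff r (i - k)) ^ p) \<in> P"
      using assms by (intro frobenius_sum_P) (auto simp: polys_over_def)
    thus ?thesis by (simp add: coeff_frob_poly coeff_mult power_mult_distrib)
  qed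
  thus ?thesis by (simp add: polys_over_def)
qed

lemma frob_poly_add:
  assumes "q \<in> polys_over S" "r \<in> polys_over S"
  shows "frob_poly (q + r) - (frob_poly q + frob_poly r) \<in> polys_over P"
  using assms frobenius_add_P by (auto simp: polys_over_def coeff_frob_poly)

lemma frob_poly_prod:
  assumes "\<And>i. i \<in> I \<Longrightarrow> g i \<in> polys_over S"
  shows "frob_poly (prod g I) - (\<Prod>i\<in>I. frob_poly (g i)) \<in> polys_over P"
  using assms
proof (induction I rule: infinite_finite_induct)
  case (insert i I)
  interpret pol: prime_set_over "polys_over S" "polys_over P" p by (rule prime_over_polys)
  have 1: "frob_poly (g i * prod g I) - frob_poly (g i) * frob_poly (prod g I) \<in> polys_over P"
    using insert by (intro frob_poly_mult) auto
  have 2: "frob_poly (g i) * frob_poly (prod g I) - frob_poly (g i) * (\<Prod>i\<in>I. frob_poly (g i))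
      \<in> polys_over P"
    using insert by (intro pol.cong_mult_P) (auto intro!: frob_poly_in)
  show ?case using pol.trans_P[OF 1 2] insert(1,2) by simp
qed (auto simp: polys_over_def coeff_frob_poly coeff_1 power_0_left)

end

lemma algebraic_int_power_complex: "algebraic_int x \<Longrightarrow> algebraic_int (x ^ k)" for x :: complex
  using subring_set.power_S[OF subring_set_alg_ints, of x k] by simp

section \<open>Roots of unity as representatives of the algebraic closure of a prime field\<close>

text \<open>These are the Teichmueller representatives of the field with \<open>p ^ m\<close>
  elements: zero and the roots of unity of order dividing \<open>p ^ m - 1\<close>.\<close>

definition teich :: "nat \<Rightarrow> nat \<Rightarrow> complex set" where
  "teich p m = {x. x ^ (p ^ m) = x}"

abbreviation frob :: "nat \<Rightarrow> complex \<Rightarrow> complex" where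
  "frob p \<equiv> (\<lambda>x. x ^ p)"

lemma teich_eq: "p > 0 \<Longrightarrow> teich p m = insert 0 {x. x ^ (p ^ m - 1) = 1}"
proof -
  assume p: "p > 0"
  have "x ^ (p ^ m) = x * x ^ (p ^ m - 1)" for x :: complex
    using p by (cases "p ^ m") auto
  thus ?thesis using p by (auto simp: teich_def power_0_left)
qed

lemma finite_teich: "p > 1 \<Longrightarrow> m > 0 \<Longrightarrow> finite (teich p m)"
  and card_teich: "p > 1 \<Longrightarrow> m > 0 \<Longrightarrow> card (teich p m) = p ^ m"
proof -
  assume p: "p > 1" "m > 0"
  hence gt: "p ^ m > 1" by (rule one_less_power)
  hence pos: "p ^ m - 1 > 0" by simp
  have fin: "finite {x::complex. x ^ (p ^ m - 1) = 1}" using pos by (intro finite_roots_unity) auto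
  thus "finite (teich p m)" using p by (simp add: teich_eq)
  have "0 \<notin> {x::complex. x ^ (p ^ m - 1) = 1}" using pos by (auto simp: power_0_left)
  thus "card (teich p m) = p ^ m"
    using p gt fin card_roots_unity_eq[OF pos] card_insert_disjoint[OF fin, of 0]
    by (simp add: teich_eq)
qed

lemma funpow_frob: "(frob p ^^ k) x = x ^ (p ^ k)"
  by (induction k) (auto simp: power_mult[symmetric] mult.commute)

lemma fin_perm_teich: "p > 1 \<Longrightarrow> m > 0 \<Longrightarrow> fin_perm (frob p) (teich p m)"
proof
  assume p: "p > 1" "m > 0"
  show fin: "finite (teich p m)" by (rule finite_teich[OF p])
  have "inj_on (frob p) (teich p m)"
  proof (rule inj_onI)
    fix x y assume xy: "x \<in> teich p m" "y \<in> teich p m" "x ^ p = y ^ p"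
    have "p ^ m = p * p ^ (m - 1)" using p by (cases m) auto
    hence *: "z = (z ^ p) ^ (p ^ (m - 1))" if "z \<in> teich p m" for z
      using that by (simp add: teich_def power_mult)
    show "x = y" by (subst *[OF xy(1)], subst *[OF xy(2)]) (simp only: xy(3))
  qed
  moreover have "x ^ p \<in> teich p m" if "x \<in> teich p m" for x
  proof -
    have "(x ^ p) ^ (p ^ m) = (x ^ (p ^ m)) ^ p" by (simp only: power_mult[symmetric] mult.commute)
    thus ?thesis using that by (simp add: teich_def)
  qed
  ultimately show "bij_betw (frob p) (teich p m) (teich p m)"
    using fin endo_inj_surj[of "teich p m" "frob p"] by (auto simp: bij_betw_def)
qed

text \<open>The power \<open>x ^ (p ^ k)\<close> is the \<open>k\<close>-th iterate of
  \<open>frob p\<close>. Hence the orbit size plays the role of the degree of \<open>x\<close> over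
  the prime field.\<close>

lemma teich_iff_orbit:
  assumes "p > 1" "m > 0" "x \<in> teich p m"
  shows "x \<in> teich p k \<longleftrightarrow> card (orbit (frob p) x) dvd k"
  using fin_perm.funpow_fix_iff[OF fin_perm_teich[OF assms(1,2)] assms(3), of k]
  by (simp add: funpow_frob teich_def)

lemma teich_mono: "p > 1 \<Longrightarrow> k > 0 \<Longrightarrow> k dvd m \<Longrightarrow> teich p k \<subseteq> teich p m"
  using teich_iff_orbit[of p k] dvd_trans by blast

definition exact_period :: "nat \<Rightarrow> nat \<Rightarrow> complex set" where
  "exact_period p d = {x \<in> teich p d. card (orbit (frob p) x) = d}"

text \<open>Modulo a prime above \<open>p\<close> these orbits are the root sets of the monic
  irreducible polynomials of degree \<open>d\<close> over the prime field.\<close>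

definition frob_orbits :: "nat \<Rightarrow> nat \<Rightarrow> complex set set" where
  "frob_orbits p d = {W \<in> orbit (frob p) ` teich p d. card W = d}"

lemma card_exact_period: "p > 1 \<Longrightarrow> d > 0 \<Longrightarrow> card (exact_period p d) = d * card (frob_orbits p d)"
  unfolding exact_period_def frob_orbits_def
  by (rule fin_perm.card_eq_orbits[OF fin_perm_teich])

text \<open>The elements of \<open>teich p m\<close> are sorted by their orbit size, which divides
  \<open>m\<close>.\<close>

lemma sum_exact_period:
  assumes "p > 1" "m > 0"
  shows "(\<Sum>d | d dvd m. card (exact_period p d)) = p ^ m"
proof -
  have d0: "d > 0" if "d dvd m" for d using that assms(2) by (rule_tac dvd_pos_nat)
  have "teich p m = (\<Union>d\<in>{d. d dvd m}. exact_period p d)"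
  proof (intro equalityI subsetI)
    fix x assume x: "x \<in> teich p m"
    let ?d = "card (orbit (frob p) x)"
    have "?d dvd m" using teich_iff_orbit[OF assms x, of m] x by simp
    moreover have "x \<in> exact_period p ?d"
      using teich_iff_orbit[OF assms x, of ?d] by (simp add: exact_period_def)
    ultimately show "x \<in> (\<Union>d\<in>{d. d dvd m}. exact_period p d)" by blast
  next
    fix x assume "x \<in> (\<Union>d\<in>{d. d dvd m}. exact_period p d)"
    then obtain d where "d dvd m" "x \<in> teich p d" by (auto simp: exact_period_def)
    thus "x \<in> teich p m" using teich_mono[OF assms(1), of d m] d0 by blast
  qed
  hence "p ^ m = card (\<Union>d\<in>{d. d dvd m}. exact_period p d)"
    using card_teich[OF assms] by simp
  also have "\<dots> = (\<Sum>d | d dvd m. card (exact_period p d))"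
  proof (rule card_UN_disjoint)
    show "finite {d. d dvd m}" using assms(2) by simp
    show "\<forall>i\<in>{d. d dvd m}. finite (exact_period p i)"
      using d0 finite_teich[OF assms(1)] by (auto simp: exact_period_def)
  qed (auto simp: exact_period_def)
  finally show ?thesis by simp
qed

section \<open>Moebius inversion and the meaning of positive density\<close>

text \<open>A prime \<open>q\<close> dividing \<open>n\<close> pairs each squarefree divisor
  \<open>d\<close> prime to \<open>q\<close> with \<open>d * q\<close>, and the two values
  cancel.\<close>

lemma sum_moebius:
  assumes "n > 0"
  shows "(\<Sum>d | d dvd n. moebius_mu d) = (if n = 1 then 1 else 0)"
proof (cases "n = 1")
  case True
  hence "{d. d dvd n} = {1}" by auto
  thus ?thesis using True by (simp add: moebius_mu_def)
next
  case False
  then obtain q where q: "prime q" "q dvd n" using prime_factor_nat by blast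
  define D where "D = {d. d dvd n \<and> squarefree d}"
  define D0 where "D0 = {d \<in> D. \<not> q dvd d}"
  define D1 where "D1 = {d \<in> D. q dvd d}"
  have fin: "finite {d. d dvd n}" using assms by simp
  have finD: "finite D" unfolding D_def using fin by (rule rev_finite_subset) auto
  have D0_ne: "d \<noteq> 0" if "d \<in> D0" for d using that assms by (auto simp: D0_def D_def)
  have cop: "coprime d q" if "d \<in> D0" for d
    using that q by (metis (no_types, lifting) D0_def coprime_commute mem_Collect_eq prime_imp_coprime)
  have D1: "D1 = (\<lambda>d. d * q) ` D0"
  proof (intro equalityI subsetI)
    fix d assume d: "d \<in> D1"
    hence "q dvd d" by (simp add: D1_def)
    then obtain e where e: "d = e * q" by (metis dvdE mult.commute)
    have sq: "squarefree (e * q)" "e * q dvd n" using d e by (auto simp: D1_def D_def)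
    have "\<not> q dvd e"
    proof
      assume "q dvd e"
      hence "q ^ 2 dvd e * q" by (auto simp: power2_eq_square)
      hence "is_unit q" using sq(1) unfolding squarefree_def by blast
      thus False using q(1) not_prime_unit by blast
    qed
    moreover have "squarefree e" using squarefree_multD[OF sq(1)] by blast
    moreover have "e dvd n" using sq(2) dvd_mult_left by blast
    ultimately show "d \<in> (\<lambda>d. d * q) ` D0" using e by (auto simp: D0_def D_def)
  next
    fix d assume "d \<in> (\<lambda>d. d * q) ` D0"
    then obtain e where e: "e \<in> D0" "d = e * q" by auto
    have "squarefree (e * q)"
      using e cop q by (intro squarefree_mult_coprime) (auto simp: D0_def D_def squarefree_prime)
    moreover have "e * q dvd n" using cop[OF e(1)] e q by (intro divides_mult) (auto simp: D0_def D_def)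
    ultimately show "d \<in> D1" using e by (auto simp: D1_def D_def)
  qed
  have neg: "moebius_mu (d * q) = - moebius_mu d" if d: "d \<in> D0" for d
  proof -
    have "d * q \<in> D1" using D1 d by blast
    hence "squarefree (d * q)" by (simp add: D1_def D_def)
    moreover have "squarefree d" using d by (simp add: D0_def D_def)
    moreover have "prime_factors (d * q) = insert q (prime_factors d)"
      using D0_ne[OF d] q by (subst prime_factors_product) (auto simp: prime_prime_factors)
    moreover have "q \<notin> prime_factors d" using d by (auto simp: D0_def)
    ultimately show ?thesis by (simp add: moebius_mu_def)
  qed
  have "(\<Sum>d | d dvd n. moebius_mu d) = (\<Sum>d\<in>D. moebius_mu d)"
    using fin by (intro sum.mono_neutral_right) (auto simp: D_def moebius_mu_def)
  also have "D = D0 \<union> D1" by (auto simp: D0_def D1_def)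
  also have "(\<Sum>d\<in>D0 \<union> D1. moebius_mu d) = (\<Sum>d\<in>D0. moebius_mu d) + (\<Sum>d\<in>D1. moebius_mu d)"
    using finD by (intro sum.union_disjoint) (auto simp: D0_def D1_def)
  also have "(\<Sum>d\<in>D1. moebius_mu d) = (\<Sum>d\<in>D0. moebius_mu (d * q))"
    unfolding D1 using q by (subst sum.reindex) (auto simp: inj_on_def)
  also have "\<dots> = - (\<Sum>d\<in>D0. moebius_mu d)" by (simp add: neg sum_negf)
  finally show ?thesis using False by simp
qed

text \<open>After exchanging the sums, the factor of \<open>e c\<close> is the sum of
  \<open>moebius_mu\<close> over the divisors of \<open>m div c\<close>, which vanishes unless
  \<open>c = m\<close>.\<close>

lemma moebius_inversion:
  fixes e :: "nat \<Rightarrow> real"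
  assumes "m > 0" "\<And>k. k dvd m \<Longrightarrow> F k = (\<Sum>c | c dvd k. e c)"
  shows "(\<Sum>d | d dvd m. of_int (moebius_mu d) * F (m div d)) = e m"
proof -
  let ?D = "{d. d dvd m}"
  have fin: "finite ?D" using assms(1) by simp
  have pos: "d > 0" if "d dvd m" for d using that assms(1) dvd_pos_nat by blast
  have iff: "c dvd m div d \<longleftrightarrow> d dvd m div c" if "c dvd m" "d dvd m" for c d
  proof -
    have "c dvd m div d \<longleftrightarrow> c * d dvd m" "d dvd m div c \<longleftrightarrow> c * d dvd m"
      using dvd_div_iff_mult[of d m c] dvd_div_iff_mult[of c m d] that pos[OF that(1)] pos[OF that(2)]
      by (auto simp: mult.commute)
    thus ?thesis by blast
  qed
  have "(\<Sum>d\<in>?D. of_int (moebius_mu d) * F (m div d)) =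
      (\<Sum>d\<in>?D. \<Sum>c\<in>?D. if c dvd m div d then of_int (moebius_mu d) * e c else 0)"
  proof (rule sum.cong)
    fix d assume d: "d \<in> ?D"
    hence dd: "m div d dvd m" by (auto simp: div_dvd_iff_mult)
    have "{c. c dvd m div d} = {c \<in> ?D. c dvd m div d}" using dd dvd_trans by blast
    hence "F (m div d) = (\<Sum>c\<in>?D. if c dvd m div d then e c else 0)"
      using assms(2)[OF dd] sum.inter_filter[OF fin, of e "\<lambda>c. c dvd m div d"] by simp
    thus "of_int (moebius_mu d) * F (m div d) =
        (\<Sum>c\<in>?D. if c dvd m div d then of_int (moebius_mu d) * e c else 0)"
      by (simp add: sum_distrib_left if_distrib cong: if_cong)
  qed auto
  also have "\<dots> = (\<Sum>c\<in>?D. \<Sum>d\<in>?D. if c dvd m div d then of_int (moebius_mu d) * e c else 0)"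
    by (rule sum.swap)
  also have "\<dots> = (\<Sum>c\<in>?D. e c * (if m div c = 1 then 1 else 0))"
  proof (rule sum.cong)
    fix c assume c: "c \<in> ?D"
    have mc: "m div c > 0" "m div c dvd m" using c pos assms(1)
      by (auto simp: div_dvd_iff_mult dvd_div_eq_0_iff intro!: Nat.gr0I)
    have eq: "{d. d dvd m div c} = {d \<in> ?D. c dvd m div d}"
      using c iff mc dvd_trans by blast
    have "(\<Sum>d\<in>?D. if c dvd m div d then of_int (moebius_mu d) * e c else 0) =
        (\<Sum>d | d dvd m div c. of_int (moebius_mu d) * e c)"
      unfolding eq by (rule sum.inter_filter[OF fin, symmetric])
    also have "\<dots> = of_int (\<Sum>d | d dvd m div c. moebius_mu d) * e c"
      by (simp add: sum_distrib_right)
    finally show "(\<Sum>d\<in>?D. if c dvd m div d then of_int (moebius_mu d) * e c else 0) =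
        e c * (if m div c = 1 then 1 else 0)"
      using sum_moebius[OF mc(1)] by simp
  qed auto
  also have "\<dots> = (\<Sum>c\<in>?D. if c = m then e c else 0)"
    using assms(1) pos by (intro sum.cong) (auto simp: div_eq_dividend_iff elim!: dvdE)
  also have "\<dots> = e m" using fin by simp
  finally show ?thesis .
qed

text \<open>Inverting \<open>sum_exact_period\<close> counts the elements whose orbit has size
  \<open>m\<close>; the factor \<open>1 / m\<close> passes from elements to orbits.\<close>

lemma necklace_eq:
  assumes "p > 1" "m > 0"
  shows "necklace m (real p) = real (card (frob_orbits p m))"
proof -
  have "(\<Sum>d | d dvd m. of_int (moebius_mu d) * real p ^ (m div d)) = real (card (exact_period p m))"
  proof (rule moebius_inversion[OF assms(2)])
    fix k assume "k dvd m"
    hence "k > 0" using assms(2) by (rule_tac dvd_pos_nat)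
    thus "real p ^ k = (\<Sum>c | c dvd k. real (card (exact_period p c)))"
      using sum_exact_period[OF assms(1), of k] by (metis of_nat_power of_nat_sum)
  qed
  thus ?thesis using assms by (simp add: necklace_def card_exact_period)
qed

text \<open>By \<open>necklace_eq\<close> the generalised binomials are ordinary ones, so no factor
  is negative and the product is positive unless some part is requested more often than there are
  orbits of its size.\<close>

lemma nu_star_pos_iff:
  assumes "prime p" "n > 0"
  shows "nu_star n p \<mu> > 0 \<longleftrightarrow> (\<forall>i\<in>{1..n}. count \<mu> i \<le> card (frob_orbits p i))"
proof -
  have p: "p > 1" using assms prime_gt_1_nat by blast
  have "(\<Prod>i = 1..n. necklace i (real p) gchoose count \<mu> i) =
      (\<Prod>i = 1..n. real (card (frob_orbits p i) choose count \<mu> i))"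
    using p by (intro prod.cong) (auto simp: necklace_eq binomial_gbinomial)
  hence "nu_star n p \<mu> = 1 / (real p ^ (n - 1) * (real p - 1)) *
      real (\<Prod>i = 1..n. card (frob_orbits p i) choose count \<mu> i)"
    by (simp add: nu_star_def)
  moreover have "1 / (real p ^ (n - 1) * (real p - 1)) > 0" using p by simp
  ultimately have "nu_star n p \<mu> > 0 \<longleftrightarrow> (\<Prod>i = 1..n. card (frob_orbits p i) choose count \<mu> i) > 0"
    by (simp only: zero_less_mult_iff of_nat_0_less_iff) auto
  also have "\<dots> \<longleftrightarrow> (\<forall>i\<in>{1..n}. card (frob_orbits p i) choose count \<mu> i > 0)"
    by (metis (no_types, lifting) finite_atLeastAtMost neq0_conv prod_zero_iff)
  finally show ?thesis by (simp add: zero_less_binomial_iff)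
qed

lemma monic_eq_prod_roots:
  fixes q :: "complex poly"
  assumes "finite S" "lead_coeff q = 1" "degree q = card S" "\<And>s. s \<in> S \<Longrightarrow> poly q s = 0"
  shows "q = (\<Prod>s\<in>S. [:- s, 1:])"
proof (rule poly_eqI_degree_lead_coeff[of q "card S" _ S])
  have deg: "degree (\<Prod>s\<in>S. [:- s, 1:]) = card S"
    by (subst degree_prod_eq_sum_degree) auto
  thus "degree (\<Prod>s\<in>S. [:- s, 1:]) \<le> card S" by simp
  have "lead_coeff (\<Prod>s\<in>S. [:- s, 1:]) = 1" by (simp add: lead_coeff_prod)
  thus "coeff q (card S) = coeff (\<Prod>s\<in>S. [:- s, 1:]) (card S)" using assms deg by simp
  fix s assume "s \<in> S"
  thus "poly q s = poly (\<Prod>s\<in>S. [:- s, 1:]) s"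
    using assms by (auto simp: poly_prod prod_zero_iff intro!: bexI[of _ s])
qed (use assms in auto)

text \<open>\<open>X ^ (p ^ m) - X\<close> is monic of degree \<open>p ^ m\<close>, the number of
  its roots in \<open>teich p m\<close>.\<close>

lemma power_minus_self_eq_prod:
  assumes "p > 1" "m > 0"
  shows "a ^ (p ^ m) - a = (\<Prod>t\<in>teich p m. a - t)"
proof -
  have k: "p ^ m > 1" using assms by (rule one_less_power)
  define q :: "complex poly" where "q = monom 1 (p ^ m) + [:0, -1:]"
  have "degree q = p ^ m" unfolding q_def using k by (subst degree_add_eq_left) (auto simp: degree_monom_eq)
  moreover have "lead_coeff q = 1"
    unfolding \<open>degree q = p ^ m\<close> using k assms(2) by (auto simp: q_def coeff_pCons split: nat.split)
  moreover have "poly q s = 0" if "s \<in> teich p m" for s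
    using that by (simp add: q_def poly_monom teich_def)
  ultimately have "q = (\<Prod>s\<in>teich p m. [:- s, 1:])"
    using finite_teich[OF assms] card_teich[OF assms] by (intro monic_eq_prod_roots) auto
  hence "poly q a = (\<Prod>t\<in>teich p m. a - t)" by (simp add: poly_prod)
  thus ?thesis by (simp add: q_def poly_monom)
qed

lemma teich_algebraic_int: "p > 1 \<Longrightarrow> m > 0 \<Longrightarrow> x \<in> teich p m \<Longrightarrow> algebraic_int x"
proof -
  assume p: "p > 1" "m > 0" and x: "x \<in> teich p m"
  have k: "p ^ m - 1 > 0" using one_less_power[OF p] by simp
  consider "x = 0" | "x ^ (p ^ m - 1) = 1" using teich_eq[of p m] p x by auto
  thus ?thesis
  proof cases
    case 2
    thus ?thesis using k
      by (rule_tac algebraic_int_root[of 1 "monom 1 (p ^ m - 1)"])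
         (auto simp: poly_monom degree_monom_eq)
  qed auto
qed

section \<open>Teichmueller representatives modulo a prime ideal\<close>

locale prime_over_alg_ints = prime_set_over "{x :: complex. algebraic_int x}" M p for M p
begin

lemma p_gt_1: "p > 1" using prime_p prime_gt_1_nat by blast

text \<open>\<open>X ^ q - X\<close> stays separable modulo \<open>M\<close>. Dividing
  \<open>x ^ q - y ^ q = x - y\<close> by \<open>x - y\<close> writes \<open>1\<close> as a sum of
  \<open>q\<close> terms, each congruent to \<open>x ^ (q - 1)\<close>, so \<open>1\<close> would be
  congruent to a multiple of \<open>q\<close> and hence lie in \<open>M\<close>.\<close>

lemma teich_inj:
  assumes "m > 0" "x \<in> teich p m" "y \<in> teich p m" "x - y \<in> M"
  shows "x = y"
proof (rule ccontr)
  assume ne: "x \<noteq> y"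
  let ?A = "{x :: complex. algebraic_int x}"
  have xy: "x \<in> ?A" "y \<in> ?A" using assms teich_algebraic_int[OF p_gt_1] by auto
  define q where "q = p ^ m"
  have "x ^ q - y ^ q = (x - y) * (\<Sum>i<q. y ^ (q - Suc i) * x ^ i)" by (rule power_diff_sumr2)
  hence "(x - y) * (\<Sum>i<q. y ^ (q - Suc i) * x ^ i) = x - y"
    using assms by (simp add: q_def teich_def)
  hence one: "(\<Sum>i<q. y ^ (q - Suc i) * x ^ i) = 1" using ne by simp
  have "(\<Sum>i<q. y ^ (q - Suc i) * x ^ i) - (\<Sum>i<q. x ^ (q - Suc i) * x ^ i) \<in> M"
    using xy sym_P[OF assms(4)]
    by (intro cong_sum_P cong_mult_P cong_power_P) (auto intro: algebraic_int_power_complex)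
  moreover have "(\<Sum>i<q. x ^ (q - Suc i) * x ^ i) = (\<Sum>i<q. x ^ (q - 1))"
    by (intro sum.cong) (auto simp flip: power_add)
  hence "(\<Sum>i<q. x ^ (q - Suc i) * x ^ i) = of_nat q * x ^ (q - 1)" by simp
  moreover have "of_nat q * x ^ (q - 1) \<in> M"
    using assms(1) xy p_dvd_of_nat_P[of q]
    by (intro mult_P') (auto simp: q_def intro: algebraic_int_power_complex)
  ultimately have "1 \<in> M" using one plus_P[of "1 - of_nat q * x ^ (q - 1)" "of_nat q * x ^ (q - 1)"] by simp
  thus False using one_P by simp
qed

text \<open>\<open>a ^ (p ^ m) - a\<close> is the product of the differences \<open>a - t\<close>,
  and \<open>M\<close> is prime.\<close>

lemma teich_complete:
  assumes "m > 0" "algebraic_int a" "a ^ (p ^ m) - a \<in> M"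
  shows "\<exists>t\<in>teich p m. a - t \<in> M"
proof (rule prod_in_P)
  show "finite (teich p m)" by (rule finite_teich[OF p_gt_1 assms(1)])
  show "(\<Prod>t\<in>teich p m. a - t) \<in> M"
    using assms power_minus_self_eq_prod[OF p_gt_1 assms(1)] by simp
  fix t assume "t \<in> teich p m"
  thus "a - t \<in> {x. algebraic_int x}"
    using diff_S[of a t] assms teich_algebraic_int[OF p_gt_1] by auto
qed

text \<open>The integers below \<open>p\<close> have distinct representatives in
  \<open>teich p 1\<close>, and this set has only \<open>p\<close> elements, so every class fixed by
  Frobenius contains an integer.\<close>

lemma frob_fixed_imp_int:
  assumes "algebraic_int c" "c ^ p - c \<in> M"
  shows "\<exists>k::nat. c - of_nat k \<in> M"
proof -
  have "\<exists>t\<in>teich p 1. of_nat k - t \<in> M" for k :: nat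
    using fermat_P[of "int k"] by (intro teich_complete) auto
  then obtain h where h: "\<And>k. h k \<in> teich p 1" "\<And>k. of_nat k - h k \<in> M" by metis
  have inj: "inj_on h {..<p}"
  proof (rule inj_onI)
    fix k l assume kl: "k \<in> {..<p}" "l \<in> {..<p}" "h k = h l"
    have "of_nat k - of_nat l \<in> M"
      using trans_P[OF h(2)[of k], of "of_nat l"] sym_P[OF h(2)[of l]] kl(3) by simp
    hence "of_int (int k - int l) \<in> M" by simp
    hence "int p dvd int k - int l" using of_int_P_iff by blast
    hence "int k mod int p = int l mod int p" by (simp add: mod_eq_dvd_iff)
    thus "k = l" using kl(1,2) by simp
  qed
  have "h ` {..<p} = teich p 1"
    using finite_teich[OF p_gt_1, of 1] card_teich[OF p_gt_1, of 1] inj h(1)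
    by (intro card_subset_eq) (auto simp: card_image)
  moreover obtain t where t: "t \<in> teich p 1" "c - t \<in> M"
    using teich_complete[of 1 c] assms by auto
  ultimately obtain k where "t = h k" by blast
  thus ?thesis using trans_P[OF t(2), of "of_nat k"] sym_P[OF h(2)[of k]] by auto
qed

text \<open>Modulo \<open>M\<close>, raising the coefficients to the \<open>p\<close>-th power
  permutes the linear factors, so every coefficient of the product is fixed by Frobenius and
  congruent to an integer.\<close>

lemma int_poly_of_stable_set:
  assumes "m > 0" "S \<subseteq> teich p m" "fin_perm (frob p) S"
  shows "\<exists>f::nat \<Rightarrow> nat. \<forall>i. of_nat (f i) - coeff (\<Prod>s\<in>S. [:- s, 1:]) i \<in> M"
proof -
  let ?A = "{x :: complex. algebraic_int x}"
  let ?g = "\<Prod>s\<in>S. [:- s, 1:]"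
  interpret S: fin_perm "frob p" S by fact
  interpret pol: prime_set_over "polys_over ?A" "polys_over M" p by (rule prime_over_polys)
  have lin: "[:- s, 1:] \<in> polys_over ?A" if "algebraic_int s" for s :: complex
    using that by (auto simp: polys_over_def coeff_pCons split: nat.split)
  have alg: "algebraic_int s" if "s \<in> S" for s
    using that assms teich_algebraic_int[OF p_gt_1] by blast
  have gA: "?g \<in> polys_over ?A" using lin alg by auto
  have *: "frob_poly [:- s, 1:] - [:- (s ^ p), 1:] \<in> polys_over M" if s: "s \<in> S" for s
  proof -
    \<comment> \<open>Fermat's theorem at \<open>-1\<close> treats the sign uniformly, including
      \<open>p = 2\<close>.\<close>
    have "(of_int (-1)) ^ p - of_int (-1) \<in> M" by (rule fermat_P)
    hence "((-1) ^ p + 1) * s ^ p \<in> M"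
      using alg[OF s] by (intro mult_P') (auto intro: algebraic_int_power_complex)
    moreover have "(- s) ^ p + s ^ p = ((-1) ^ p + 1) * s ^ p"
      by (subst power_minus) (simp add: distrib_right)
    ultimately have "(- s) ^ p + s ^ p \<in> M" by simp
    thus ?thesis
      by (auto simp: polys_over_def coeff_frob_poly coeff_pCons power_0_left split: nat.split)
  qed
  have "frob_poly ?g - (\<Prod>s\<in>S. frob_poly [:- s, 1:]) \<in> polys_over M"
    using lin alg by (intro frob_poly_prod) auto
  moreover have "(\<Prod>s\<in>S. frob_poly [:- s, 1:]) - (\<Prod>s\<in>S. [:- (s ^ p), 1:]) \<in> polys_over M"
    using * lin alg by (intro pol.cong_prod_P conjI frob_poly_in lin) auto
  moreover have "(\<Prod>s\<in>S. [:- (s ^ p), 1:]) = ?g"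
    using prod.reindex_bij_betw[OF S.bij_A, of "\<lambda>s. [:- s, 1:]"] .
  ultimately have cong: "frob_poly ?g - ?g \<in> polys_over M"
    using pol.trans_P[of "frob_poly ?g" "\<Prod>s\<in>S. frob_poly [:- s, 1:]" ?g] by simp
  have "\<exists>k::nat. of_nat k - coeff ?g i \<in> M" for i
  proof -
    have "coeff ?g i ^ p - coeff ?g i \<in> M"
      using cong by (auto simp: polys_over_def coeff_frob_poly)
    moreover have "algebraic_int (coeff ?g i)" using gA by (auto simp: polys_over_def)
    ultimately obtain k :: nat where "coeff ?g i - of_nat k \<in> M" using frob_fixed_imp_int by blast
    hence "of_nat k - coeff ?g i \<in> M" by (rule sym_P)
    thus ?thesis by blast
  qed
  thus ?thesis by metis
qed

end

section \<open>Stable sets of representatives and their cycle types\<close>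

text \<open>\<open>h\<close> carries the orbits of \<open>\<sigma>\<close> injectively to orbits of
  \<open>frob p\<close>, and an orbit of size \<open>i\<close> lies in \<open>teich p i\<close> even
  when its points were found in a larger \<open>teich p m\<close>.\<close>

lemma count_cycle_type_le:
  assumes "p > 1" "fin_perm \<sigma> R" "inj_on h R" "\<And>x. x \<in> R \<Longrightarrow> h (\<sigma> x) = h x ^ p"
    and "\<And>x. x \<in> R \<Longrightarrow> \<exists>m>0. h x \<in> teich p m" "i > 0"
  shows "count (cycle_type \<sigma> R) i \<le> card (frob_orbits p i)"
proof -
  have fp: "fin_perm (frob p) (h ` R)"
    using fin_perm_equivariant[of \<sigma> R h "frob p"] assms(2-4) by blast
  have "cycle_type \<sigma> R = cycle_type (frob p) (h ` R)"
    using cycle_type_equivariant[of \<sigma> R h "frob p"] assms(2-4) by simp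
  hence "count (cycle_type \<sigma> R) i = card {W \<in> orbit (frob p) ` h ` R. card W = i}"
    using fin_perm.count_cycle_type[OF fp] by simp
  also have "\<dots> \<le> card (frob_orbits p i)"
  proof (rule card_mono)
    show "finite (frob_orbits p i)"
      unfolding frob_orbits_def using finite_teich[OF assms(1,6)] by simp
    show "{W \<in> orbit (frob p) ` h ` R. card W = i} \<subseteq> frob_orbits p i"
    proof
      fix W assume "W \<in> {W \<in> orbit (frob p) ` h ` R. card W = i}"
      then obtain x where x: "x \<in> R" "W = orbit (frob p) (h x)" "card W = i" by blast
      obtain m where "m > 0" "h x \<in> teich p m" using assms(5)[OF x(1)] by blast
      hence "h x \<in> teich p i" using teich_iff_orbit[OF assms(1), of m "h x" i] x by simp
      thus "W \<in> frob_orbits p i" using x by (auto simp: frob_orbits_def)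
    qed
  qed
  finally show ?thesis .
qed

lemma ex_stable_set_of_type:
  assumes "p > 1" "partition_of n \<mu>" "\<And>i. i \<in> {1..n} \<Longrightarrow> count \<mu> i \<le> card (frob_orbits p i)"
  shows "\<exists>m S. m > 0 \<and> S \<subseteq> teich p m \<and> fin_perm (frob p) S \<and> cycle_type (frob p) S = \<mu>"
proof -
  have "\<exists>V. V \<subseteq> frob_orbits p i \<and> card V = count \<mu> i" if "i \<in> {1..n}" for i
    using assms(3)[OF that] by (meson obtain_subset_with_card_n)
  then obtain V where V: "\<And>i. i \<in> {1..n} \<Longrightarrow> V i \<subseteq> frob_orbits p i"
      "\<And>i. i \<in> {1..n} \<Longrightarrow> card (V i) = count \<mu> i"
    by metis
  \<comment> \<open>A common multiple of the possible orbit sizes \<open>1, ..., n\<close>, which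
    puts all chosen orbits into a single \<open>teich p m\<close>.\<close>
  define m where "m = (fact n :: nat)"
  have m: "m > 0" by (simp add: m_def)
  interpret T: fin_perm "frob p" "teich p m" by (rule fin_perm_teich[OF assms(1) m])
  define \<W> where "\<W> = (\<Union>i\<in>{1..n}. V i)"
  define S where "S = \<Union>\<W>"
  have orb: "W \<in> orbit (frob p) ` teich p m" "card W = i" if "i \<in> {1..n}" "W \<in> V i" for W i
  proof -
    have "W \<in> frob_orbits p i" using V(1)[OF that(1)] that(2) by blast
    moreover have "teich p i \<subseteq> teich p m"
      using that(1) assms(1) by (intro teich_mono) (auto simp: m_def dvd_fact)
    ultimately show "W \<in> orbit (frob p) ` teich p m" "card W = i" by (auto simp: frob_orbits_def)
  qed
  have W: "W \<in> orbit (frob p) ` teich p m" if "W \<in> \<W>" for W using that orb by (auto simp: \<W>_def)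
  have S_sub: "S \<subseteq> teich p m" unfolding S_def using W T.orbit_sub by blast
  have orbS: "orbit (frob p) x \<in> \<W> \<and> orbit (frob p) x \<subseteq> S" if "x \<in> S" for x
  proof -
    obtain W where W': "W \<in> \<W>" "x \<in> W" using \<open>x \<in> S\<close> by (auto simp: S_def)
    then obtain y where "y \<in> teich p m" "W = orbit (frob p) y" using W by blast
    hence "orbit (frob p) x = W" using T.orbit_eq W' by simp
    thus ?thesis using W' by (auto simp: S_def)
  qed
  have "x ^ p \<in> S" if "x \<in> S" for x
    using orbS[OF that] orbit.base[of "frob p" x] by blast
  moreover have finS: "finite S" using S_sub T.finite_A finite_subset by blast
  moreover have "inj_on (frob p) S"
    using T.bij_A S_sub by (auto simp: bij_betw_def intro: inj_on_subset)
  ultimately have "bij_betw (frob p) S S"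
    using endo_inj_surj[of S "frob p"] by (auto simp: bij_betw_def)
  then interpret S: fin_perm "frob p" S using finS by unfold_locales
  have orbits: "orbit (frob p) ` S = \<W>"
  proof
    show "orbit (frob p) ` S \<subseteq> \<W>" using orbS by blast
    show "\<W> \<subseteq> orbit (frob p) ` S"
    proof
      fix W' assume W': "W' \<in> \<W>"
      then obtain y where y: "y \<in> teich p m" "W' = orbit (frob p) y" using W by blast
      have "y \<in> S" using T.self_in_orbit[OF y(1)] W' y(2) unfolding S_def by blast
      thus "W' \<in> orbit (frob p) ` S" using y by blast
    qed
  qed
  have "count (cycle_type (frob p) S) i = count \<mu> i" for i
  proof (cases "i \<in> {1..n}")
    case True
    have "{W \<in> \<W>. card W = i} = V i" using True orb by (auto simp: \<W>_def)
    thus ?thesis using S.count_cycle_type[of i] orbits V(2)[OF True] by simp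
  next
    case False
    have "{W \<in> \<W>. card W = i} = {}" using False orb by (auto simp: \<W>_def)
    hence "count (cycle_type (frob p) S) i = 0" using S.count_cycle_type[of i] orbits by (metis card.empty)
    moreover have "i \<notin># \<mu>"
    proof
      assume "i \<in># \<mu>"
      moreover have "i \<noteq> 0" using \<open>i \<in># \<mu>\<close> assms(2) by (metis partition_of_def)
      ultimately have "i \<noteq> 0" "i \<le> n" using assms(2) sum_mset.remove[of i \<mu>] by (auto simp: partition_of_def)
      thus False using False by simp
    qed
    ultimately show ?thesis by (metis count_eq_zero_iff)
  qed
  hence "cycle_type (frob p) S = \<mu>" by (rule multiset_eqI)
  thus ?thesis using m S_sub S.fin_perm_axioms by blast
qed

lemma frob_orbits_1:
  assumes "p > 1"
  shows "card (frob_orbits p 1) = p"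
  using sum_exact_period[OF assms, of 1] card_exact_period[OF assms, of 1] by simp

text \<open>The elements of \<open>teich p i\<close> with a shorter orbit number at most the sum of
  \<open>p ^ d\<close> over \<open>d < i\<close>, which is less than \<open>p ^ i\<close>.\<close>

lemma frob_orbits_pos:
  assumes "p > 1" "i > 0"
  shows "card (frob_orbits p i) > 0"
proof -
  have D: "{d. d dvd i} = insert i {d. d dvd i \<and> d < i}"
    using assms(2) by (auto dest: dvd_imp_le)
  have fin: "finite {d. d dvd i \<and> d < i}" using assms(2) by simp
  have "p ^ i = card (exact_period p i) + (\<Sum>d | d dvd i \<and> d < i. card (exact_period p d))"
    using sum_exact_period[OF assms] D fin by simp
  also have "(\<Sum>d | d dvd i \<and> d < i. card (exact_period p d)) \<le> (\<Sum>d | d dvd i \<and> d < i. p ^ d)"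
  proof (rule sum_mono)
    fix d assume "d \<in> {d. d dvd i \<and> d < i}"
    hence d: "d > 0" using assms(2) dvd_pos_nat by auto
    have "card (exact_period p d) \<le> card (teich p d)"
      using finite_teich[OF assms(1) d] by (intro card_mono) (auto simp: exact_period_def)
    thus "card (exact_period p d) \<le> p ^ d" using card_teich[OF assms(1) d] by simp
  qed
  also have "\<dots> \<le> (\<Sum>d<i. p ^ d)" by (intro sum_mono2) auto
  also have "(\<Sum>d<i. p ^ d) < p ^ i"
  proof (induction i)
    case (Suc i)
    have "(\<Sum>d<Suc i. p ^ d) < p ^ i + p ^ i" using Suc by simp
    also have "\<dots> = 2 * p ^ i" by simp
    also have "\<dots> \<le> p * p ^ i" using assms(1) by (intro mult_right_mono) auto
    finally show ?case by simp
  qed auto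
  finally have "card (exact_period p i) > 0" by linarith
  thus ?thesis using card_exact_period[OF assms] by (metis gr0I mult_0_right less_irrefl)
qed

section \<open>Subfields of the complex numbers\<close>

lemma CC_simps [simp]:
  "carrier CC = UNIV" "x \<otimes>\<^bsub>CC\<^esub> y = x * y" "x \<oplus>\<^bsub>CC\<^esub> y = x + y" "\<one>\<^bsub>CC\<^esub> = 1" "\<zero>\<^bsub>CC\<^esub> = 0"
  by (simp_all add: ring_of_type_algebra_def)

interpretation CC: ring CC by (rule ring_from_type_algebra)

lemma field_CC: "Ring.field CC" by (rule field_from_type_algebra)

lemma CC_uminus [simp]: "\<ominus>\<^bsub>CC\<^esub> x = - x"
  using CC.minus_equality[of "- x" x] by simp

lemma CC_inv: "x \<noteq> 0 \<Longrightarrow> inv\<^bsub>CC\<^esub> x = inverse x"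
  using CC.inv_char[of x "inverse x"] by simp

lemma subring_CC_iff: "subring A CC \<longleftrightarrow> subring_set A"
proof
  assume "subring A CC"
  note * = subringE[OF this, simplified]
  show "subring_set A"
    using *(3,5,6,7) by unfold_locales (auto simp only: diff_conv_add_uminus)
next
  assume "subring_set A"
  then interpret subring_set A .
  show "subring A CC" by (rule CC.subringI) auto
qed

locale subfield_set = subring_set K for K :: "complex set" +
  assumes inverse_K [intro]: "x \<in> K \<Longrightarrow> inverse x \<in> K"
begin

lemma divide_K [intro]: "x \<in> K \<Longrightarrow> y \<in> K \<Longrightarrow> x / y \<in> K"
  by (auto simp: divide_inverse)

lemma of_rat_K [simp, intro]: "of_rat r \<in> K"
  by (cases r) (auto simp: of_rat_rat)

end

lemma subfield_CC_iff: "subfield K CC \<longleftrightarrow> subfield_set K"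
proof
  assume K: "subfield K CC"
  then interpret subring_set K using subfieldE(1) subring_CC_iff by blast
  show "subfield_set K"
  proof
    fix x assume "x \<in> K"
    thus "inverse x \<in> K" using CC.subfield_m_inv(1)[OF K, of x] by (cases "x = 0") (auto simp: CC_inv)
  qed
next
  assume "subfield_set K"
  then interpret subfield_set K .
  show "subfield K CC"
  proof (rule field.subfieldI'[OF field_CC])
    show "subring K CC" using subring_CC_iff subring_set_axioms by blast
  qed (auto simp: CC_inv)
qed

lemma subfield_set_Rats: "subfield_set \<rat>"
  by unfold_locales auto

lemma subfield_Rats: "subfield \<rat> CC"
  using subfield_set_Rats subfield_CC_iff by blast

lemma CC_combine:
  "length ks = length us \<Longrightarrow> CC.combine ks us = (\<Sum>i<length us. ks ! i * us ! i)"
proof (induction ks us rule: list_induct2)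
  case (Cons k ks u us)
  thus ?case by (simp add: sum.lessThan_Suc_shift del: sum.lessThan_Suc)
qed auto

text \<open>Together with \<open>qindep\<close> this has the shape of \<open>int_span\<close> and
  \<open>int_basis\<close>, with rational coefficients, which makes the passage between lattices and
  vector spaces direct.\<close>

definition qspan :: "complex list \<Rightarrow> complex set" where
  "qspan ws = {\<Sum>i<length ws. of_rat (a i) * ws ! i | a :: nat \<Rightarrow> rat. True}"

definition qindep :: "complex list \<Rightarrow> bool" where
  "qindep ws \<longleftrightarrow> (\<forall>a :: nat \<Rightarrow> rat. (\<Sum>i<length ws. of_rat (a i) * ws ! i) = 0 \<longrightarrow> (\<forall>i<length ws. a i = 0))"

lemma Span_eq_qspan: "CC.Span \<rat> ws = qspan ws"
proof -
  have "x \<in> CC.Span \<rat> ws \<longleftrightarrow> x \<in> qspan ws" for x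
  proof
    assume "x \<in> CC.Span \<rat> ws"
    then obtain ks where ks: "set ks \<subseteq> \<rat>" "length ks = length ws" "x = CC.combine ks ws"
      using CC.Span_mem_iff_length_version[OF subfield_Rats, of ws x] by auto
    have "\<forall>i<length ws. \<exists>r. ks ! i = of_rat r"
      using ks(1,2) by (metis Rats_cases nth_mem subsetD)
    then obtain a where "\<forall>i<length ws. ks ! i = of_rat (a i)" by metis
    thus "x \<in> qspan ws" unfolding qspan_def using ks CC_combine[OF ks(2)] by (auto intro!: exI[of _ a])
  next
    assume "x \<in> qspan ws"
    then obtain a where a: "x = (\<Sum>i<length ws. of_rat (a i) * ws ! i)" unfolding qspan_def by auto
    have "x = CC.combine (map (\<lambda>i. of_rat (a i)) [0..<length ws]) ws"
      by (subst CC_combine) (auto simp: a)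
    thus "x \<in> CC.Span \<rat> ws"
      using CC.Span_mem_iff_length_version[OF subfield_Rats, of ws x]
      by (auto intro!: exI[of _ "map (\<lambda>i. of_rat (a i)) [0..<length ws]"])
  qed
  thus ?thesis by blast
qed

lemma independent_iff_qindep: "CC.independent \<rat> ws \<longleftrightarrow> qindep ws"
proof
  assume ind: "CC.independent \<rat> ws"
  show "qindep ws" unfolding qindep_def
  proof (intro allI impI)
    fix a :: "nat \<Rightarrow> rat" and i
    assume 0: "(\<Sum>i<length ws. of_rat (a i) * ws ! i) = 0" and i: "i < length ws"
    let ?ks = "map (\<lambda>i. complex_of_rat (a i)) [0..<length ws]"
    have "CC.combine ?ks ws = 0" by (subst CC_combine) (auto simp: 0)
    moreover have "set ?ks \<subseteq> \<rat>" by auto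
    ultimately have "set (take (length ws) ?ks) \<subseteq> {0}"
      using CC.independent_imp_trivial_combine[OF subfield_Rats ind, of ?ks] unfolding CC_simps by blast
    hence "complex_of_rat (a i) = 0" using i by (auto simp: image_subset_iff)
    thus "a i = 0" by simp
  qed
next
  assume ind: "qindep ws"
  show "CC.independent \<rat> ws"
  proof (rule CC.trivial_combine_imp_independent[OF subfield_Rats])
    fix ks assume ks: "set ks \<subseteq> \<rat>" "CC.combine ks ws = \<zero>\<^bsub>CC\<^esub>"
    \<comment> \<open>The list \<open>ks\<close> may be longer or shorter than \<open>ws\<close>;
      \<open>combine\<close> drops the surplus, so an equivalent list of the right length
      exists.\<close>
    obtain ls where ls: "set (take (length ws) ks) \<subseteq> set ls" "set ls \<subseteq> set (take (length ws) ks) \<union> {0}"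
       "length ls = length ws" "CC.combine ls ws = 0"
      using CC.combine_normalize[of ks ws 0] ks by auto
    have "set ls \<subseteq> \<rat>" using ls(2) ks(1) set_take_subset[of "length ws" ks] Rats_0 by blast
    hence "\<forall>i<length ws. \<exists>r. ls ! i = of_rat r" using ls(3) by (metis Rats_cases nth_mem subsetD)
    then obtain a where a: "\<forall>i<length ws. ls ! i = of_rat (a i)" by metis
    have "(\<Sum>i<length ws. of_rat (a i) * ws ! i) = 0" using ls(4) CC_combine[OF ls(3)] a by simp
    hence "\<forall>i<length ws. a i = 0" using ind unfolding qindep_def by blast
    hence "set ls \<subseteq> {0}" using a ls(3) by (auto simp: in_set_conv_nth)
    thus "set (take (length ws) ks) \<subseteq> {\<zero>\<^bsub>CC\<^esub>}" using ls(1) by auto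
  qed auto
qed

lemma dimension_iff:
  "ring.dimension CC n \<rat> K \<longleftrightarrow> (\<exists>ws. length ws = n \<and> qindep ws \<and> qspan ws = K)"
proof
  assume "ring.dimension CC n \<rat> K"
  from CC.exists_base[OF subfield_Rats this]
  show "\<exists>ws. length ws = n \<and> qindep ws \<and> qspan ws = K"
    using independent_iff_qindep Span_eq_qspan by auto
next
  assume "\<exists>ws. length ws = n \<and> qindep ws \<and> qspan ws = K"
  thus "ring.dimension CC n \<rat> K"
    using CC.dimensionI[OF subfield_Rats] independent_iff_qindep Span_eq_qspan by auto
qed

section \<open>Rational polynomials and simple extensions\<close>

definition qeval :: "rat poly \<Rightarrow> complex \<Rightarrow> complex" where
  "qeval g x = poly (map_poly of_rat g) x"

lemma qeval_0 [simp]: "qeval 0 x = 0"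
  and qeval_1 [simp]: "qeval 1 x = 1"
  and qeval_pCons [simp]: "qeval (pCons a g) x = of_rat a + x * qeval g x"
  by (simp_all add: qeval_def of_rat_hom.map_poly_pCons_hom)

lemma map_poly_of_rat_add: "map_poly of_rat (g + h) = map_poly of_rat g + (map_poly of_rat h :: complex poly)"
  by (rule poly_eqI) (simp add: coeff_map_poly of_rat_add)

lemma map_poly_of_rat_mult: "map_poly of_rat (g * h) = map_poly of_rat g * (map_poly of_rat h :: complex poly)"
  by (rule poly_eqI) (simp add: coeff_map_poly coeff_mult of_rat_sum of_rat_mult)

lemma qeval_add [simp]: "qeval (g + h) x = qeval g x + qeval h x"
  by (simp add: qeval_def map_poly_of_rat_add)

lemma qeval_mult [simp]: "qeval (g * h) x = qeval g x * qeval h x"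
  by (simp add: qeval_def map_poly_of_rat_mult)

lemma qeval_uminus [simp]: "qeval (- g) x = - qeval g x"
  using qeval_add[of g "- g" x] by (simp add: add_eq_0_iff)

lemma qeval_diff [simp]: "qeval (g - h) x = qeval g x - qeval h x"
  using qeval_add[of g "- h" x] by simp

lemma qeval_smult [simp]: "qeval (smult c g) x = of_rat c * qeval g x"
  using qeval_mult[of "[:c:]" g x] by simp

lemma qeval_sum [simp]: "qeval (sum g I) x = (\<Sum>i\<in>I. qeval (g i) x)"
  by (induction I rule: infinite_finite_induct) auto

lemma qeval_monom [simp]: "qeval (monom c k) x = of_rat c * x ^ k"
  by (simp add: qeval_def map_poly_monom poly_monom)

lemma qeval_altdef: "qeval g x = (\<Sum>i\<le>degree g. of_rat (coeff g i) * x ^ i)"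
  by (simp add: qeval_def poly_altdef coeff_map_poly degree_map_poly)

lemma qeval_altdef_lt: "degree g < n \<Longrightarrow> qeval g x = (\<Sum>i<n. of_rat (coeff g i) * x ^ i)"
  unfolding qeval_altdef
  by (rule sum.mono_neutral_left) (auto simp: coeff_eq_0 not_le)

lemma (in subfield_set) qeval_K [intro]: "x \<in> K \<Longrightarrow> qeval g x \<in> K"
  by (induction g) auto

definition is_minpoly :: "rat poly \<Rightarrow> complex \<Rightarrow> bool" where
  "is_minpoly m x \<longleftrightarrow> lead_coeff m = 1 \<and> (\<forall>g. qeval g x = 0 \<longleftrightarrow> m dvd g)"

lemma is_minpolyD:
  assumes "is_minpoly m x"
  shows "lead_coeff m = 1" "m \<noteq> 0" "qeval g x = 0 \<longleftrightarrow> m dvd g" "qeval m x = 0" "degree m > 0"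
proof -
  show lc: "lead_coeff m = 1" and eq: "\<And>g. qeval g x = 0 \<longleftrightarrow> m dvd g"
    using assms by (auto simp: is_minpoly_def)
  show "m \<noteq> 0" using lc by auto
  show m: "qeval m x = 0" using eq by simp
  show "degree m > 0"
  proof (rule ccontr)
    assume "\<not> degree m > 0"
    hence "m = 1" using lc by (metis degree_0_id gr_zeroI one_pCons)
    thus False using m by simp
  qed
qed

lemma ex_minpoly:
  assumes "g \<noteq> 0" "qeval g x = 0"
  shows "\<exists>m. is_minpoly m x"
proof -
  define h where "h = arg_min degree (\<lambda>g. g \<noteq> 0 \<and> qeval g x = 0)"
  have h: "h \<noteq> 0" "qeval h x = 0"
    using arg_min_natI[of "\<lambda>g. g \<noteq> 0 \<and> qeval g x = 0" g degree] assms by (auto simp: h_def)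
  have hmin: "degree h \<le> degree g" if "g \<noteq> 0" "qeval g x = 0" for g
    using arg_min_nat_le[of "\<lambda>g. g \<noteq> 0 \<and> qeval g x = 0" g degree] that by (auto simp: h_def)
  define m where "m = smult (inverse (lead_coeff h)) h"
  have m: "lead_coeff m = 1" "qeval m x = 0" "degree m = degree h" "m \<noteq> 0" using h by (auto simp: m_def)
  have "m dvd g" if g: "qeval g x = 0" for g
  proof -
    have "qeval (g mod m) x = qeval (g - g div m * m) x" by (simp add: minus_div_mult_eq_mod)
    hence "qeval (g mod m) x = 0" using g m by simp
    hence "g mod m = 0"
      using hmin[of "g mod m"] degree_mod_less[of m g] m h by fastforce
    thus ?thesis by auto
  qed
  moreover have "qeval g x = 0" if "m dvd g" for g
    using that m by (auto elim!: dvdE)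
  ultimately show ?thesis using m unfolding is_minpoly_def by blast
qed

text \<open>Irreducibility in disguise: the minimal polynomial \<open>m'\<close> of \<open>a\<close>
  divides \<open>m\<close>, and the cofactor has smaller degree than \<open>m\<close>, so it does
  not vanish at \<open>x\<close>. Hence \<open>m'\<close> vanishes at \<open>x\<close> and is
  divisible by \<open>m\<close>.\<close>

lemma is_minpoly_conjugate:
  assumes "is_minpoly m x" "qeval m a = 0"
  shows "is_minpoly m a"
proof -
  note mD = is_minpolyD[OF assms(1)]
  obtain m' where m': "is_minpoly m' a" using ex_minpoly[OF mD(2) assms(2)] by blast
  note m'D = is_minpolyD[OF m']
  have "m' dvd m" using m'D(3) assms(2) by blast
  then obtain h where h: "m = m' * h" by auto
  have "\<not> m dvd h"
  proof
    assume "m dvd h"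
    moreover have "h \<noteq> 0" using h mD(2) by auto
    ultimately have "degree m \<le> degree h" by (rule dvd_imp_degree_le)
    moreover have "degree m = degree m' + degree h" using h mD(2) by (subst h, intro degree_mult_eq) auto
    ultimately show False using m'D(5) by simp
  qed
  hence "qeval h x \<noteq> 0" using mD(3) by blast
  moreover have "qeval m' x * qeval h x = 0" using mD(4) h by simp
  ultimately have "m dvd m'" using mD(3) by simp
  hence "m dvd g \<longleftrightarrow> m' dvd g" for g using \<open>m' dvd m\<close> dvd_trans by blast
  thus ?thesis using mD(1) m'D(3) unfolding is_minpoly_def by blast
qed

lemma minpoly_pderiv:
  assumes "is_minpoly m x"
  shows "qeval (pderiv m) x \<noteq> 0"
proof
  note mD = is_minpolyD[OF assms]
  assume "qeval (pderiv m) x = 0"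
  hence "m dvd pderiv m" using mD(3) by blast
  moreover have "pderiv m \<noteq> 0" using mD(5) by (simp add: pderiv_eq_0_iff)
  ultimately have "degree m \<le> degree (pderiv m)" by (rule dvd_imp_degree_le)
  thus False using mD(5) by (simp add: degree_pderiv)
qed

lemma map_poly_of_rat_pderiv: "map_poly of_rat (pderiv g) = pderiv (map_poly of_rat g :: complex poly)"
  by (rule poly_eqI) (simp add: coeff_map_poly coeff_pderiv of_rat_mult of_rat_add)

text \<open>By \<open>is_minpoly_conjugate\<close>, \<open>m\<close> is the minimal polynomial of
  each of its roots, so its derivative vanishes at none of them and all roots are simple.\<close>

lemma card_roots_minpoly:
  assumes "is_minpoly m x"
  shows "card {a. qeval m a = 0} = degree m" "finite {a. qeval m a = 0}"
    and "map_poly of_rat m = (\<Prod>a | qeval m a = 0. [:- a, 1:])"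
proof -
  note mD = is_minpolyD[OF assms]
  let ?m = "map_poly of_rat m :: complex poly"
  have m0: "?m \<noteq> 0" using mD(2) by (simp add: map_poly_eq_0_iff)
  have "\<not> (poly ?m a = 0 \<and> poly (pderiv ?m) a = 0)" for a
  proof
    assume "poly ?m a = 0 \<and> poly (pderiv ?m) a = 0"
    hence a: "qeval m a = 0" "qeval (pderiv m) a = 0"
      by (simp_all add: qeval_def map_poly_of_rat_pderiv)
    thus False using minpoly_pderiv[OF is_minpoly_conjugate[OF assms]] by blast
  qed
  hence "rsquarefree ?m" by (simp add: rsquarefree_roots)
  from complex_poly_decompose_rsquarefree[OF this]
  have *: "smult (lead_coeff ?m) (\<Prod>a | poly ?m a = 0. [:- a, 1:]) = ?m" .
  have "lead_coeff ?m = 1" using mD(1) by (simp add: coeff_map_poly degree_map_poly)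
  with * have eq: "(\<Prod>a | poly ?m a = 0. [:- a, 1:]) = ?m" by simp
  thus "?m = (\<Prod>a | qeval m a = 0. [:- a, 1:])" by (simp add: qeval_def)
  show "finite {a. qeval m a = 0}" using poly_roots_finite[OF m0] by (simp add: qeval_def)
  have "degree (\<Prod>a | poly ?m a = 0. [:- a, 1:]) = card {a. poly ?m a = 0}"
    by (subst degree_prod_eq_sum_degree) auto
  thus "card {a. qeval m a = 0} = degree m" using eq by (simp add: qeval_def degree_map_poly)
qed

section \<open>Simple extensions of the rationals\<close>

definition adj :: "complex \<Rightarrow> complex set" where
  "adj x = range (\<lambda>g. qeval g x)"

lemma adj_self [simp, intro]: "x \<in> adj x"
  unfolding adj_def using rangeI[of "\<lambda>g. qeval g x" "[:0, 1:]"] by simp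

lemma qeval_in_adj [simp, intro]: "qeval g x \<in> adj x"
  by (simp add: adj_def)

text \<open>A polynomial not vanishing at \<open>x\<close> is coprime to the minimal polynomial, and
  evaluating a Bezout identity at \<open>x\<close> produces the inverse.\<close>

lemma subfield_adj:
  assumes "is_minpoly m x"
  shows "subfield_set (adj x)"
proof
  show "1 \<in> adj x" unfolding adj_def by (rule range_eqI[of _ _ 1]) simp
  fix u v assume "u \<in> adj x" "v \<in> adj x"
  then obtain g h where gh: "u = qeval g x" "v = qeval h x" by (auto simp: adj_def)
  show "u - v \<in> adj x" unfolding gh adj_def by (rule range_eqI[of _ _ "g - h"]) simp
  show "u * v \<in> adj x" unfolding gh adj_def by (rule range_eqI[of _ _ "g * h"]) simp
next
  fix u assume "u \<in> adj x"
  then obtain g where g: "u = qeval g x" by (auto simp: adj_def)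
  note mD = is_minpolyD[OF assms]
  show "inverse u \<in> adj x"
  proof (cases "u = 0")
    case True
    thus ?thesis unfolding adj_def by (auto intro!: range_eqI[of _ _ 0])
  next
    case False
    have "coprime g m"
    proof (rule coprimeI)
      fix d assume d: "d dvd g" "d dvd m"
      then obtain h where h: "m = d * h" by auto
      have "qeval d x \<noteq> 0" using d(1) False g by (auto elim!: dvdE)
      hence "qeval h x = 0" using mD(4) h by simp
      hence "m dvd h" using mD(3) by blast
      then obtain k where "h = m * k" by auto
      hence "m * (d * k) = m * 1" using h by (simp add: mult_ac)
      hence "d * k = 1" using mD(2) by (simp only: mult_cancel_left) simp
      thus "is_unit d" by (metis dvd_triv_left)
    qed
    hence "fst (bezout_coefficients g m) * g + snd (bezout_coefficients g m) * m = 1"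
      using bezout_coefficients_fst_snd[of g m] by simp
    hence "qeval (fst (bezout_coefficients g m) * g + snd (bezout_coefficients g m) * m) x = qeval 1 x"
      by simp
    hence "qeval (fst (bezout_coefficients g m)) x * u = 1" using mD(4) g by simp
    hence "inverse u = qeval (fst (bezout_coefficients g m)) x"
      using False by (simp add: field_simps)
    thus ?thesis by simp
  qed
qed

lemma (in subfield_set) adj_subset: "x \<in> K \<Longrightarrow> adj x \<subseteq> K"
  by (auto simp: adj_def)

lemma adj_eq_qspan:
  assumes "is_minpoly m x"
  shows "adj x = qspan (map (\<lambda>i. x ^ i) [0..<degree m])" "qindep (map (\<lambda>i. x ^ i) [0..<degree m])"
proof -
  note mD = is_minpolyD[OF assms]
  let ?n = "degree m"
  let ?g = "\<lambda>a. \<Sum>i<?n. monom (a i) i"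
  have deg: "degree (?g a) < ?n" for a :: "nat \<Rightarrow> rat"
    using mD(5) by (intro degree_sum_less) (auto intro: le_less_trans[OF degree_monom_le])
  have ev: "qeval (?g a) x = (\<Sum>i<?n. of_rat (a i) * x ^ i)" for a by simp
  show "adj x = qspan (map (\<lambda>i. x ^ i) [0..<degree m])"
  proof (intro equalityI subsetI)
    fix y assume "y \<in> adj x"
    then obtain g where g: "y = qeval g x" by (auto simp: adj_def)
    have "qeval (g mod m) x = qeval (g - g div m * m) x" by (simp add: minus_div_mult_eq_mod)
    hence "y = qeval (g mod m) x" using g mD by simp
    moreover have "degree (g mod m) < ?n" using degree_mod_less[of m g] mD by auto
    ultimately have "y = (\<Sum>i<?n. of_rat (coeff (g mod m) i) * x ^ i)" by (simp add: qeval_altdef_lt)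
    thus "y \<in> qspan (map (\<lambda>i. x ^ i) [0..<degree m])"
      unfolding qspan_def by (auto intro!: exI[of _ "coeff (g mod m)"])
  next
    fix y assume "y \<in> qspan (map (\<lambda>i. x ^ i) [0..<degree m])"
    then obtain a where "y = qeval (?g a) x" unfolding qspan_def by auto
    thus "y \<in> adj x" by (auto simp only: qeval_in_adj)
  qed
  show "qindep (map (\<lambda>i. x ^ i) [0..<degree m])" unfolding qindep_def
  proof (intro allI impI)
    fix a :: "nat \<Rightarrow> rat" and i
    let ?ws = "map (\<lambda>i. x ^ i) [0..<degree m]"
    assume "(\<Sum>i<length ?ws. of_rat (a i) * ?ws ! i) = 0" and i: "i < length ?ws"
    hence "qeval (?g a) x = 0" by simp
    hence "m dvd ?g a" using mD(3) by blast
    hence "?g a = 0" using deg[of a] dvd_imp_degree_le[of m "?g a"] by force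
    hence "coeff (?g a) i = 0" by simp
    thus "a i = 0" using i by (simp add: coeff_sum)
  qed
qed

lemma dimension_adj:
  assumes "is_minpoly m x"
  shows "ring.dimension CC (degree m) \<rat> (adj x)"
  unfolding dimension_iff using adj_eq_qspan[OF assms]
  by (intro exI[of _ "map (\<lambda>i. x ^ i) [0..<degree m]"]) auto

lemma number_field_adj: "is_minpoly m x \<Longrightarrow> number_field (adj x)"
  unfolding number_field_def
  using CC.finite_dimensionI[OF dimension_adj] subfield_adj subfield_CC_iff by blast

definition rat_poly :: "int poly \<Rightarrow> rat poly" where
  "rat_poly f = map_poly of_int f"

lemma qeval_rat_poly: "qeval (rat_poly f) x = poly (map_poly of_int f) x"
  unfolding qeval_def rat_poly_def by (simp add: map_poly_map_poly o_def)

lemma coeff_rat_poly [simp]: "coeff (rat_poly f) i = of_int (coeff f i)"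
  and degree_rat_poly [simp]: "degree (rat_poly f) = degree f"
  by (simp_all add: rat_poly_def coeff_map_poly degree_map_poly)

lemma algebraic_int_minpoly:
  assumes "algebraic_int x"
  shows "\<exists>m. is_minpoly m x"
proof -
  obtain q :: "int poly" where q: "poly (map_poly of_int q) x = 0" "lead_coeff q = 1"
    using assms unfolding algebraic_int_altdef_ipoly by auto
  have "rat_poly q \<noteq> 0"
  proof
    assume "rat_poly q = 0"
    hence "coeff (rat_poly q) (degree q) = 0" by simp
    thus False using q(2) by simp
  qed
  thus ?thesis using q ex_minpoly[of "rat_poly q" x] by (simp add: qeval_rat_poly)
qed

section \<open>Embeddings and Galois groups\<close>

locale subfield_hom = subfield_set K for K +
  fixes \<phi> :: "complex \<Rightarrow> complex"
  assumes hom_1: "\<phi> 1 = 1"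
    and hom_add: "x \<in> K \<Longrightarrow> y \<in> K \<Longrightarrow> \<phi> (x + y) = \<phi> x + \<phi> y"
    and hom_mult: "x \<in> K \<Longrightarrow> y \<in> K \<Longrightarrow> \<phi> (x * y) = \<phi> x * \<phi> y"
begin

lemma hom_0: "\<phi> 0 = 0"
  using hom_add[of 0 0] by simp

lemma hom_uminus: "x \<in> K \<Longrightarrow> \<phi> (- x) = - \<phi> x"
  using hom_add[of x "- x"] hom_0 by (simp add: uminus_S add_eq_0_iff)

lemma hom_diff: "x \<in> K \<Longrightarrow> y \<in> K \<Longrightarrow> \<phi> (x - y) = \<phi> x - \<phi> y"
  using hom_add[of x "- y"] hom_uminus by (simp add: uminus_S)

lemma hom_of_nat: "\<phi> (of_nat k) = of_nat k"
  by (induction k) (auto simp: hom_0 hom_1 hom_add)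

lemma hom_of_int: "\<phi> (of_int k) = of_int k"
  by (cases k) (auto simp: hom_of_nat hom_uminus simp del: of_nat_Suc)

lemma hom_inverse: "x \<in> K \<Longrightarrow> \<phi> (inverse x) = inverse (\<phi> x)"
proof (cases "x = 0")
  case False
  assume x: "x \<in> K"
  hence "\<phi> x * \<phi> (inverse x) = 1" using hom_mult[of x "inverse x"] inverse_K[OF x] False hom_1 by simp
  thus ?thesis by (rule inverse_unique[symmetric])
qed (simp add: hom_0)

lemma hom_of_rat: "\<phi> (of_rat r) = of_rat r"
proof (cases r)
  case (Fract a b)
  have "of_rat r = of_int a * inverse (complex_of_int b)"
    using Fract by (simp add: of_rat_rat divide_inverse)
  thus ?thesis by (simp add: hom_mult hom_inverse hom_of_int inverse_K)
qed

lemma hom_eq_0_iff: "x \<in> K \<Longrightarrow> \<phi> x = 0 \<longleftrightarrow> x = 0"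
proof
  assume x: "x \<in> K" and 0: "\<phi> x = 0"
  show "x = 0"
  proof (rule ccontr)
    assume "x \<noteq> 0"
    hence "\<phi> x * \<phi> (inverse x) = 1" using hom_mult[of x "inverse x"] inverse_K[OF x] x hom_1 by simp
    thus False using 0 by simp
  qed
qed (simp add: hom_0)

lemma hom_inj: "inj_on \<phi> K"
proof (rule inj_onI)
  fix x y assume "x \<in> K" "y \<in> K" "\<phi> x = \<phi> y"
  thus "x = y" using hom_eq_0_iff[of "x - y"] hom_diff[of x y] diff_S[of x y] by simp
qed

lemma hom_power: "x \<in> K \<Longrightarrow> \<phi> (x ^ k) = \<phi> x ^ k"
  by (induction k) (auto simp: hom_1 hom_mult power_S)

lemma hom_sum: "(\<And>i. i \<in> I \<Longrightarrow> g i \<in> K) \<Longrightarrow> \<phi> (sum g I) = (\<Sum>i\<in>I. \<phi> (g i))"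
  by (induction I rule: infinite_finite_induct) (auto simp: hom_0 hom_add sum_S)

lemma hom_qeval: "x \<in> K \<Longrightarrow> \<phi> (qeval g x) = qeval g (\<phi> x)"
  by (induction g) (auto simp: hom_0 hom_add hom_mult hom_of_rat qeval_K mult_S)

lemma hom_algebraic_int: "x \<in> K \<Longrightarrow> algebraic_int x \<Longrightarrow> algebraic_int (\<phi> x)"
proof -
  assume x: "x \<in> K" "algebraic_int x"
  then obtain q :: "int poly" where q: "qeval (rat_poly q) x = 0" "lead_coeff q = 1"
    unfolding algebraic_int_altdef_ipoly by (auto simp: qeval_rat_poly)
  hence "qeval (rat_poly q) (\<phi> x) = 0" using hom_qeval[OF x(1), of "rat_poly q"] hom_0 by simp
  thus ?thesis using q unfolding algebraic_int_altdef_ipoly by (auto simp: qeval_rat_poly)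
qed

text \<open>This reduces the claim that a homomorphism maps a field into \<open>F\<close> to a check
  on generators.\<close>

lemma subfield_vimage: "subfield_set F \<Longrightarrow> subfield_set {x \<in> K. \<phi> x \<in> F}"
proof -
  assume "subfield_set F"
  then interpret F: subfield_set F .
  show ?thesis
    by unfold_locales (auto simp: hom_1 hom_diff hom_mult hom_inverse)
qed

end

lemma ring_hom_iff:
  "subfield_set K \<Longrightarrow> \<phi> \<in> Ring.ring_hom (ring_on K) CC \<longleftrightarrow> subfield_hom K \<phi>"
  by (auto simp: Ring.ring_hom_def subfield_hom_def subfield_hom_axioms_def)

lemma embeddings_iff:
  "subfield_set K \<Longrightarrow> \<phi> \<in> embeddings K \<longleftrightarrow> subfield_hom K \<phi> \<and> \<phi> \<in> extensional K"
  by (simp add: embeddings_def ring_hom_iff)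

lemma gal_iff:
  "subfield_set L \<Longrightarrow> \<sigma> \<in> carrier (gal_group L) \<longleftrightarrow>
     subfield_hom L \<sigma> \<and> \<sigma> \<in> extensional L \<and> bij_betw \<sigma> L L"
  by (auto simp: gal_group_def Bij_def Ring.ring_hom_def subfield_hom_def subfield_hom_axioms_def
      bij_betw_def)

lemma gal_mult:
  "\<sigma> \<in> carrier (gal_group L) \<Longrightarrow> \<tau> \<in> carrier (gal_group L) \<Longrightarrow> \<sigma> \<otimes>\<^bsub>gal_group L\<^esub> \<tau> = compose L \<sigma> \<tau>"
  by (auto simp: gal_group_def BijGroup_def)

text \<open>The embedding with \<open>x \<mapsto> a\<close> for a conjugate \<open>a\<close> of
  \<open>x\<close>. By \<open>emb_qeval\<close> the chosen polynomial does not matter; the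
  restriction to \<open>adj x\<close> provides the extensionality demanded by
  \<open>embeddings\<close> and \<open>gal_group\<close>.\<close>

definition emb :: "complex \<Rightarrow> complex \<Rightarrow> complex \<Rightarrow> complex" where
  "emb x a = (\<lambda>y\<in>adj x. qeval (SOME g. qeval g x = y) a)"

lemma emb_qeval:
  assumes "is_minpoly m x" "qeval m a = 0"
  shows "emb x a (qeval g x) = qeval g a"
proof -
  define h where "h = (SOME h. qeval h x = qeval g x)"
  have "qeval h x = qeval g x" unfolding h_def by (rule someI[of _ g]) simp
  hence "qeval (h - g) x = 0" by simp
  hence "m dvd h - g" using is_minpolyD(3)[OF assms(1)] by blast
  hence "qeval (h - g) a = 0" using is_minpolyD(3)[OF is_minpoly_conjugate[OF assms]] by blast
  thus ?thesis by (simp add: emb_def h_def)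
qed

lemma emb_self: "is_minpoly m x \<Longrightarrow> qeval m a = 0 \<Longrightarrow> emb x a x = a"
  using emb_qeval[of m x a "[:0, 1:]"] by simp

lemma emb_hom:
  assumes "is_minpoly m x" "qeval m a = 0"
  shows "subfield_hom (adj x) (emb x a)"
proof -
  interpret subfield_set "adj x" by (rule subfield_adj[OF assms(1)])
  note ev = emb_qeval[OF assms]
  show ?thesis
  proof
    show "emb x a 1 = 1" using ev[of 1] by simp
    fix u v assume "u \<in> adj x" "v \<in> adj x"
    then obtain g h where gh: "u = qeval g x" "v = qeval h x" by (auto simp: adj_def)
    show "emb x a (u + v) = emb x a u + emb x a v" using ev[of "g + h"] ev[of g] ev[of h] gh by simp
    show "emb x a (u * v) = emb x a u * emb x a v" using ev[of "g * h"] ev[of g] ev[of h] gh by simp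
  qed
qed

lemma hom_adj_ext:
  assumes "subfield_hom (adj x) \<phi>" "subfield_hom (adj x) \<psi>" "\<phi> x = \<psi> x" "y \<in> adj x"
  shows "\<phi> y = \<psi> y"
proof -
  obtain g where "y = qeval g x" using assms(4) by (auto simp: adj_def)
  thus ?thesis
    using subfield_hom.hom_qeval[OF assms(1), of x g] subfield_hom.hom_qeval[OF assms(2), of x g] assms(3)
    by simp
qed

lemma embeddings_adj:
  assumes "is_minpoly m x"
  shows "bij_betw (\<lambda>\<phi>. \<phi> x) (embeddings (adj x)) {a. qeval m a = 0}"
    and "finite (embeddings (adj x))"
proof -
  have sf: "subfield_set (adj x)" by (rule subfield_adj[OF assms])
  have root: "qeval m (\<phi> x) = 0" if "\<phi> \<in> embeddings (adj x)" for \<phi>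
  proof -
    interpret subfield_hom "adj x" \<phi> using that embeddings_iff[OF sf] by blast
    show ?thesis using hom_qeval[of x m] is_minpolyD(4)[OF assms] hom_0 by simp
  qed
  have inj: "inj_on (\<lambda>\<phi>. \<phi> x) (embeddings (adj x))"
  proof (rule inj_onI)
    fix \<phi> \<psi> assume *: "\<phi> \<in> embeddings (adj x)" "\<psi> \<in> embeddings (adj x)" "\<phi> x = \<psi> x"
    thus "\<phi> = \<psi>" using embeddings_iff[OF sf] hom_adj_ext[of x \<phi> \<psi>]
      by (intro extensionalityI[of \<phi> "adj x" \<psi>]) auto
  qed
  have "a \<in> (\<lambda>\<phi>. \<phi> x) ` embeddings (adj x)" if a: "qeval m a = 0" for a
  proof (rule image_eqI[of _ _ "emb x a"])
    show "a = emb x a x" using emb_self[OF assms a] by simp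
    show "emb x a \<in> embeddings (adj x)"
      using embeddings_iff[OF sf] emb_hom[OF assms a] by (simp add: emb_def)
  qed
  thus bij: "bij_betw (\<lambda>\<phi>. \<phi> x) (embeddings (adj x)) {a. qeval m a = 0}"
    using inj root unfolding bij_betw_def by auto
  show "finite (embeddings (adj x))"
    using bij_betw_finite[OF bij] card_roots_minpoly(2)[OF assms] by simp
qed

text \<open>Finiteness of the group belongs to the interface because norms, traces and
  characteristic polynomials over the whole group are formed below.\<close>

locale galois_field =
  fixes L :: "complex set"
  assumes galois: "galois_over_Q L" and finite_gal: "finite (carrier (gal_group L))"

text \<open>Each conjugate of \<open>x\<close> gives an automorphism. If \<open>g\<close> has degree
  below \<open>degree m\<close> and \<open>qeval g x\<close> is fixed by all of them, then
  \<open>g\<close> takes one value at \<open>degree m\<close> points and is therefore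
  constant.\<close>

lemma galois_adj:
  assumes "is_minpoly m x" "\<And>a. qeval m a = 0 \<Longrightarrow> a \<in> adj x"
  shows "galois_field (adj x)"
proof -
  interpret subfield_set "adj x" by (rule subfield_adj[OF assms(1)])
  have sf: "subfield_set (adj x)" by (rule subfield_adj[OF assms(1)])
  let ?R = "{a. qeval m a = 0}"
  have fin: "finite ?R" by (rule card_roots_minpoly(2)[OF assms(1)])
  have gal: "emb x a \<in> carrier (gal_group (adj x))" if a: "qeval m a = 0" for a
  proof -
    interpret h: subfield_hom "adj x" "emb x a" by (rule emb_hom[OF assms(1) a])
    have into: "emb x a ` adj x \<subseteq> adj x"
    proof
      fix y assume "y \<in> emb x a ` adj x"
      then obtain g where "y = emb x a (qeval g x)" by (auto simp: adj_def)
      thus "y \<in> adj x" using emb_qeval[OF assms(1) a, of g] qeval_K[OF assms(2)[OF a], of g] by simp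
    qed
    \<comment> \<open>An injective self-map of the finite set of conjugates is onto, so
      \<open>x\<close> itself is an image and generates the image of the embedding.\<close>
    have "emb x a ` ?R \<subseteq> ?R"
    proof
      fix b assume "b \<in> emb x a ` ?R"
      then obtain c where c: "qeval m c = 0" "b = emb x a c" by auto
      thus "b \<in> ?R" using h.hom_qeval[of c m] assms(2) h.hom_0 by simp
    qed
    moreover have "inj_on (emb x a) ?R" by (rule inj_on_subset[OF h.hom_inj]) (use assms(2) in auto)
    ultimately have "emb x a ` ?R = ?R" using fin by (simp add: endo_inj_surj)
    then obtain b where b: "qeval m b = 0" "emb x a b = x"
      using is_minpolyD(4)[OF assms(1)] by (metis (mono_tags, lifting) imageE mem_Collect_eq)
    have "adj x \<subseteq> emb x a ` adj x"
    proof
      fix y assume "y \<in> adj x"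
      then obtain g where "y = qeval g x" by (auto simp: adj_def)
      hence "y = emb x a (qeval g b)" using h.hom_qeval[of b g] b assms(2) by simp
      moreover have "qeval g b \<in> adj x" using assms(2)[OF b(1)] by (rule qeval_K)
      ultimately show "y \<in> emb x a ` adj x" by blast
    qed
    thus ?thesis using into h.hom_inj gal_iff[OF sf] h.subfield_hom_axioms
      by (simp add: bij_betw_def emb_def)
  qed
  have "{y \<in> adj x. \<forall>\<sigma> \<in> carrier (gal_group (adj x)). \<sigma> y = y} = \<rat>"
  proof (intro equalityI subsetI)
    fix y assume y: "y \<in> {y \<in> adj x. \<forall>\<sigma> \<in> carrier (gal_group (adj x)). \<sigma> y = y}"
    then obtain a where a: "y = (\<Sum>i<degree m. of_rat (a i) * x ^ i)"
      using adj_eq_qspan(1)[OF assms(1)] by (auto simp: qspan_def)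
    define g where "g = (\<Sum>i<degree m. monom (a i :: rat) i)"
    have deg: "degree g < degree m" unfolding g_def
      using is_minpolyD(5)[OF assms(1)]
      by (intro degree_sum_less) (auto intro: le_less_trans[OF degree_monom_le])
    have yg: "y = qeval g x" using a by (simp add: g_def)
    have "qeval g b = y" if b: "qeval m b = 0" for b
      using y gal[OF b] emb_qeval[OF assms(1) b, of g] yg by auto
    hence "map_poly of_rat g = [:y:]"
      using deg card_roots_minpoly(1)[OF assms(1)]
      by (intro poly_eqI_degree[of ?R]) (auto simp: qeval_def degree_map_poly)
    hence "coeff (map_poly of_rat g) 0 = y" by simp
    thus "y \<in> \<rat>" by (auto simp: coeff_map_poly)
  next
    fix y :: complex assume "y \<in> \<rat>"
    then obtain r where r: "y = of_rat r" by (auto elim: Rats_cases)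
    have "\<sigma> y = y" if "\<sigma> \<in> carrier (gal_group (adj x))" for \<sigma>
      using that gal_iff[OF sf] subfield_hom.hom_of_rat r by blast
    thus "y \<in> {y \<in> adj x. \<forall>\<sigma> \<in> carrier (gal_group (adj x)). \<sigma> y = y}" using r by auto
  qed
  hence "galois_over_Q (adj x)" using number_field_adj[OF assms(1)] by (simp add: galois_over_Q_def)
  moreover have "finite (carrier (gal_group (adj x)))"
  proof (rule finite_subset)
    show "carrier (gal_group (adj x)) \<subseteq> embeddings (adj x)"
      using gal_iff[OF sf] embeddings_iff[OF sf] by blast
  qed (rule embeddings_adj(2)[OF assms(1)])
  ultimately show ?thesis by (simp add: galois_field_def)
qed

section \<open>Primitive elements and splitting fields\<close>

text \<open>An element of least degree divides the others. Leading terms are cancelled one by one,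
  so that all polynomials involved keep their coefficients in \<open>K\<close>.\<close>

lemma (in subfield_set) minimal_poly_over:
  assumes "h \<in> polys_over K" "h \<noteq> 0" "poly h \<beta> = 0"
  shows "\<exists>q. q \<in> polys_over K \<and> lead_coeff q = 1 \<and> poly q \<beta> = 0 \<and>
    (\<forall>r\<in>polys_over K. poly r \<beta> = 0 \<longrightarrow> q dvd r)"
proof -
  interpret pol: subring_set "polys_over K" by (rule subring_polys_over)
  let ?Q = "\<lambda>g. g \<in> polys_over K \<and> g \<noteq> 0 \<and> poly g \<beta> = 0"
  define q0 where "q0 = arg_min degree ?Q"
  have q0: "q0 \<in> polys_over K" "q0 \<noteq> 0" "poly q0 \<beta> = 0"
    using arg_min_natI[of ?Q h degree] assms by (auto simp: q0_def)
  have qmin: "degree q0 \<le> degree g" if "g \<in> polys_over K" "g \<noteq> 0" "poly g \<beta> = 0" for g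
    using arg_min_nat_le[of ?Q g degree] that by (auto simp: q0_def)
  define q where "q = smult (inverse (lead_coeff q0)) q0"
  have monom: "monom c k \<in> polys_over K" if "c \<in> K" for c k
    using that by (auto simp: polys_over_def)
  have q: "q \<in> polys_over K" "lead_coeff q = 1" "poly q \<beta> = 0" "degree q = degree q0" "q \<noteq> 0"
    using q0 by (auto simp: q_def polys_over_def)
  have "q dvd r" if "r \<in> polys_over K" "poly r \<beta> = 0" for r
    using that
  proof (induction "degree r" arbitrary: r rule: less_induct)
    case less
    show ?case
    proof (cases "r = 0")
      case False
      define s where "s = monom (lead_coeff r) (degree r - degree q) * q"
      have le: "degree q \<le> degree r" using qmin[of r] less.prems False q by simp
      have lc: "lead_coeff r \<in> K" using less.prems(1) by (auto simp: polys_over_def)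
      have sK: "s \<in> polys_over K" unfolding s_def using monom[OF lc] q(1) by (rule pol.mult_S)
      have ds: "degree s = degree r"
        unfolding s_def using False q(5) le by (subst degree_mult_eq) (auto simp: degree_monom_eq)
      have ls: "lead_coeff s = lead_coeff r"
        unfolding s_def by (simp only: lead_coeff_mult lead_coeff_monom q(2) mult_1_right)
      have "q dvd s" by (simp add: s_def)
      moreover have "q dvd r - s"
      proof (cases "r - s = 0")
        case ne: False
        have "degree (r - s) < degree r"
        proof (rule degree_lessI)
          show "r - s \<noteq> 0 \<or> 0 < degree r" using ne by simp
          show "\<forall>k\<ge>degree r. coeff (r - s) k = 0"
          proof (intro allI impI)
            fix k assume "k \<ge> degree r"
            thus "coeff (r - s) k = 0"
              using ls ds by (cases "k = degree r") (auto simp: coeff_eq_0)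
          qed
        qed
        moreover have "poly (r - s) \<beta> = 0" using less.prems q by (simp add: s_def)
        ultimately show ?thesis using less.hyps[of "r - s"] pol.diff_S[OF less.prems(1) sK] by blast
      qed simp
      ultimately have "q dvd (r - s) + s" by (intro dvd_add)
      thus ?thesis by simp
    qed simp
  qed
  thus ?thesis using q by blast
qed

text \<open>With \<open>\<gamma> = \<alpha> + c * \<beta>\<close>, the minimal polynomial
  \<open>q\<close> of \<open>\<beta>\<close> over \<open>adj \<gamma>\<close> divides both
  \<open>g\<close> and \<open>f(\<gamma> - c X)\<close>. For suitable \<open>c\<close> their only
  common root is \<open>\<beta>\<close>, which is a simple root of \<open>g\<close>, so
  \<open>q\<close> is linear.\<close>

lemma primitive_element_two:
  fixes \<alpha> \<beta> :: complex
  assumes "algebraic_int \<alpha>" "algebraic_int \<beta>"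
  shows "\<exists>c::nat. \<alpha> \<in> adj (\<alpha> + of_nat c * \<beta>) \<and> \<beta> \<in> adj (\<alpha> + of_nat c * \<beta>)"
proof -
  obtain f where f: "is_minpoly f \<alpha>" using algebraic_int_minpoly assms by blast
  obtain g where g: "is_minpoly g \<beta>" using algebraic_int_minpoly assms by blast
  note fD = is_minpolyD[OF f]
  note gD = is_minpolyD[OF g]
  \<comment> \<open>The value \<open>c\<close> is bad if \<open>\<gamma> - c * b\<close> is a root
    of \<open>f\<close> for some root \<open>b \<noteq> \<beta>\<close> of \<open>g\<close>. The
    pairs with \<open>b = \<beta>\<close> contribute only the value \<open>0\<close>.\<close>
  let ?B = "(\<lambda>(a, b). (a - \<alpha>) / (\<beta> - b)) ` ({a. qeval f a = 0} \<times> {b. qeval g b = 0})"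
  have "finite ?B" using card_roots_minpoly(2)[OF f] card_roots_minpoly(2)[OF g] by simp
  moreover have "infinite (range (of_nat :: nat \<Rightarrow> complex))"
    by (simp add: finite_image_iff inj_of_nat)
  ultimately obtain c :: nat where c: "of_nat c \<notin> ?B"
    by (metis finite_subset image_subsetI)
  define \<gamma> where "\<gamma> = \<alpha> + of_nat c * \<beta>"
  have "algebraic_int \<gamma>" unfolding \<gamma>_def
    using assms algebraic_int_plus_times algebraic_int_of_nat by blast
  then obtain m where m: "is_minpoly m \<gamma>" using algebraic_int_minpoly by blast
  interpret F: subfield_set "adj \<gamma>" by (rule subfield_adj[OF m])
  interpret pol: subring_set "polys_over (adj \<gamma>)" by (rule F.subring_polys_over)
  let ?g = "map_poly of_rat g :: complex poly"
  let ?f = "map_poly of_rat f :: complex poly"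
  let ?h = "pcompose ?f [:\<gamma>, - of_nat c:]"
  have "?g \<in> polys_over (adj \<gamma>)" by (auto simp: polys_over_def coeff_map_poly)
  moreover have "?g \<noteq> 0" using gD(2) by (simp add: map_poly_eq_0_iff)
  moreover have "poly ?g \<beta> = 0" using gD(4) by (simp add: qeval_def)
  ultimately obtain q where q: "q \<in> polys_over (adj \<gamma>)" "lead_coeff q = 1" "poly q \<beta> = 0"
      "\<And>r. r \<in> polys_over (adj \<gamma>) \<Longrightarrow> poly r \<beta> = 0 \<Longrightarrow> q dvd r"
    using F.minimal_poly_over[of ?g \<beta>] by blast
  have qg: "q dvd ?g" using q(4) \<open>?g \<in> polys_over (adj \<gamma>)\<close> \<open>poly ?g \<beta> = 0\<close> by blast
  have "coeff ?h i \<in> adj \<gamma>" for i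
    by (rule coeff_pcompose_semiring_closed)
       (auto simp: coeff_map_poly coeff_pCons split: nat.split)
  hence "?h \<in> polys_over (adj \<gamma>)" by (simp add: polys_over_def)
  moreover have "poly ?h \<beta> = 0" using fD(4) by (simp add: poly_pcompose qeval_def \<gamma>_def algebra_simps)
  ultimately have qh: "q dvd ?h" using q(4) by blast
  have root: "z = \<beta>" if "poly q z = 0" for z
  proof (rule ccontr)
    assume "z \<noteq> \<beta>"
    have "poly ?g z = 0" "poly ?h z = 0" using that qg qh by (auto elim!: dvdE)
    hence "qeval g z = 0" "qeval f (\<gamma> - of_nat c * z) = 0"
      by (simp_all add: qeval_def poly_pcompose algebra_simps)
    hence "((\<gamma> - of_nat c * z) - \<alpha>) / (\<beta> - z) \<in> ?B" by (auto intro!: image_eqI[of _ _ "(\<gamma> - of_nat c * z, z)"])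
    moreover have "((\<gamma> - of_nat c * z) - \<alpha>) / (\<beta> - z) = of_nat c"
      using \<open>z \<noteq> \<beta>\<close> by (simp add: \<gamma>_def field_simps)
    ultimately show False using c by simp
  qed
  obtain q1 where q1: "q = [:- \<beta>, 1:] * q1" using q(3) by (auto simp: poly_eq_0_iff_dvd)
  have "degree q1 = 0"
  proof (rule ccontr)
    assume "degree q1 \<noteq> 0"
    hence "\<not> constant (poly q1)" by (simp add: constant_degree)
    then obtain z where z: "poly q1 z = 0" using fundamental_theorem_of_algebra by blast
    hence "z = \<beta>" using root[of z] q1 by simp
    hence "[:- \<beta>, 1:] dvd q1" using z by (simp add: poly_eq_0_iff_dvd)
    then obtain q2 where "q1 = [:- \<beta>, 1:] * q2" by auto
    moreover obtain q3 where "?g = q * q3" using qg by auto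
    ultimately have "?g = [:- \<beta>, 1:] * ([:- \<beta>, 1:] * (q2 * q3))" using q1 by (simp only: mult.assoc)
    moreover have "poly (pderiv ([:- \<beta>, 1:] * ([:- \<beta>, 1:] * u))) \<beta> = 0" for u
      by (simp only: pderiv_mult poly_add poly_mult) simp
    ultimately have "poly (pderiv ?g) \<beta> = 0" by metis
    thus False using minpoly_pderiv[OF g] by (simp add: qeval_def map_poly_of_rat_pderiv)
  qed
  then obtain k where "q1 = [:k:]" by (auto elim: degree_eq_zeroE)
  hence "q = [:- \<beta> * k, k:]" using q1 by simp
  hence "q = [:- \<beta>, 1:]" using q(2) by (cases "k = 0") auto
  hence "- \<beta> = coeff q 0" by simp
  hence "- \<beta> \<in> adj \<gamma>" using q(1) by (auto simp: polys_over_def)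
  hence b: "\<beta> \<in> adj \<gamma>" using F.uminus_S[of "- \<beta>"] by simp
  hence "\<gamma> - of_nat c * \<beta> \<in> adj \<gamma>" by (intro F.diff_S F.mult_S) auto
  thus ?thesis using b by (auto simp: \<gamma>_def)
qed

text \<open>The last conjunct records that \<open>adj \<gamma>\<close> is the smallest subfield
  containing \<open>R\<close>; natural number multiples in the construction keep
  \<open>\<gamma>\<close> an algebraic integer.\<close>

lemma primitive_element:
  assumes "finite R" "\<And>r. r \<in> R \<Longrightarrow> algebraic_int r"
  shows "\<exists>\<gamma>. algebraic_int \<gamma> \<and> R \<subseteq> adj \<gamma> \<and> (\<forall>F. subfield_set F \<longrightarrow> R \<subseteq> F \<longrightarrow> \<gamma> \<in> F)"
  using assms
proof (induction R rule: finite_induct)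
  case empty
  show ?case
    by (intro exI[of _ 1]) (auto simp: subfield_set_def subring_set_def)
next
  case (insert \<beta> R)
  then obtain \<gamma>' where \<gamma>': "algebraic_int \<gamma>'" "R \<subseteq> adj \<gamma>'" "\<forall>F. subfield_set F \<longrightarrow> R \<subseteq> F \<longrightarrow> \<gamma>' \<in> F"
    by auto
  obtain c :: nat where c: "\<gamma>' \<in> adj (\<gamma>' + of_nat c * \<beta>)" "\<beta> \<in> adj (\<gamma>' + of_nat c * \<beta>)"
    using primitive_element_two[of \<gamma>' \<beta>] \<gamma>'(1) insert.prems by blast
  define \<gamma> where "\<gamma> = \<gamma>' + of_nat c * \<beta>"
  have alg: "algebraic_int \<gamma>" unfolding \<gamma>_def
    using \<gamma>'(1) insert.prems algebraic_int_plus_times algebraic_int_of_nat by blast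
  then obtain m where m: "is_minpoly m \<gamma>" using algebraic_int_minpoly by blast
  interpret F: subfield_set "adj \<gamma>" by (rule subfield_adj[OF m])
  have "adj \<gamma>' \<subseteq> adj \<gamma>" using c(1) unfolding \<gamma>_def[symmetric] by (rule F.adj_subset)
  hence "insert \<beta> R \<subseteq> adj \<gamma>" using \<gamma>'(2) c(2) by (auto simp: \<gamma>_def)
  moreover have "\<gamma> \<in> F" if F: "subfield_set F" "insert \<beta> R \<subseteq> F" for F
  proof -
    interpret F': subfield_set F by fact
    have "\<gamma>' \<in> F" using \<gamma>'(3) F by blast
    thus ?thesis unfolding \<gamma>_def using F(2) by (intro F'.plus_S F'.mult_S) auto
  qed
  ultimately show ?case using alg by blast
qed

text \<open>An embedding of \<open>adj \<gamma>\<close> sends roots of \<open>f\<close> to roots of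
  \<open>f\<close>. The elements mapped into \<open>adj \<gamma>\<close> thus form a subfield
  containing \<open>R\<close>, hence containing \<open>\<gamma>\<close>, so all conjugates of
  \<open>\<gamma>\<close> lie in \<open>adj \<gamma>\<close>.\<close>

lemma splitting_field:
  fixes f :: "rat poly"
  assumes "finite R" "\<And>r. r \<in> R \<Longrightarrow> algebraic_int r" "R = {a. qeval f a = 0}"
  obtains L where "galois_field L" "R \<subseteq> L" "\<And>F. subfield_set F \<Longrightarrow> R \<subseteq> F \<Longrightarrow> L \<subseteq> F"
proof -
  obtain \<gamma> where \<gamma>: "algebraic_int \<gamma>" "R \<subseteq> adj \<gamma>" "\<And>F. subfield_set F \<Longrightarrow> R \<subseteq> F \<Longrightarrow> \<gamma> \<in> F"
    using primitive_element[of R] assms by blast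
  obtain m where m: "is_minpoly m \<gamma>" using algebraic_int_minpoly[OF \<gamma>(1)] by blast
  have sf: "subfield_set (adj \<gamma>)" by (rule subfield_adj[OF m])
  have "a \<in> adj \<gamma>" if a: "qeval m a = 0" for a
  proof -
    interpret h: subfield_hom "adj \<gamma>" "emb \<gamma> a" by (rule emb_hom[OF m a])
    have "R \<subseteq> {x \<in> adj \<gamma>. emb \<gamma> a x \<in> adj \<gamma>}"
    proof
      fix r assume r: "r \<in> R"
      hence "qeval f (emb \<gamma> a r) = 0" using h.hom_qeval[of r f] h.hom_0 \<gamma>(2) assms(3) by auto
      hence "emb \<gamma> a r \<in> R" using assms(3) by simp
      thus "r \<in> {x \<in> adj \<gamma>. emb \<gamma> a x \<in> adj \<gamma>}" using r \<gamma>(2) by auto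
    qed
    hence "\<gamma> \<in> {x \<in> adj \<gamma>. emb \<gamma> a x \<in> adj \<gamma>}" by (rule \<gamma>(3)[OF h.subfield_vimage[OF sf]])
    thus ?thesis using emb_self[OF m a] by simp
  qed
  hence "galois_field (adj \<gamma>)" by (rule galois_adj[OF m])
  moreover have "adj \<gamma> \<subseteq> F" if "subfield_set F" "R \<subseteq> F" for F
    using subfield_set.adj_subset[OF that(1)] \<gamma>(3)[OF that] by blast
  ultimately show thesis using that \<gamma>(2) by blast
qed

section \<open>Ring homomorphisms on coefficients\<close>

text \<open>Source and target types are arbitrary so that the passage from \<open>h\<close> to
  \<open>map_poly h\<close> can be repeated, as \<open>char_poly_int\<close> requires.\<close>

locale ring_hom_on = subring_set S for S :: "'a :: comm_ring_1 set" +
  fixes h :: "'a \<Rightarrow> 'b :: comm_ring_1"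
  assumes h_0: "h 0 = 0" and h_1: "h 1 = 1"
    and h_add: "x \<in> S \<Longrightarrow> y \<in> S \<Longrightarrow> h (x + y) = h x + h y"
    and h_mult: "x \<in> S \<Longrightarrow> y \<in> S \<Longrightarrow> h (x * y) = h x * h y"
begin

lemma h_uminus: "x \<in> S \<Longrightarrow> h (- x) = - h x"
  using h_add[of x "- x"] h_0 uminus_S[of x] by (simp add: add_eq_0_iff)

lemma h_sum: "(\<And>i. i \<in> I \<Longrightarrow> g i \<in> S) \<Longrightarrow> h (sum g I) = (\<Sum>i\<in>I. h (g i))"
  by (induction I rule: infinite_finite_induct) (auto simp: h_0 h_add sum_S)

lemma h_prod: "(\<And>i. i \<in> I \<Longrightarrow> g i \<in> S) \<Longrightarrow> h (prod g I) = (\<Prod>i\<in>I. h (g i))"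
  by (induction I rule: infinite_finite_induct) (auto simp: h_1 h_mult prod_S)

lemma coeff_map_h: "coeff (map_poly h q) i = h (coeff q i)"
  by (simp add: coeff_map_poly h_0)

lemma ring_hom_on_polys: "ring_hom_on (polys_over S) (map_poly h)"
proof -
  interpret pol: subring_set "polys_over S" by (rule subring_polys_over)
  show ?thesis
  proof
    show "map_poly h 0 = 0" by simp
    show "map_poly h 1 = 1" by (rule poly_eqI) (simp add: coeff_map_h coeff_1 h_0 h_1)
    fix q r assume qr: "q \<in> polys_over S" "r \<in> polys_over S"
    hence in_S: "coeff q i \<in> S" "coeff r i \<in> S" for i by (auto simp: polys_over_def)
    show "map_poly h (q + r) = map_poly h q + map_poly h r"
      by (rule poly_eqI) (simp add: coeff_map_h h_add in_S)
    show "map_poly h (q * r) = map_poly h q * map_poly h r"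
      by (rule poly_eqI) (simp add: coeff_map_h coeff_mult h_sum h_mult in_S mult_S)
  qed
qed

end

section \<open>Prime ideals and Frobenius elements in Galois number fields\<close>

lemma gal_compose:
  assumes "subfield_set L" "\<sigma> \<in> carrier (gal_group L)" "\<tau> \<in> carrier (gal_group L)"
  shows "compose L \<sigma> \<tau> \<in> carrier (gal_group L)"
proof -
  interpret s: subfield_hom L \<sigma> using assms gal_iff by blast
  interpret t: subfield_hom L \<tau> using assms gal_iff by blast
  have bij: "bij_betw \<sigma> L L" "bij_betw \<tau> L L" using assms gal_iff by blast+
  have "\<tau> x \<in> L" if "x \<in> L" for x using bij(2) that by (auto simp: bij_betw_def)
  hence "subfield_hom L (compose L \<sigma> \<tau>)"
    by unfold_locales (auto simp: compose_def s.hom_1 t.hom_1 s.hom_add t.hom_add s.hom_mult t.hom_mult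
        s.plus_S s.mult_S)
  thus ?thesis using gal_iff[OF assms(1)] bij_betw_compose[OF bij(2,1)] by simp
qed

lemma prime_over_restrict:
  assumes "prime_set_over {x :: complex. algebraic_int x} M p" "subfield_set L"
  shows "prime_set_over (ring_of_integers L) (M \<inter> L) p"
proof -
  interpret M: prime_set_over "{x :: complex. algebraic_int x}" M p by fact
  interpret L: subfield_set L by fact
  have MA: "algebraic_int x" if "x \<in> M" for x using M.P_sub that by auto
  have A: "algebraic_int (x - y)" "algebraic_int (x * y)" if "algebraic_int x" "algebraic_int y" for x y :: complex
    using that M.diff_S[of x y] M.mult_S[of x y] by auto
  show ?thesis
  proof unfold_locales
    show "x * y \<in> M \<inter> L \<Longrightarrow> x \<in> M \<inter> L \<or> y \<in> M \<inter> L"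
      if "x \<in> ring_of_integers L" "y \<in> ring_of_integers L" for x y
      using that M.prime_P[of x y] by (auto simp: ring_of_integers_def)
  qed (use M.one_P M.mult_P M.prime_p M.p_P in
      \<open>auto simp: ring_of_integers_def MA A L.diff_S L.mult_S M.plus_P L.plus_S\<close>)
qed

context galois_field
begin

abbreviation G where "G \<equiv> carrier (gal_group L)"
abbreviation \<O> where "\<O> \<equiv> ring_of_integers L"

lemma subfield_L: "subfield_set L"
  using galois subfield_CC_iff by (auto simp: galois_over_Q_def number_field_def)

end

sublocale galois_field \<subseteq> L: subfield_set L by (rule subfield_L)

sublocale galois_field \<subseteq> O: subring_set "ring_of_integers L"
proof -
  interpret A: subring_set "{x :: complex. algebraic_int x}" by (rule subring_set_alg_ints)
  show "subring_set (ring_of_integers L)"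
  proof
    fix x y assume "x \<in> ring_of_integers L" "y \<in> ring_of_integers L"
    thus "x - y \<in> ring_of_integers L" "x * y \<in> ring_of_integers L"
      using A.diff_S[of x y] A.mult_S[of x y] L.diff_S[of x y] L.mult_S[of x y]
      by (auto simp: ring_of_integers_def)
  qed (auto simp: ring_of_integers_def)
qed

context galois_field
begin

lemma \<O>_L: "x \<in> \<O> \<Longrightarrow> x \<in> L"
  by (simp add: ring_of_integers_def)

lemma G_hom: "\<sigma> \<in> G \<Longrightarrow> subfield_hom L \<sigma>"
  and G_bij: "\<sigma> \<in> G \<Longrightarrow> bij_betw \<sigma> L L"
  and G_ext: "\<sigma> \<in> G \<Longrightarrow> \<sigma> \<in> extensional L"
  using gal_iff[OF subfield_L] by auto

lemma G_in [intro]: "\<sigma> \<in> G \<Longrightarrow> x \<in> L \<Longrightarrow> \<sigma> x \<in> L"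
  using G_bij by (auto simp: bij_betw_def)

lemma G_in_O [intro]: "\<sigma> \<in> G \<Longrightarrow> x \<in> \<O> \<Longrightarrow> \<sigma> x \<in> \<O>"
  using G_in subfield_hom.hom_algebraic_int[OF G_hom] by (auto simp: ring_of_integers_def)

lemma G_inj: "\<sigma> \<in> G \<Longrightarrow> x \<in> L \<Longrightarrow> y \<in> L \<Longrightarrow> \<sigma> x = \<sigma> y \<longleftrightarrow> x = y"
  using G_bij by (auto simp: bij_betw_def inj_on_def)

lemma G_eqI: "\<sigma> \<in> G \<Longrightarrow> \<tau> \<in> G \<Longrightarrow> (\<And>x. x \<in> L \<Longrightarrow> \<sigma> x = \<tau> x) \<Longrightarrow> \<sigma> = \<tau>"
  using G_ext by (intro extensionalityI[of \<sigma> L \<tau>]) auto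

lemma ring_hom_on_O: "\<sigma> \<in> G \<Longrightarrow> ring_hom_on \<O> \<sigma>"
proof -
  assume "\<sigma> \<in> G"
  then interpret h: subfield_hom L \<sigma> by (rule G_hom)
  show ?thesis by unfold_locales (auto simp: h.hom_0 h.hom_1 h.hom_add h.hom_mult \<O>_L)
qed

definition gid where "gid = (\<lambda>x\<in>L. x)"

lemma gid_G [simp, intro]: "gid \<in> G"
proof -
  have "subfield_hom L gid" by unfold_locales (auto simp: gid_def L.plus_S L.mult_S)
  moreover have "bij_betw gid L L" unfolding gid_def by (simp add: bij_betw_def inj_on_def)
  ultimately show ?thesis using gal_iff[OF subfield_L] by (simp add: gid_def)
qed

lemma gid_apply [simp]: "x \<in> L \<Longrightarrow> gid x = x"
  by (simp add: gid_def)

lemma compose_G [intro]: "\<sigma> \<in> G \<Longrightarrow> \<tau> \<in> G \<Longrightarrow> compose L \<sigma> \<tau> \<in> G"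
  by (rule gal_compose[OF subfield_L])

lemma compose_apply [simp]: "x \<in> L \<Longrightarrow> compose L \<sigma> \<tau> x = \<sigma> (\<tau> x)"
  by (simp add: compose_def)

definition ginv where "ginv \<sigma> = (\<lambda>x\<in>L. inv_into L \<sigma> x)"

lemma ginv_apply: "\<sigma> \<in> G \<Longrightarrow> x \<in> L \<Longrightarrow> ginv \<sigma> (\<sigma> x) = x" "\<sigma> \<in> G \<Longrightarrow> x \<in> L \<Longrightarrow> \<sigma> (ginv \<sigma> x) = x"
  using bij_betw_inv_into_left[OF G_bij, of \<sigma> x] bij_betw_inv_into_right[OF G_bij, of \<sigma> x] G_in[of \<sigma> x]
  by (auto simp: ginv_def)

lemma ginv_G [intro]: "\<sigma> \<in> G \<Longrightarrow> ginv \<sigma> \<in> G"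
proof -
  assume s: "\<sigma> \<in> G"
  interpret s: subfield_hom L \<sigma> by (rule G_hom[OF s])
  have bij: "bij_betw (ginv \<sigma>) L L"
    using bij_betw_inv_into[OF G_bij[OF s]] by (simp add: ginv_def cong: bij_betw_cong)
  hence gi: "ginv \<sigma> x \<in> L" if "x \<in> L" for x using that by (auto simp: bij_betw_def)
  have "subfield_hom L (ginv \<sigma>)"
  proof
    show "ginv \<sigma> 1 = 1" using ginv_apply(1)[OF s, of 1] s.hom_1 by simp
    fix x y assume xy: "x \<in> L" "y \<in> L"
    have "\<sigma> (ginv \<sigma> x + ginv \<sigma> y) = x + y"
      using xy gi ginv_apply(2)[OF s] by (simp add: s.hom_add)
    thus "ginv \<sigma> (x + y) = ginv \<sigma> x + ginv \<sigma> y"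
      using ginv_apply(1)[OF s, of "ginv \<sigma> x + ginv \<sigma> y"] gi xy by (simp add: L.plus_S)
    have "\<sigma> (ginv \<sigma> x * ginv \<sigma> y) = x * y"
      using xy gi ginv_apply(2)[OF s] by (simp add: s.hom_mult)
    thus "ginv \<sigma> (x * y) = ginv \<sigma> x * ginv \<sigma> y"
      using ginv_apply(1)[OF s, of "ginv \<sigma> x * ginv \<sigma> y"] gi xy by (simp add: L.mult_S)
  qed
  thus ?thesis using bij gal_iff[OF subfield_L] by (simp add: ginv_def)
qed

lemma bij_left_mult: "\<tau> \<in> G \<Longrightarrow> bij_betw (compose L \<tau>) G G"
proof -
  assume t: "\<tau> \<in> G"
  have "inj_on (compose L \<tau>) G"
  proof (rule inj_onI)
    fix \<sigma> \<rho> assume *: "\<sigma> \<in> G" "\<rho> \<in> G" and eq: "compose L \<tau> \<sigma> = compose L \<tau> \<rho>"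
    show "\<sigma> = \<rho>"
    proof (rule G_eqI[OF *])
      fix x assume x: "x \<in> L"
      hence "\<tau> (\<sigma> x) = \<tau> (\<rho> x)" using fun_cong[OF eq, of x] by simp
      thus "\<sigma> x = \<rho> x" using G_inj[OF t] G_in * x by simp
    qed
  qed
  moreover have "compose L \<tau> ` G \<subseteq> G" using t by auto
  ultimately show ?thesis using finite_gal by (simp add: bij_betw_def endo_inj_surj)
qed

lemma fixed_imp_int: "x \<in> \<O> \<Longrightarrow> (\<And>\<sigma>. \<sigma> \<in> G \<Longrightarrow> \<sigma> x = x) \<Longrightarrow> x \<in> \<int>"
proof -
  assume x: "x \<in> \<O>" and fx: "\<And>\<sigma>. \<sigma> \<in> G \<Longrightarrow> \<sigma> x = x"
  hence "x \<in> {x \<in> L. \<forall>\<sigma>\<in>G. \<sigma> x = x}" using \<O>_L by simp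
  hence "x \<in> \<rat>" using galois unfolding galois_over_Q_def by blast
  thus ?thesis using x rational_algebraic_int_is_int by (auto simp: ring_of_integers_def)
qed

lemma restrict_funpow_G: "\<rho> \<in> G \<Longrightarrow> restrict (\<rho> ^^ k) L \<in> G"
proof (induction k)
  case 0
  have "restrict (\<rho> ^^ 0) L = gid" by (auto simp: gid_def restrict_def)
  thus ?case using gid_G by (simp only:)
next
  case (Suc k)
  have "restrict (\<rho> ^^ Suc k) L = compose L \<rho> (restrict (\<rho> ^^ k) L)"
    by (auto simp: compose_def restrict_def)
  thus ?case using compose_G[OF Suc.prems Suc.IH[OF Suc.prems]] by (simp only:)
qed

lemma finite_order: "\<rho> \<in> G \<Longrightarrow> \<exists>k>0. \<forall>x\<in>L. (\<rho> ^^ k) x = x"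
proof -
  assume r: "\<rho> \<in> G"
  have pow_L: "(\<rho> ^^ k) x \<in> L" if "x \<in> L" for k x using that r by (induction k) auto
  note pow = restrict_funpow_G[OF r]
  have "\<not> inj (\<lambda>k. restrict (\<rho> ^^ k) L)"
  proof
    assume "inj (\<lambda>k. restrict (\<rho> ^^ k) L)"
    hence "infinite (range (\<lambda>k. restrict (\<rho> ^^ k) L))" using finite_imageD by blast
    moreover have "range (\<lambda>k. restrict (\<rho> ^^ k) L) \<subseteq> G" using pow by auto
    ultimately show False using finite_gal finite_subset by blast
  qed
  then obtain i j where "i \<noteq> j" "restrict (\<rho> ^^ i) L = restrict (\<rho> ^^ j) L" unfolding inj_def by blast
  then obtain i j where ij: "i < j" "restrict (\<rho> ^^ i) L = restrict (\<rho> ^^ j) L" by (metis nat_neq_iff)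
  have "(\<rho> ^^ (j - i)) x = x" if x: "x \<in> L" for x
  proof -
    have "(\<rho> ^^ j) x = (\<rho> ^^ (i + (j - i))) x" using ij by simp
    hence "(\<rho> ^^ i) x = (\<rho> ^^ i) ((\<rho> ^^ (j - i)) x)"
      using fun_cong[OF ij(2), of x] x by (simp add: funpow_add)
    moreover have "u = v" if "(\<rho> ^^ i) u = (\<rho> ^^ i) v" "u \<in> L" "v \<in> L" for u v
      using that by (induction i) (auto simp: G_inj[OF r] pow_L)
    ultimately show ?thesis using x pow_L by metis
  qed
  thus ?thesis using ij by (intro exI[of _ "j - i"]) auto
qed

text \<open>Some positive power of \<open>\<rho>\<close> is the identity on \<open>L\<close>, so
  every element of \<open>P\<close> is the image of an iterate that stays in
  \<open>P\<close>.\<close>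

lemma image_sub_imp_eq: "\<rho> \<in> G \<Longrightarrow> P \<subseteq> L \<Longrightarrow> \<rho> ` P \<subseteq> P \<Longrightarrow> \<rho> ` P = P"
proof
  assume r: "\<rho> \<in> G" and P: "P \<subseteq> L" "\<rho> ` P \<subseteq> P"
  obtain k where k: "k > 0" "\<forall>x\<in>L. (\<rho> ^^ k) x = x" using finite_order[OF r] by blast
  have pw: "(\<rho> ^^ j) x \<in> P" if "x \<in> P" for x j using that P(2) by (induction j) auto
  show "P \<subseteq> \<rho> ` P"
  proof
    fix x assume x: "x \<in> P"
    have "x = (\<rho> ^^ Suc (k - 1)) x" using k x P by auto
    hence "x = \<rho> ((\<rho> ^^ (k - 1)) x)" by simp
    thus "x \<in> \<rho> ` P" using pw[OF x] by blast
  qed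
qed

text \<open>The bridge from the ideals of the record \<open>ring_on \<O>\<close>, in which
  ramification and Artin symbols are phrased, to sets of complex numbers.\<close>

lemma primes_above_iff: "P \<in> primes_above L p \<longleftrightarrow> prime_set \<O> P \<and> of_nat p \<in> P"
proof
  assume "P \<in> primes_above L p"
  hence P: "primeideal P (ring_on \<O>)" "of_nat p \<in> P" by (auto simp: primes_above_def)
  interpret primeideal P "ring_on \<O>" by fact
  have sub: "P \<subseteq> \<O>" using a_subset by simp
  have one: "1 \<notin> P"
  proof
    assume "1 \<in> P"
    hence "\<O> \<subseteq> P" using I_l_closed[of 1] by auto
    thus False using I_notcarr sub by simp
  qed
  have "prime_set \<O> P"
  proof unfold_locales
    show "P \<subseteq> \<O>" "1 \<notin> P" "0 \<in> P"
      using sub one additive_subgroup.zero_closed[OF is_additive_subgroup] by simp_all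
    show "x + y \<in> P" if "x \<in> P" "y \<in> P" for x y
      using additive_subgroup.a_closed[OF is_additive_subgroup that] by simp
    show "a * x \<in> P" if "x \<in> P" "a \<in> \<O>" for x a using I_l_closed[of x a] that by simp
    show "x \<in> P \<or> y \<in> P" if "x \<in> \<O>" "y \<in> \<O>" "x * y \<in> P" for x y using I_prime[of x y] that by simp
  qed
  thus "prime_set \<O> P \<and> of_nat p \<in> P" using P by blast
next
  assume "prime_set \<O> P \<and> of_nat p \<in> P"
  then interpret prime_set \<O> P by blast
  have "subring \<O> CC" using subring_CC_iff O.subring_set_axioms by blast
  hence cring: "cring (ring_on \<O>)"
    using CC.subcring_iff[of \<O>] cring.subcringI'[OF cring_from_type_algebra, of \<O>] by simp
  then interpret R: cring "ring_on \<O>" .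
  have neg: "inv\<^bsub>add_monoid (ring_on \<O>)\<^esub> x = - x" if "x \<in> \<O>" for x
  proof -
    have "\<ominus>\<^bsub>ring_on \<O>\<^esub> x = - x" using R.minus_equality[of "- x" x] that O.uminus_S by simp
    thus ?thesis by (simp add: a_inv_def)
  qed
  have "primeideal P (ring_on \<O>)"
  proof (rule primeidealI)
    show "ideal P (ring_on \<O>)"
    proof (rule idealI)
      show "Ring.ring (ring_on \<O>)" by (rule R.ring_axioms)
      show "subgroup P (add_monoid (ring_on \<O>))"
      proof
        fix x assume "x \<in> P"
        thus "inv\<^bsub>add_monoid (ring_on \<O>)\<^esub> x \<in> P" using neg[of x] P_sub by auto
      qed (use P_sub in \<open>auto intro: plus_P\<close>)
    qed (auto intro: mult_P mult_P')
    show "carrier (ring_on \<O>) \<noteq> P" using one_P by auto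
  qed (use cring prime_P in auto)
  thus "P \<in> primes_above L p" using \<open>prime_set \<O> P \<and> of_nat p \<in> P\<close> by (simp add: primes_above_def)
qed

lemma primes_aboveD: "prime p \<Longrightarrow> P \<in> primes_above L p \<Longrightarrow> prime_set_over \<O> P p"
  using primes_above_iff by (auto simp: prime_set_over_def prime_set_over_axioms_def)

lemma image_primes_above:
  assumes "P \<in> primes_above L p" "\<sigma> \<in> G"
  shows "\<sigma> ` P \<in> primes_above L p"
proof -
  interpret prime_set \<O> P using assms primes_above_iff by blast
  interpret h: subfield_hom L \<sigma> by (rule G_hom[OF assms(2)])
  have PL: "x \<in> L" if "x \<in> P" for x using that P_sub \<O>_L by auto
  have mem: "\<sigma> x \<in> \<sigma> ` P \<longleftrightarrow> x \<in> P" if "x \<in> L" for x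
    using that G_inj[OF assms(2)] PL by auto
  have surj: "\<exists>x\<in>\<O>. y = \<sigma> x" if "y \<in> \<O>" for y
    using that ginv_apply(2)[OF assms(2)] \<O>_L G_in_O[OF ginv_G[OF assms(2)]] by metis
  have "prime_set \<O> (\<sigma> ` P)"
  proof unfold_locales
    show "\<sigma> ` P \<subseteq> \<O>" using P_sub G_in_O[OF assms(2)] by auto
    show "1 \<notin> \<sigma> ` P" using mem[of 1] h.hom_1 one_P by simp
    show "0 \<in> \<sigma> ` P" using mem[of 0] h.hom_0 by simp
    show "x + y \<in> \<sigma> ` P" if xy: "x \<in> \<sigma> ` P" "y \<in> \<sigma> ` P" for x y
    proof -
      obtain u v where "u \<in> P" "v \<in> P" "x = \<sigma> u" "y = \<sigma> v" using xy by auto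
      thus ?thesis using h.hom_add[of u v] PL plus_P[of u v] by (auto intro!: image_eqI[of _ _ "u + v"])
    qed
    show "a * x \<in> \<sigma> ` P" if xa: "x \<in> \<sigma> ` P" "a \<in> \<O>" for x a
    proof -
      obtain u where u: "u \<in> P" "x = \<sigma> u" using xa by auto
      obtain b where b: "b \<in> \<O>" "a = \<sigma> b" using surj[OF xa(2)] by blast
      have "a * x = \<sigma> (b * u)" using u b h.hom_mult[of b u] PL \<O>_L by simp
      thus ?thesis using mult_P[OF u(1) b(1)] by blast
    qed
    show "x \<in> \<sigma> ` P \<or> y \<in> \<sigma> ` P" if xy: "x \<in> \<O>" "y \<in> \<O>" "x * y \<in> \<sigma> ` P" for x y
    proof -
      obtain u where u: "u \<in> \<O>" "x = \<sigma> u" using surj[OF xy(1)] by blast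
      obtain v where v: "v \<in> \<O>" "y = \<sigma> v" using surj[OF xy(2)] by blast
      have "\<sigma> (u * v) \<in> \<sigma> ` P" using xy(3) u v h.hom_mult[of u v] \<O>_L by simp
      hence "u * v \<in> P" using mem[OF L.mult_S[OF \<O>_L[OF u(1)] \<O>_L[OF v(1)]]] by blast
      thus ?thesis using prime_P[OF u(1) v(1)] u v by blast
    qed
  qed
  moreover have "of_nat p \<in> \<sigma> ` P"
    using mem[of "of_nat p"] h.hom_of_nat assms(1) primes_above_iff by auto
  ultimately show ?thesis using primes_above_iff by blast
qed

text \<open>A polynomial whose coefficients range over witnesses for all elements of the finite group
  reduces statements about one element at a time to statements about all of them at once.\<close>

lemma enum_poly:
  fixes x :: "(complex \<Rightarrow> complex) \<Rightarrow> complex"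
  assumes "\<And>\<sigma>. \<sigma> \<in> G \<Longrightarrow> x \<sigma> \<in> S" "0 \<in> S"
  obtains u where "u \<in> polys_over S" "\<And>\<sigma>. \<sigma> \<in> G \<Longrightarrow> \<exists>j. coeff u j = x \<sigma>"
proof -
  obtain e where e: "bij_betw e {..<card G} G"
    using ex_bij_betw_nat_finite[OF finite_gal] by (auto simp: atLeast0LessThan)
  define u where "u = (\<Sum>j<card G. monom (x (e j)) j)"
  have cf: "coeff u j = (if j < card G then x (e j) else 0)" for j
    by (simp add: u_def coeff_sum)
  have "e j \<in> G" if "j < card G" for j using e that by (auto simp: bij_betw_def)
  hence "u \<in> polys_over S" using assms by (auto simp: polys_over_def cf)
  moreover have "\<exists>j. coeff u j = x \<sigma>" if "\<sigma> \<in> G" for \<sigma>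
  proof -
    have "\<sigma> \<in> e ` {..<card G}" using e that by (simp add: bij_betw_def)
    then obtain j where "j < card G" "e j = \<sigma>" by auto
    thus ?thesis using cf[of j] by auto
  qed
  ultimately show thesis using that by blast
qed

lemma map_poly_compose:
  assumes "\<sigma> \<in> G" "\<tau> \<in> G" "u \<in> polys_over \<O>"
  shows "map_poly \<sigma> (map_poly \<tau> u) = map_poly (compose L \<sigma> \<tau>) u"
proof -
  interpret s: ring_hom_on \<O> \<sigma> by (rule ring_hom_on_O[OF assms(1)])
  interpret t: ring_hom_on \<O> \<tau> by (rule ring_hom_on_O[OF assms(2)])
  interpret st: ring_hom_on \<O> "compose L \<sigma> \<tau>" by (rule ring_hom_on_O[OF compose_G[OF assms(1,2)]])
  have "coeff u i \<in> L" for i using assms(3) \<O>_L by (auto simp: polys_over_def)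
  thus ?thesis by (intro poly_eqI) (simp add: s.coeff_map_h t.coeff_map_h st.coeff_map_h)
qed

lemma map_poly_G_in: "\<sigma> \<in> G \<Longrightarrow> u \<in> polys_over \<O> \<Longrightarrow> map_poly \<sigma> u \<in> polys_over \<O>"
  using ring_hom_on.coeff_map_h[OF ring_hom_on_O] by (auto simp: polys_over_def)

lemma map_poly_gid: "u \<in> polys_over \<O> \<Longrightarrow> map_poly gid u = u"
  using ring_hom_on.coeff_map_h[OF ring_hom_on_O[OF gid_G]] \<O>_L
  by (intro poly_eqI) (auto simp: polys_over_def)

text \<open>Applying \<open>\<tau>\<close> to the coefficients permutes the factors, so every
  coefficient is fixed by the group and hence a rational algebraic integer.\<close>

lemma norm_poly_int:
  assumes "u \<in> polys_over \<O>"
  shows "coeff (\<Prod>\<sigma>\<in>G. map_poly \<sigma> u) i \<in> \<int>"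
proof (rule fixed_imp_int)
  interpret pol: subring_set "polys_over \<O>" by (rule O.subring_polys_over)
  have "(\<Prod>\<sigma>\<in>G. map_poly \<sigma> u) \<in> polys_over \<O>" using map_poly_G_in[OF _ assms] by auto
  thus "coeff (\<Prod>\<sigma>\<in>G. map_poly \<sigma> u) i \<in> \<O>" by (simp add: polys_over_def)
  fix \<tau> assume t: "\<tau> \<in> G"
  interpret t: ring_hom_on \<O> \<tau> by (rule ring_hom_on_O[OF t])
  interpret tp: ring_hom_on "polys_over \<O>" "map_poly \<tau>" by (rule t.ring_hom_on_polys)
  have "map_poly \<tau> (\<Prod>\<sigma>\<in>G. map_poly \<sigma> u) = (\<Prod>\<sigma>\<in>G. map_poly \<tau> (map_poly \<sigma> u))"
    using map_poly_G_in[OF _ assms] by (rule tp.h_prod)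
  also have "\<dots> = (\<Prod>\<sigma>\<in>G. map_poly (compose L \<tau> \<sigma>) u)"
    using map_poly_compose[OF t _ assms] by (intro prod.cong) auto
  also have "\<dots> = (\<Prod>\<sigma>\<in>G. map_poly \<sigma> u)"
    using prod.reindex_bij_betw[OF bij_left_mult[OF t], of "\<lambda>\<sigma>. map_poly \<sigma> u"] .
  finally show "\<tau> (coeff (\<Prod>\<sigma>\<in>G. map_poly \<sigma> u) i) = coeff (\<Prod>\<sigma>\<in>G. map_poly \<sigma> u) i"
    by (metis t.coeff_map_h)
qed

text \<open>The outer variable is that of the characteristic polynomial of \<open>u\<close>, the
  inner one is the variable of \<open>u\<close>. As for the norm, the group only permutes the
  factors.\<close>

lemma char_poly_int:
  assumes "u \<in> polys_over \<O>"
  shows "coeff (coeff (\<Prod>\<sigma>\<in>G. [:- map_poly \<sigma> u, 1:]) i) j \<in> \<int>"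
    and "(\<Prod>\<sigma>\<in>G. [:- map_poly \<sigma> u, 1:]) \<in> polys_over (polys_over \<O>)"
proof -
  interpret pol: subring_set "polys_over \<O>" by (rule O.subring_polys_over)
  interpret pp: subring_set "polys_over (polys_over \<O>)" by (rule pol.subring_polys_over)
  let ?l = "\<lambda>\<sigma>. [:- map_poly \<sigma> u, 1:]"
  have lin: "?l \<sigma> \<in> polys_over (polys_over \<O>)" if "\<sigma> \<in> G" for \<sigma>
  proof -
    have "coeff (?l \<sigma>) k \<in> polys_over \<O>" for k
      using map_poly_G_in[OF that assms] pol.uminus_S by (auto simp: coeff_pCons split: nat.split)
    thus ?thesis by (simp add: polys_over_def)
  qed
  show F: "prod ?l G \<in> polys_over (polys_over \<O>)" using lin by (rule pp.prod_S)
  show "coeff (coeff (prod ?l G) i) j \<in> \<int>"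
  proof (rule fixed_imp_int)
    show "coeff (coeff (prod ?l G) i) j \<in> \<O>" using F by (simp add: polys_over_def)
    fix \<tau> assume t: "\<tau> \<in> G"
    interpret t: ring_hom_on \<O> \<tau> by (rule ring_hom_on_O[OF t])
    interpret tp: ring_hom_on "polys_over \<O>" "map_poly \<tau>" by (rule t.ring_hom_on_polys)
    interpret tpp: ring_hom_on "polys_over (polys_over \<O>)" "map_poly (map_poly \<tau>)" by (rule tp.ring_hom_on_polys)
    have "map_poly (map_poly \<tau>) (prod ?l G) = (\<Prod>\<sigma>\<in>G. map_poly (map_poly \<tau>) (?l \<sigma>))"
      using lin by (rule tpp.h_prod)
    also have "\<dots> = (\<Prod>\<sigma>\<in>G. ?l (compose L \<tau> \<sigma>))"
    proof (rule prod.cong)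
      fix \<sigma> assume s: "\<sigma> \<in> G"
      have "map_poly \<tau> (- map_poly \<sigma> u) = - map_poly (compose L \<tau> \<sigma>) u"
        using tp.h_uminus[OF map_poly_G_in[OF s assms]] map_poly_compose[OF t s assms] by simp
      thus "map_poly (map_poly \<tau>) (?l \<sigma>) = ?l (compose L \<tau> \<sigma>)"
        by (intro poly_eqI) (auto simp: tp.coeff_map_h coeff_pCons tp.h_1 tp.h_0 split: nat.split)
    qed simp
    also have "\<dots> = prod ?l G"
      using prod.reindex_bij_betw[OF bij_left_mult[OF t], of ?l] .
    finally have "coeff (coeff (map_poly (map_poly \<tau>) (prod ?l G)) i) j = coeff (coeff (prod ?l G) i) j"
      by simp
    thus "\<tau> (coeff (coeff (prod ?l G) i) j) = coeff (coeff (prod ?l G) i) j"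
      by (simp only: tp.coeff_map_h t.coeff_map_h)
  qed
qed

section \<open>Frobenius elements and transitivity on the primes above p\<close>

text \<open>If every \<open>\<sigma>\<close> fails at some \<open>x \<sigma>\<close>, let
  \<open>u\<close> have these elements among its coefficients. Its characteristic polynomial has
  integer coefficients, so it vanishes modulo \<open>P\<close> at \<open>frob_poly u\<close> because
  it vanishes at \<open>u\<close>. By Gauss's lemma \<open>frob_poly u\<close> is congruent to
  \<open>map_poly \<sigma> u\<close> for one \<open>\<sigma>\<close>, which therefore does not fail
  at \<open>x \<sigma>\<close>.\<close>

lemma frobenius_exists:
  assumes "prime p" "P \<in> primes_above L p"
  shows "\<exists>\<sigma>. frobenius_at L p P \<sigma>"
proof (rule ccontr)
  assume "\<not> ?thesis"
  hence "\<forall>\<sigma>\<in>G. \<exists>x\<in>\<O>. \<sigma> x - x ^ p \<notin> P" by (auto simp: frobenius_at_def)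
  then obtain x where x: "\<And>\<sigma>. \<sigma> \<in> G \<Longrightarrow> x \<sigma> \<in> \<O>" "\<And>\<sigma>. \<sigma> \<in> G \<Longrightarrow> \<sigma> (x \<sigma>) - x \<sigma> ^ p \<notin> P" by metis
  obtain u where u: "u \<in> polys_over \<O>" "\<And>\<sigma>. \<sigma> \<in> G \<Longrightarrow> \<exists>j. coeff u j = x \<sigma>"
    using enum_poly[of x \<O>] x by auto
  interpret P: prime_set_over \<O> P p by (rule primes_aboveD[OF assms])
  interpret pol: prime_set_over "polys_over \<O>" "polys_over P" p by (rule P.prime_over_polys)
  let ?F = "\<Prod>\<sigma>\<in>G. [:- map_poly \<sigma> u, 1:]"
  let ?v = "P.frob_poly u"
  have v: "?v \<in> polys_over \<O>" by (rule P.frob_poly_in[OF u(1)])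
  have eval: "poly ?F w = (\<Prod>\<sigma>\<in>G. w - map_poly \<sigma> u)" for w by (simp add: poly_prod)
  have Fu: "poly ?F u = 0"
    unfolding eval using finite_gal gid_G map_poly_gid[OF u(1)] by (auto intro!: prod_zero bexI[of _ gid])
  \<comment> \<open>Evaluation commutes with Frobenius modulo \<open>P\<close>, since by Fermat's
    theorem integer coefficients are fixed.\<close>
  have transfer: "poly H u \<in> polys_over \<O> \<and> P.frob_poly (poly H u) - poly H ?v \<in> polys_over P"
    if "\<forall>i. coeff H i \<in> polys_over \<O> \<and> (\<forall>j. coeff (coeff H i) j \<in> \<int>)" for H
    using that
  proof (induction H)
    case 0
    have "P.frob_poly 0 = 0" by (rule poly_eqI) (simp add: P.coeff_frob_poly power_0_left)
    thus ?case by simp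
  next
    case (pCons c H)
    have c: "c \<in> polys_over \<O>" "\<And>j. coeff c j \<in> \<int>" using pCons.prems spec[OF pCons.prems, of 0] by auto
    have "coeff H i \<in> polys_over \<O> \<and> (\<forall>j. coeff (coeff H i) j \<in> \<int>)" for i
      using spec[OF pCons.prems, of "Suc i"] by simp
    hence IH: "poly H u \<in> polys_over \<O>" "P.frob_poly (poly H u) - poly H ?v \<in> polys_over P"
      using pCons.IH by blast+
    have uH: "u * poly H u \<in> polys_over \<O>" using u(1) IH(1) by (rule pol.mult_S)
    have 1: "P.frob_poly (c + u * poly H u) - (P.frob_poly c + P.frob_poly (u * poly H u)) \<in> polys_over P"
      by (rule P.frob_poly_add[OF c(1) uH])
    have "coeff (P.frob_poly c - c) j \<in> P" for j
    proof -
      obtain k where "coeff c j = of_int k" using c(2)[of j] by (auto elim: Ints_cases)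
      thus ?thesis using P.fermat_P[of k] by (simp add: P.coeff_frob_poly)
    qed
    hence 2: "P.frob_poly c - c \<in> polys_over P" by (simp add: polys_over_def)
    have 3: "P.frob_poly (u * poly H u) - ?v * P.frob_poly (poly H u) \<in> polys_over P"
      by (rule P.frob_poly_mult[OF u(1) IH(1)])
    have 4: "?v * (P.frob_poly (poly H u) - poly H ?v) \<in> polys_over P"
      by (rule pol.mult_P[OF IH(2) v])
    have "P.frob_poly (c + u * poly H u) - (c + ?v * poly H ?v) =
       (P.frob_poly (c + u * poly H u) - (P.frob_poly c + P.frob_poly (u * poly H u))) +
       (P.frob_poly c - c) + (P.frob_poly (u * poly H u) - ?v * P.frob_poly (poly H u)) +
       ?v * (P.frob_poly (poly H u) - poly H ?v)"
      by (simp add: algebra_simps)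
    also have "\<dots> \<in> polys_over P" by (intro pol.plus_P 1 2 3 4)
    finally show ?case using c(1) uH by (simp add: pol.plus_S)
  qed
  have "P.frob_poly (poly ?F u) - poly ?F ?v \<in> polys_over P"
    using transfer[of ?F] char_poly_int[OF u(1)] unfolding polys_over_def by blast
  moreover have "P.frob_poly 0 = 0" by (rule poly_eqI) (simp add: P.coeff_frob_poly power_0_left)
  ultimately have "- poly ?F ?v \<in> polys_over P" by (simp only: Fu diff_0)
  hence "(\<Prod>\<sigma>\<in>G. ?v - map_poly \<sigma> u) \<in> polys_over P" by (simp only: pol.uminus_P_iff eval)
  then obtain \<sigma> where s: "\<sigma> \<in> G" "?v - map_poly \<sigma> u \<in> polys_over P"
    using pol.prod_in_P[OF finite_gal, of "\<lambda>\<sigma>. ?v - map_poly \<sigma> u"] v map_poly_G_in[OF _ u(1)] by auto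
  obtain j where j: "coeff u j = x \<sigma>" using u(2)[OF s(1)] by blast
  have "coeff (?v - map_poly \<sigma> u) j \<in> P" using s(2) by (simp add: polys_over_def)
  hence "x \<sigma> ^ p - \<sigma> (x \<sigma>) \<in> P"
    using ring_hom_on.coeff_map_h[OF ring_hom_on_O[OF s(1)], of u j] j by (simp add: P.coeff_frob_poly)
  thus False using x(2)[OF s(1)] P.sym_P by blast
qed

text \<open>Otherwise collect elements \<open>a \<sigma>\<close> of \<open>P\<close> with
  \<open>\<sigma> (a \<sigma>)\<close> outside \<open>Q\<close> as coefficients of \<open>u\<close>.
  The norm of \<open>u\<close> lies in \<open>polys_over P\<close> and has integer coefficients,
  which are thus divisible by \<open>p\<close> and lie in \<open>Q\<close>. By Gauss's lemma some
  factor \<open>map_poly \<sigma> u\<close> has all coefficients in \<open>Q\<close>.\<close>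

lemma primes_above_sub_conjugate:
  assumes "prime p" "P \<in> primes_above L p" "Q \<in> primes_above L p"
  shows "\<exists>\<sigma>\<in>G. \<sigma> ` P \<subseteq> Q"
proof (rule ccontr)
  assume "\<not> ?thesis"
  hence "\<forall>\<sigma>\<in>G. \<exists>a\<in>P. \<sigma> a \<notin> Q" by blast
  then obtain a where a: "\<And>\<sigma>. \<sigma> \<in> G \<Longrightarrow> a \<sigma> \<in> P" "\<And>\<sigma>. \<sigma> \<in> G \<Longrightarrow> \<sigma> (a \<sigma>) \<notin> Q" by metis
  interpret P: prime_set_over \<O> P p by (rule primes_aboveD[OF assms(1,2)])
  interpret Q: prime_set_over \<O> Q p by (rule primes_aboveD[OF assms(1,3)])
  interpret Pp: prime_set_over "polys_over \<O>" "polys_over P" p by (rule P.prime_over_polys)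
  interpret Qp: prime_set_over "polys_over \<O>" "polys_over Q" p by (rule Q.prime_over_polys)
  obtain u where u: "u \<in> polys_over P" "\<And>\<sigma>. \<sigma> \<in> G \<Longrightarrow> \<exists>j. coeff u j = a \<sigma>"
    using enum_poly[of a P] a by auto
  have uO: "u \<in> polys_over \<O>" using u(1) Pp.P_sub by blast
  let ?N = "\<Prod>\<sigma>\<in>G. map_poly \<sigma> u"
  have "?N = map_poly gid u * (\<Prod>\<sigma>\<in>G - {gid}. map_poly \<sigma> u)"
    by (rule prod.remove[OF finite_gal gid_G])
  also have "\<dots> \<in> polys_over P"
    unfolding map_poly_gid[OF uO] using map_poly_G_in[OF _ uO] by (intro Pp.mult_P'[OF u(1)] Pp.prod_S) auto
  finally have NP: "?N \<in> polys_over P" .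
  have "coeff ?N i \<in> Q" for i
  proof -
    obtain k where k: "coeff ?N i = of_int k" using norm_poly_int[OF uO, of i] by (auto elim: Ints_cases)
    moreover have "coeff ?N i \<in> P" using NP by (simp add: polys_over_def)
    ultimately have "of_int k \<in> P" by (simp only:)
    thus ?thesis unfolding k P.of_int_P_iff Q.of_int_P_iff .
  qed
  hence "?N \<in> polys_over Q" by (simp add: polys_over_def)
  then obtain \<sigma> where s: "\<sigma> \<in> G" "map_poly \<sigma> u \<in> polys_over Q"
    using Qp.prod_in_P[OF finite_gal, of "\<lambda>\<sigma>. map_poly \<sigma> u"] map_poly_G_in[OF _ uO] by auto
  obtain j where j: "coeff u j = a \<sigma>" using u(2)[OF s(1)] by blast
  have "coeff (map_poly \<sigma> u) j \<in> Q" using s(2) by (simp add: polys_over_def)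
  thus False using a(2)[OF s(1)] ring_hom_on.coeff_map_h[OF ring_hom_on_O[OF s(1)], of u j] j by simp
qed

text \<open>The inclusions obtained in both directions compose to an automorphism mapping
  \<open>P\<close> into itself, which by finite order maps it onto itself.\<close>

lemma primes_above_conjugate:
  assumes "prime p" "P \<in> primes_above L p" "Q \<in> primes_above L p"
  shows "\<exists>\<sigma>\<in>G. Q = \<sigma> ` P"
proof -
  obtain \<sigma> where s: "\<sigma> \<in> G" "\<sigma> ` P \<subseteq> Q" using primes_above_sub_conjugate[OF assms] by blast
  obtain \<tau> where t: "\<tau> \<in> G" "\<tau> ` Q \<subseteq> P" using primes_above_sub_conjugate[OF assms(1,3,2)] by blast
  interpret P: prime_set_over \<O> P p by (rule primes_aboveD[OF assms(1,2)])
  interpret Q: prime_set_over \<O> Q p by (rule primes_aboveD[OF assms(1,3)])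
  have PL: "P \<subseteq> L" "Q \<subseteq> L" using P.P_sub Q.P_sub \<O>_L by auto
  have im: "compose L \<tau> \<sigma> ` P = \<tau> ` \<sigma> ` P"
    unfolding image_image by (rule image_cong) (use PL in auto)
  hence "compose L \<tau> \<sigma> ` P \<subseteq> P" using s(2) t(2) by blast
  hence eq: "\<tau> ` \<sigma> ` P = P" using image_sub_imp_eq[OF compose_G[OF t(1) s(1)] PL(1)] im by simp
  have "Q \<subseteq> \<sigma> ` P"
  proof
    fix y assume y: "y \<in> Q"
    hence "\<tau> y \<in> \<tau> ` \<sigma> ` P" using t(2) eq by auto
    then obtain x where x: "x \<in> P" "\<tau> y = \<tau> (\<sigma> x)" by auto
    hence "y = \<sigma> x" using G_inj[OF t(1)] y PL G_in[OF s(1)] by blast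
    thus "y \<in> \<sigma> ` P" using x by blast
  qed
  thus ?thesis using s by blast
qed

lemma frobenius_conjugate:
  assumes "prime p" "P \<in> primes_above L p" "frobenius_at L p P \<sigma>" "\<tau> \<in> G"
  shows "frobenius_at L p (\<tau> ` P) (compose L \<tau> (compose L \<sigma> (ginv \<tau>)))"
proof -
  have s: "\<sigma> \<in> G" "\<And>x. x \<in> \<O> \<Longrightarrow> \<sigma> x - x ^ p \<in> P" using assms(3) by (auto simp: frobenius_at_def)
  interpret h: subfield_hom L \<tau> by (rule G_hom[OF assms(4)])
  let ?\<rho> = "compose L \<tau> (compose L \<sigma> (ginv \<tau>))"
  have "?\<rho> x - x ^ p \<in> \<tau> ` P" if x: "x \<in> \<O>" for x
  proof -
    define y where "y = ginv \<tau> x"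
    have y: "y \<in> \<O>" "\<tau> y = x" unfolding y_def
      using x G_in_O[OF ginv_G[OF assms(4)]] ginv_apply(2)[OF assms(4)] \<O>_L by auto
    have "?\<rho> x - x ^ p = \<tau> (\<sigma> y - y ^ p)"
      using x y \<O>_L G_in[OF s(1)] by (simp add: y_def[symmetric] h.hom_diff h.hom_power L.power_S)
    thus ?thesis using s(2)[OF y(1)] by blast
  qed
  thus ?thesis using s assms(4) by (simp add: frobenius_at_def compose_G ginv_G)
qed

end

section \<open>Splitting fields of monic integer polynomials\<close>

text \<open>\<open>f\<close> may be reducible or have multiple roots at this stage; that
  \<open>card R = degree f\<close> is derived later from a reduction modulo a prime or from
  irreducibility.\<close>

locale galois_roots = galois_field L for L +
  fixes R :: "complex set" and f :: "int poly"
  assumes monic_f: "lead_coeff f = 1"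
    and R_eq: "R = {a. poly (map_poly of_int f) a = 0}"
    and R_L: "R \<subseteq> L"
    and R_gen: "\<And>F. subfield_set F \<Longrightarrow> R \<subseteq> F \<Longrightarrow> L \<subseteq> F"
begin

lemma cpoly_f: "lead_coeff (map_poly of_int f :: complex poly) = 1" "degree (map_poly of_int f :: complex poly) = degree f"
  using monic_f by simp_all

lemma finite_R: "finite R"
  unfolding R_eq by (rule poly_roots_finite) (use cpoly_f(1) in auto)

lemma card_R_le: "card R \<le> degree f"
  using card_poly_roots_bound[of "map_poly of_int f :: complex poly"] cpoly_f unfolding R_eq by force

lemma R_algebraic_int: "r \<in> R \<Longrightarrow> algebraic_int r"
  unfolding algebraic_int_altdef_ipoly using monic_f R_eq by blast

lemma R_O: "r \<in> R \<Longrightarrow> r \<in> \<O>"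
  using R_algebraic_int R_L by (auto simp: ring_of_integers_def)

lemma G_R: "\<sigma> \<in> G \<Longrightarrow> r \<in> R \<Longrightarrow> \<sigma> r \<in> R"
proof -
  assume s: "\<sigma> \<in> G" and r: "r \<in> R"
  interpret h: subfield_hom L \<sigma> by (rule G_hom[OF s])
  have rL: "r \<in> L" using r R_L by blast
  have "qeval (rat_poly f) r = 0" using r by (simp add: qeval_rat_poly R_eq)
  hence "qeval (rat_poly f) (\<sigma> r) = 0" using h.hom_qeval[OF rL, of "rat_poly f"] h.hom_0 by simp
  thus ?thesis by (simp add: qeval_rat_poly R_eq)
qed

lemma fin_perm_R: "\<sigma> \<in> G \<Longrightarrow> fin_perm \<sigma> R"
proof
  assume s: "\<sigma> \<in> G"
  show "finite R" by (rule finite_R)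
  have "inj_on \<sigma> R" using G_inj[OF s] R_L by (auto simp: inj_on_def)
  thus "bij_betw \<sigma> R R" using finite_R G_R[OF s] by (simp add: bij_betw_def endo_inj_surj image_subsetI)
qed

text \<open>The elements on which two automorphisms agree form a subfield, and \<open>R\<close>
  generates \<open>L\<close>.\<close>

lemma G_eq_on_R:
  assumes "\<sigma> \<in> G" "\<tau> \<in> G" "\<And>r. r \<in> R \<Longrightarrow> \<sigma> r = \<tau> r"
  shows "\<sigma> = \<tau>"
proof -
  interpret s: subfield_hom L \<sigma> by (rule G_hom[OF assms(1)])
  interpret t: subfield_hom L \<tau> by (rule G_hom[OF assms(2)])
  have "subfield_set {x \<in> L. \<sigma> x = \<tau> x}"
    by unfold_locales
      (auto simp: s.hom_1 t.hom_1 s.hom_diff t.hom_diff s.hom_mult t.hom_mult s.hom_inverse t.hom_inverse)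
  hence "L \<subseteq> {x \<in> L. \<sigma> x = \<tau> x}" by (rule R_gen) (use assms(3) R_L in auto)
  thus ?thesis by (intro G_eqI[OF assms(1,2)]) auto
qed

text \<open>The elements \<open>x\<^sub>j, y\<^sub>j\<close> below satisfy \<open>\<Sum> x\<^sub>j \<sigma>(y\<^sub>j) = 0\<close> for \<open>\<sigma> \<noteq> 1\<close>, so they recover a multiple
  \<open>D z\<close> of an integer \<open>z\<close> from the traces of the \<open>y\<^sub>j z\<close>.\<close>

lemma separating_pairs:
  assumes "finite T" "\<And>\<tau>. \<tau> \<in> T \<Longrightarrow> u \<tau> \<in> \<O> \<and> v \<tau> \<in> \<O>"
  shows "\<exists>xs. set xs \<subseteq> \<O> \<times> \<O> \<and> (\<forall>\<sigma>\<in>G. (\<Sum>(x, y)\<leftarrow>xs. x * \<sigma> y) = (\<Prod>\<tau>\<in>T. u \<tau> - \<sigma> (v \<tau>)))"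
  using assms
proof (induction T rule: finite_induct)
  case empty
  show ?case
    by (intro exI[of _ "[(1, 1)]"]) (auto simp: subfield_hom.hom_1[OF G_hom])
next
  case (insert \<tau> T)
  then obtain xs where xs: "set xs \<subseteq> \<O> \<times> \<O>"
      "\<And>\<sigma>. \<sigma> \<in> G \<Longrightarrow> (\<Sum>(x, y)\<leftarrow>xs. x * \<sigma> y) = (\<Prod>\<tau>\<in>T. u \<tau> - \<sigma> (v \<tau>))" by auto
  have uv: "u \<tau> \<in> \<O>" "v \<tau> \<in> \<O>" using insert.prems by auto
  \<comment> \<open>The first half contributes the factor \<open>u \<tau>\<close>, the second half
    \<open>- \<sigma> (v \<tau>)\<close>, because \<open>\<sigma>\<close> is multiplicative on
    \<open>y * v \<tau>\<close>.\<close>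
  define ys where "ys = map (\<lambda>(x, y). (x * u \<tau>, y)) xs @ map (\<lambda>(x, y). (- x, y * v \<tau>)) xs"
  have "set ys \<subseteq> \<O> \<times> \<O>" using xs(1) uv by (auto simp: ys_def)
  moreover have "(\<Sum>(x, y)\<leftarrow>ys. x * \<sigma> y) = (\<Prod>\<tau>\<in>insert \<tau> T. u \<tau> - \<sigma> (v \<tau>))" if s: "\<sigma> \<in> G" for \<sigma>
  proof -
    interpret h: subfield_hom L \<sigma> by (rule G_hom[OF s])
    have "(\<Sum>(x, y)\<leftarrow>map (\<lambda>(x, y). (x * u \<tau>, y)) zs @ map (\<lambda>(x, y). (- x, y * v \<tau>)) zs. x * \<sigma> y)
        = (u \<tau> - \<sigma> (v \<tau>)) * (\<Sum>(x, y)\<leftarrow>zs. x * \<sigma> y)" if "set zs \<subseteq> \<O> \<times> \<O>" for zs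
      using that
    proof (induction zs)
      case (Cons z zs)
      obtain x y where z: "z = (x, y)" by (cases z)
      have "\<sigma> (y * v \<tau>) = \<sigma> y * \<sigma> (v \<tau>)" using Cons.prems uv z by (auto simp: h.hom_mult \<O>_L)
      thus ?case using Cons z by (simp add: algebra_simps)
    qed simp
    thus ?thesis using xs s insert.hyps by (simp add: ys_def)
  qed
  ultimately show ?case by blast
qed

section \<open>Distinct roots modulo a prime imply unramifiedness\<close>

text \<open>There are \<open>D\<close> and \<open>c\<close> outside \<open>P\<close> such that
  \<open>D * c * P\<close> is contained in the multiples of \<open>p\<close>: \<open>D * z\<close>
  is a combination of traces of multiples of \<open>z\<close>, and for \<open>z\<close> in
  \<open>c * P\<close> these traces are integers in \<open>P\<close>. If \<open>p\<close> were in
  the square of \<open>P\<close>, then \<open>(D * c) ^ 2 * p\<close> would be a multiple of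
  \<open>p ^ 2\<close>, so \<open>(D * c) ^ 2\<close> would be a multiple of \<open>p\<close> and
  lie in \<open>P\<close>.\<close>

lemma unramified:
  assumes "prime p" "P \<in> primes_above L p"
    and sep: "\<And>r s. r \<in> R \<Longrightarrow> s \<in> R \<Longrightarrow> r - s \<in> P \<Longrightarrow> r = s"
  shows "of_nat p \<notin> ideal_prod (ring_on \<O>) P P"
proof
  assume pP2: "of_nat p \<in> ideal_prod (ring_on \<O>) P P"
  interpret P: prime_set_over \<O> P p by (rule primes_aboveD[OF assms(1,2)])
  have PL: "P \<subseteq> L" using P.P_sub \<O>_L by auto
  define H where "H = G - {gid}"
  have finH: "finite H" using finite_gal by (simp add: H_def)
  have "\<exists>r\<in>R. \<tau> r \<noteq> r" if "\<tau> \<in> H" for \<tau>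
  proof (rule ccontr)
    assume "\<not> ?thesis"
    hence "\<tau> = gid" using that R_L by (intro G_eq_on_R) (auto simp: H_def)
    thus False using that by (simp add: H_def)
  qed
  then obtain t where t: "\<And>\<tau>. \<tau> \<in> H \<Longrightarrow> t \<tau> \<in> R" "\<And>\<tau>. \<tau> \<in> H \<Longrightarrow> \<tau> (t \<tau>) \<noteq> t \<tau>" by metis
  obtain xs where xs: "set xs \<subseteq> \<O> \<times> \<O>"
      "\<And>\<sigma>. \<sigma> \<in> G \<Longrightarrow> (\<Sum>(x, y)\<leftarrow>xs. x * \<sigma> y) = (\<Prod>\<tau>\<in>H. \<tau> (t \<tau>) - \<sigma> (t \<tau>))"
    using separating_pairs[OF finH, of "\<lambda>\<tau>. \<tau> (t \<tau>)" t] t(1) R_O G_in_O by (auto simp: H_def)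
  \<comment> \<open>The value of the separating sum at the identity. Each factor is a difference of
    distinct roots and is therefore outside \<open>P\<close>.\<close>
  define D where "D = (\<Prod>\<tau>\<in>H. \<tau> (t \<tau>) - t \<tau>)"
  have "\<tau> (t \<tau>) - t \<tau> \<in> \<O>" if "\<tau> \<in> H" for \<tau>
    using O.diff_S[OF G_in_O[of \<tau>, OF _ R_O[OF t(1)[OF that]]] R_O[OF t(1)[OF that]]] that by (auto simp: H_def)
  hence D_O: "D \<in> \<O>" unfolding D_def by (rule O.prod_S)
  have D_P: "D \<notin> P"
  proof
    assume "D \<in> P"
    then obtain \<tau> where \<tau>: "\<tau> \<in> H" "\<tau> (t \<tau>) - t \<tau> \<in> P"
      using P.prod_in_P[OF finH, of "\<lambda>\<tau>. \<tau> (t \<tau>) - t \<tau>"] t(1) R_O G_in_O unfolding D_def H_def by blast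
    thus False using sep[of "\<tau> (t \<tau>)" "t \<tau>"] t G_R by (auto simp: H_def)
  qed
  have xs_id: "(\<Sum>(x, y)\<leftarrow>xs. x * \<sigma> y) = (if \<sigma> = gid then D else 0)" if s: "\<sigma> \<in> G" for \<sigma>
  proof (cases "\<sigma> = gid")
    case True
    have "gid (t \<tau>) = t \<tau>" if "\<tau> \<in> H" for \<tau> using t(1)[OF that] R_L by auto
    thus ?thesis using xs(2)[OF s] True by (simp add: D_def)
  next
    case False
    hence "\<sigma> \<in> H" using s by (simp add: H_def)
    thus ?thesis using xs(2)[OF s] False finH by (auto intro!: prod_zero bexI[of _ \<sigma>])
  qed
  have trace: "(\<Sum>(x, y)\<leftarrow>xs. x * (\<Sum>\<sigma>\<in>G. \<sigma> (y * z))) = D * z" if z: "z \<in> \<O>" for z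
  proof -
    have "(\<Sum>(x, y)\<leftarrow>zs. x * (\<Sum>\<sigma>\<in>G. \<sigma> (y * z))) = (\<Sum>\<sigma>\<in>G. (\<Sum>(x, y)\<leftarrow>zs. x * \<sigma> y) * \<sigma> z)"
      if "set zs \<subseteq> \<O> \<times> \<O>" for zs
      using that
    proof (induction zs)
      case (Cons w zs)
      obtain x y where w: "w = (x, y)" by (cases w)
      have "\<sigma> (y * z) = \<sigma> y * \<sigma> z" if "\<sigma> \<in> G" for \<sigma>
        using subfield_hom.hom_mult[OF G_hom[OF that], of y z] Cons.prems w z \<O>_L by auto
      hence "x * (\<Sum>\<sigma>\<in>G. \<sigma> (y * z)) = (\<Sum>\<sigma>\<in>G. x * \<sigma> y * \<sigma> z)" by (simp add: sum_distrib_left mult.assoc)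
      thus ?case using Cons w by (simp add: sum.distrib distrib_right)
    qed simp
    from this[OF xs(1)] have "(\<Sum>(x, y)\<leftarrow>xs. x * (\<Sum>\<sigma>\<in>G. \<sigma> (y * z))) =
        (\<Sum>\<sigma>\<in>G. (if \<sigma> = gid then D else 0) * \<sigma> z)" using xs_id by simp
    also have "\<dots> = (\<Sum>\<sigma>\<in>G. if \<sigma> = gid then D * gid z else 0)" by (intro sum.cong) auto
    also have "\<dots> = D * z" using finite_gal z \<O>_L by simp
    finally show ?thesis .
  qed
  \<comment> \<open>For an automorphism \<open>\<sigma>\<close> that does not preserve
    \<open>P\<close>, its inverse does not either, which yields \<open>b \<sigma>\<close> outside
    \<open>P\<close> with \<open>\<sigma> (b \<sigma>)\<close> in \<open>P\<close>. The product
    \<open>c\<close> of these elements makes every automorphism map \<open>c * P\<close> into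
    \<open>P\<close>.\<close>
  define B where "B = {\<sigma> \<in> G. \<not> \<sigma> ` P \<subseteq> P}"
  have "\<exists>b. b \<in> \<O> \<and> b \<notin> P \<and> \<sigma> b \<in> P" if s: "\<sigma> \<in> B" for \<sigma>
  proof -
    have sG: "\<sigma> \<in> G" "\<not> \<sigma> ` P \<subseteq> P" using s by (auto simp: B_def)
    have "\<not> ginv \<sigma> ` P \<subseteq> P"
    proof
      assume "ginv \<sigma> ` P \<subseteq> P"
      hence eq: "ginv \<sigma> ` P = P" by (rule image_sub_imp_eq[OF ginv_G[OF sG(1)] PL])
      have "\<sigma> x \<in> P" if x: "x \<in> P" for x
      proof -
        have "x \<in> ginv \<sigma> ` P" using x eq by simp
        then obtain y where y: "y \<in> P" "x = ginv \<sigma> y" by blast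
        thus ?thesis using ginv_apply(2)[OF sG(1), of y] PL by auto
      qed
      thus False using sG(2) by blast
    qed
    then obtain c where c: "c \<in> P" "ginv \<sigma> c \<notin> P" by blast
    have "c \<in> \<O>" using c(1) P.P_sub by blast
    thus ?thesis
      using c ginv_apply(2)[OF sG(1), of c] \<O>_L G_in_O[OF ginv_G[OF sG(1)]]
      by (intro exI[of _ "ginv \<sigma> c"]) auto
  qed
  then obtain b where b: "\<And>\<sigma>. \<sigma> \<in> B \<Longrightarrow> b \<sigma> \<in> \<O>" "\<And>\<sigma>. \<sigma> \<in> B \<Longrightarrow> b \<sigma> \<notin> P" "\<And>\<sigma>. \<sigma> \<in> B \<Longrightarrow> \<sigma> (b \<sigma>) \<in> P"
    by metis
  have finB: "finite B" using finite_gal by (simp add: B_def)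
  define c where "c = (\<Prod>\<sigma>\<in>B. b \<sigma>)"
  have c_O: "c \<in> \<O>" unfolding c_def using b(1) by auto
  have c_P: "c \<notin> P" using P.prod_in_P[OF finB, of b] b(1,2) unfolding c_def by blast
  have all_P: "\<sigma> (c * a) \<in> P" if s: "\<sigma> \<in> G" and a: "a \<in> P" for \<sigma> a
  proof -
    interpret h: subfield_hom L \<sigma> by (rule G_hom[OF s])
    have a_O: "a \<in> \<O>" using a P.P_sub by blast
    have eq: "\<sigma> (c * a) = \<sigma> c * \<sigma> a" using h.hom_mult[of c a] c_O a_O \<O>_L by simp
    show ?thesis
    proof (cases "\<sigma> \<in> B")
      case True
      have "c = b \<sigma> * (\<Prod>\<tau>\<in>B - {\<sigma>}. b \<tau>)" unfolding c_def by (rule prod.remove[OF finB True])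
      moreover have rest: "(\<Prod>\<tau>\<in>B - {\<sigma>}. b \<tau>) \<in> \<O>" using b(1) by auto
      ultimately have "\<sigma> c = \<sigma> (b \<sigma>) * \<sigma> (\<Prod>\<tau>\<in>B - {\<sigma>}. b \<tau>)"
        using h.hom_mult[of "b \<sigma>"] b(1)[OF True] \<O>_L by simp
      hence "\<sigma> c \<in> P" using P.mult_P'[OF b(3)[OF True] G_in_O[OF s rest]] by simp
      thus ?thesis unfolding eq using P.mult_P' G_in_O[OF s a_O] by blast
    next
      case False
      hence "\<sigma> a \<in> P" using s a by (auto simp: B_def)
      thus ?thesis unfolding eq using P.mult_P G_in_O[OF s c_O] by blast
    qed
  qed
  have Dc: "\<exists>w\<in>\<O>. (D * c) * a = of_nat p * w" if a: "a \<in> P" for a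
  proof -
    have a_O: "a \<in> \<O>" using a P.P_sub by blast
    have ca: "c * a \<in> \<O>" using c_O a_O by auto
    have tr: "\<exists>k. (\<Sum>\<sigma>\<in>G. \<sigma> (y * (c * a))) = of_nat p * of_int k" if y: "y \<in> \<O>" for y
    proof -
      let ?T = "\<Sum>\<sigma>\<in>G. \<sigma> (y * (c * a))"
      have yz: "y * (c * a) \<in> \<O>" using y ca by auto
      have "?T \<in> P"
      proof (rule P.sum_P)
        fix \<sigma> assume s: "\<sigma> \<in> G"
        have "\<sigma> (y * (c * a)) = \<sigma> y * \<sigma> (c * a)"
          using subfield_hom.hom_mult[OF G_hom[OF s]] y ca \<O>_L by simp
        thus "\<sigma> (y * (c * a)) \<in> P" using P.mult_P[OF all_P[OF s a] G_in_O[OF s y]] by simp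
      qed
      have "?T \<in> \<int>"
      proof (rule fixed_imp_int)
        show "?T \<in> \<O>" using yz G_in_O by auto
        fix \<tau> assume t: "\<tau> \<in> G"
        have "\<tau> ?T = (\<Sum>\<sigma>\<in>G. \<tau> (\<sigma> (y * (c * a))))"
          using yz G_in \<O>_L by (intro subfield_hom.hom_sum[OF G_hom[OF t]]) auto
        also have "\<dots> = (\<Sum>\<sigma>\<in>G. compose L \<tau> \<sigma> (y * (c * a)))" using yz \<O>_L by simp
        also have "\<dots> = ?T" by (rule sum.reindex_bij_betw[OF bij_left_mult[OF t], of "\<lambda>\<sigma>. \<sigma> (y * (c * a))"])
        finally show "\<tau> ?T = ?T" .
      qed
      then obtain k where k: "?T = of_int k" by (auto elim: Ints_cases)
      hence "int p dvd k" using \<open>?T \<in> P\<close> P.of_int_P_iff by simp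
      then obtain l where "k = int p * l" by auto
      thus ?thesis using k by (intro exI[of _ l]) simp
    qed
    have "\<exists>w\<in>\<O>. (\<Sum>(x, y)\<leftarrow>zs. x * (\<Sum>\<sigma>\<in>G. \<sigma> (y * (c * a)))) = of_nat p * w"
      if "set zs \<subseteq> \<O> \<times> \<O>" for zs
      using that
    proof (induction zs)
      case Nil
      show ?case by (auto intro!: bexI[of _ 0])
    next
      case (Cons z zs)
      obtain x y where z: "z = (x, y)" by (cases z)
      have xy: "x \<in> \<O>" "y \<in> \<O>" using Cons.prems z by auto
      obtain w where w: "w \<in> \<O>" "(\<Sum>(x, y)\<leftarrow>zs. x * (\<Sum>\<sigma>\<in>G. \<sigma> (y * (c * a)))) = of_nat p * w"
        using Cons by auto
      obtain k where "(\<Sum>\<sigma>\<in>G. \<sigma> (y * (c * a))) = of_nat p * of_int k" using tr[OF xy(2)] by blast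
      hence "(\<Sum>(x, y)\<leftarrow>z # zs. x * (\<Sum>\<sigma>\<in>G. \<sigma> (y * (c * a)))) = of_nat p * (x * of_int k + w)"
        using w z by (simp add: algebra_simps)
      moreover have "x * of_int k + w \<in> \<O>" using w xy by auto
      ultimately show ?case by blast
    qed
    from this[OF xs(1)] show ?thesis using trace[OF ca] by (simp add: mult.assoc)
  qed
  define d where "d = D * c"
  have d_O: "d \<in> \<O>" and d_P: "d \<notin> P" unfolding d_def using D_O c_O D_P c_P P.prime_P by auto
  have "\<exists>w\<in>\<O>. d ^ 2 * x = of_nat p ^ 2 * w" if "x \<in> ideal_prod (ring_on \<O>) P P" for x
    using that
  proof (induction rule: ideal_prod.induct)
    case (prod i j)
    then obtain w w' where "w \<in> \<O>" "d * i = of_nat p * w" "w' \<in> \<O>" "d * j = of_nat p * w'"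
      using Dc unfolding d_def by metis
    hence "d ^ 2 * (i * j) = of_nat p ^ 2 * (w * w')" "w * w' \<in> \<O>"
      by (auto simp: power2_eq_square) (metis mult.assoc mult.left_commute)
    thus ?case by auto
  next
    case (sum s1 s2)
    then obtain w w' where "w \<in> \<O>" "d ^ 2 * s1 = of_nat p ^ 2 * w" "w' \<in> \<O>" "d ^ 2 * s2 = of_nat p ^ 2 * w'"
      by blast
    hence "d ^ 2 * (s1 + s2) = of_nat p ^ 2 * (w + w')" "w + w' \<in> \<O>" by (auto simp: distrib_left)
    thus ?case by auto
  qed
  from this[OF pP2] obtain w where w: "w \<in> \<O>" "d ^ 2 * of_nat p = of_nat p ^ 2 * w" by blast
  have "d ^ 2 = of_nat p * w" using w(2) by (simp add: power2_eq_square)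
  hence "d ^ 2 \<in> P" using P.mult_P'[OF P.p_P w(1)] by simp
  thus False using P.power_in_P[OF d_O] d_P by blast
qed

lemma ideal_pow_Suc:
  "P [^]\<^bsub>ideals_set A\<^esub> Suc k = ideal_prod A (P [^]\<^bsub>ideals_set A\<^esub> k) P"
  by (simp add: nat_pow_def ideals_set_def)

text \<open>The zeroth ideal power is all of \<open>\<O>\<close>, so the first contains
  \<open>p\<close>. All powers from the second on lie in \<open>ideal_prod\<close> of
  \<open>P\<close> with itself, which omits \<open>p\<close>, so the greatest exponent exists and is
  \<open>1\<close>.\<close>

lemma unramified_at_L:
  assumes "prime p"
    and sep: "\<And>P r s. P \<in> primes_above L p \<Longrightarrow> r \<in> R \<Longrightarrow> s \<in> R \<Longrightarrow> r - s \<in> P \<Longrightarrow> r = s"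
  shows "unramified_at L p"
  unfolding unramified_at_def
proof
  fix P assume P: "P \<in> primes_above L p"
  interpret P: prime_set_over \<O> P p by (rule primes_aboveD[OF assms(1) P])
  let ?A = "ring_on \<O>"
  have pow0: "P [^]\<^bsub>ideals_set ?A\<^esub> (0::nat) = \<O>" by (simp add: nat_pow_def ideals_set_def)
  have powO: "P [^]\<^bsub>ideals_set ?A\<^esub> k \<subseteq> \<O>" for k :: nat
  proof (induction k)
    case (Suc k)
    show ?case
    proof
      fix x assume "x \<in> P [^]\<^bsub>ideals_set ?A\<^esub> Suc k"
      hence "x \<in> ideal_prod ?A (P [^]\<^bsub>ideals_set ?A\<^esub> k) P" by (simp only: ideal_pow_Suc)
      thus "x \<in> \<O>" by (induction rule: ideal_prod.induct) (use Suc P.P_sub in auto)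
    qed
  next
    case 0
    show ?case unfolding pow0 by simp
  qed
  have powP: "P [^]\<^bsub>ideals_set ?A\<^esub> Suc k \<subseteq> P" for k :: nat
  proof
    fix x assume "x \<in> P [^]\<^bsub>ideals_set ?A\<^esub> Suc k"
    hence "x \<in> ideal_prod ?A (P [^]\<^bsub>ideals_set ?A\<^esub> k) P" by (simp only: ideal_pow_Suc)
    thus "x \<in> P"
    proof (induction rule: ideal_prod.induct)
      case (prod i j)
      thus ?case using powO[of k] P.mult_P[of j i] by auto
    qed (auto intro: P.plus_P)
  qed
  have pow2: "P [^]\<^bsub>ideals_set ?A\<^esub> Suc (Suc k) \<subseteq> ideal_prod ?A P P" for k :: nat
  proof
    fix x assume "x \<in> P [^]\<^bsub>ideals_set ?A\<^esub> Suc (Suc k)"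
    hence "x \<in> ideal_prod ?A (P [^]\<^bsub>ideals_set ?A\<^esub> Suc k) P" by (simp only: ideal_pow_Suc)
    thus "x \<in> ideal_prod ?A P P"
    proof (induction rule: ideal_prod.induct)
      case (prod i j)
      thus ?case using powP[of k] ideal_prod.prod[of i P j P ?A] by auto
    next
      case (sum s1 s2)
      thus ?case using ideal_prod.sum[of s1 ?A P P s2] by auto
    qed
  qed
  show "ramification_index L p P = 1"
    unfolding ramification_index_def
  proof (rule Greatest_equality)
    have "1 * of_nat p \<in> ideal_prod ?A \<O> P"
      using ideal_prod.prod[of 1 \<O> "of_nat p" P ?A] P.p_P by simp
    thus "of_nat p \<in> P [^]\<^bsub>ideals_set ?A\<^esub> (1::nat)" using ideal_pow_Suc[where P = P and A = ?A and k = 0] pow0 by simp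
    fix e :: nat assume e: "of_nat p \<in> P [^]\<^bsub>ideals_set ?A\<^esub> e"
    show "e \<le> 1"
    proof (rule ccontr)
      assume "\<not> e \<le> 1"
      then obtain k where "e = Suc (Suc k)" by (metis One_nat_def Suc_le_eq not0_implies_Suc not_less_eq_eq zero_le)
      hence "of_nat p \<in> ideal_prod ?A P P" using e pow2 by blast
      thus False using unramified[OF assms(1) P] sep[OF P] by blast
    qed
  qed
qed

lemma prime_restrict_above:
  assumes "prime_over_alg_ints M p"
  shows "M \<inter> L \<in> primes_above L p"
proof -
  have "prime_set_over {x :: complex. algebraic_int x} M p" using assms by (simp add: prime_over_alg_ints_def)
  from prime_over_restrict[OF this subfield_L] show ?thesis
    using primes_above_iff by (simp add: prime_set_over_def prime_set_over_axioms_def)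
qed

text \<open>Modulo \<open>M\<close> the polynomial \<open>f\<close> has the roots \<open>S\<close>,
  so every root of \<open>f\<close> is congruent to an element of \<open>S\<close> and conversely.
  As \<open>card S = degree f\<close>, the resulting surjection from \<open>R\<close> onto
  \<open>S\<close> must be a bijection.\<close>

lemma cycle_type_from_stable_set:
  assumes "prime_over_alg_ints M p" "m > 0" "S \<subseteq> teich p m" "fin_perm (frob p) S" "degree f = card S"
    and cong: "\<And>i. of_int (coeff f i) - coeff (\<Prod>s\<in>S. [:- s, 1:]) i \<in> M"
  shows "card R = degree f" "\<And>r s. r \<in> R \<Longrightarrow> s \<in> R \<Longrightarrow> r - s \<in> M \<Longrightarrow> r = s"
    and "\<And>\<sigma>. frobenius_at L p (M \<inter> L) \<sigma> \<Longrightarrow> cycle_type \<sigma> R = cycle_type (frob p) S"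
proof -
  interpret M: prime_over_alg_ints M p by fact
  interpret S: fin_perm "frob p" S by fact
  let ?A = "{x :: complex. algebraic_int x}"
  let ?g = "\<Prod>s\<in>S. [:- s, 1:]"
  let ?f = "map_poly of_int f :: complex poly"
  have S_alg: "algebraic_int s" if "s \<in> S" for s
    using that assms(3) teich_algebraic_int[OF M.p_gt_1 assms(2)] by blast
  have deg_g: "degree ?g = card S" by (subst degree_prod_eq_sum_degree) auto
  have fg: "poly ?f x - poly ?g x \<in> M" if x: "algebraic_int x" for x
  proof -
    have "poly ?f x = (\<Sum>i\<le>card S. of_int (coeff f i) * x ^ i)"
      by (subst poly_altdef) (simp add: assms(5))
    moreover have "poly ?g x = (\<Sum>i\<le>card S. coeff ?g i * x ^ i)" by (subst poly_altdef) (simp add: deg_g)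
    ultimately have "poly ?f x - poly ?g x = (\<Sum>i\<le>card S. (of_int (coeff f i) - coeff ?g i) * x ^ i)"
      by (simp add: sum_subtractf left_diff_distrib)
    also have "\<dots> \<in> M" using cong algebraic_int_power_complex[OF x] by (intro M.sum_P M.mult_P') auto
    finally show ?thesis .
  qed
  have "\<exists>s\<in>S. r - s \<in> M" if r: "r \<in> R" for r
  proof -
    have "poly ?f r = 0" using r R_eq by simp
    hence "- poly ?g r \<in> M" using fg[OF R_algebraic_int[OF r]] by simp
    hence "poly ?g r \<in> M" by (simp only: M.uminus_P_iff)
    hence "(\<Prod>s\<in>S. r - s) \<in> M" by (simp add: poly_prod)
    moreover have "r - s \<in> ?A" if "s \<in> S" for s
      using M.diff_S[of r s] R_algebraic_int[OF r] S_alg[OF that] by simp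
    ultimately show ?thesis using M.prod_in_P[OF S.finite_A, of "\<lambda>s. r - s"] by blast
  qed
  then obtain h where h: "\<And>r. r \<in> R \<Longrightarrow> h r \<in> S" "\<And>r. r \<in> R \<Longrightarrow> r - h r \<in> M" by metis
  have onto: "\<exists>r\<in>R. s = h r" if s: "s \<in> S" for s
  proof -
    have "poly ?g s = 0" using s S.finite_A by (auto simp: poly_prod intro!: prod_zero bexI[of _ s])
    hence "poly ?f s \<in> M" using fg[OF S_alg[OF s]] by simp
    \<comment> \<open>The roots of \<open>f\<close> are not yet known to be simple, so
      multiplicities enter here; primality of \<open>M\<close> removes them again.\<close>
    moreover have "?f = (\<Prod>z | poly ?f z = 0. [:- z, 1:] ^ order z ?f)"
      using complex_poly_decompose[of ?f] cpoly_f(1) by simp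
    ultimately have "poly (\<Prod>z | poly ?f z = 0. [:- z, 1:] ^ order z ?f) s \<in> M" by simp
    hence "(\<Prod>z\<in>R. (s - z) ^ order z ?f) \<in> M" by (simp add: poly_prod R_eq)
    moreover have sz: "s - z \<in> ?A" if "z \<in> R" for z
      using M.diff_S[of s z] R_algebraic_int[OF that] S_alg[OF s] by simp
    hence "(s - z) ^ order z ?f \<in> ?A" if "z \<in> R" for z using M.power_S[OF sz[OF that]] by blast
    ultimately obtain z where z: "z \<in> R" "(s - z) ^ order z ?f \<in> M"
      using M.prod_in_P[OF finite_R, of "\<lambda>z. (s - z) ^ order z ?f"] by blast
    hence "s - z \<in> M" using M.power_in_P[OF sz[OF z(1)]] by blast
    hence "s - h z \<in> M" using M.trans_P[OF _ h(2)[OF z(1)]] by blast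
    hence "s = h z" using M.teich_inj[OF assms(2)] s h(1)[OF z(1)] assms(3) by blast
    thus ?thesis using z by blast
  qed
  have img: "h ` R = S" using h(1) onto by blast
  have "card S \<le> card R" using img finite_R card_image_le by metis
  thus cR: "card R = degree f" using card_R_le assms(5) by simp
  have inj: "inj_on h R" using img finite_R cR assms(5) by (metis eq_card_imp_inj_on)
  show sep: "r = s" if rs: "r \<in> R" "s \<in> R" "r - s \<in> M" for r s
  proof -
    have "h r - r \<in> M" by (rule M.sym_P[OF h(2)[OF rs(1)]])
    hence "h r - s \<in> M" using M.trans_P rs(3) by blast
    hence "h r - h s \<in> M" using M.trans_P h(2)[OF rs(2)] by blast
    hence "h r = h s" using M.teich_inj[OF assms(2)] h(1) rs assms(3) by blast
    thus ?thesis using inj rs by (simp add: inj_on_def)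
  qed
  show "cycle_type \<sigma> R = cycle_type (frob p) S" if fr: "frobenius_at L p (M \<inter> L) \<sigma>" for \<sigma>
  proof -
    have s: "\<sigma> \<in> G" "\<And>x. x \<in> \<O> \<Longrightarrow> \<sigma> x - x ^ p \<in> M" using fr by (auto simp: frobenius_at_def)
    \<comment> \<open>Both sides are congruent to \<open>r ^ p\<close> modulo \<open>M\<close> and
      lie in \<open>teich p m\<close>, where congruence implies equality.\<close>
    have "h (\<sigma> r) = h r ^ p" if r: "r \<in> R" for r
    proof -
      have "h (\<sigma> r) - \<sigma> r \<in> M" by (rule M.sym_P[OF h(2)[OF G_R[OF s(1) r]]])
      moreover have "\<sigma> r - r ^ p \<in> M" by (rule s(2)[OF R_O[OF r]])
      moreover have "r ^ p - h r ^ p \<in> M"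
        using h(2)[OF r] R_algebraic_int[OF r] S_alg[OF h(1)[OF r]] by (intro M.cong_power_P) auto
      ultimately have "h (\<sigma> r) - h r ^ p \<in> M" using M.trans_P by blast
      moreover have "h (\<sigma> r) \<in> teich p m" "h r ^ p \<in> teich p m"
        using h(1)[OF G_R[OF s(1) r]] S.f_in[OF h(1)[OF r]] assms(3) by auto
      ultimately show ?thesis using M.teich_inj[OF assms(2)] by blast
    qed
    thus ?thesis using cycle_type_equivariant[of \<sigma> R h "frob p"] fin_perm_R[OF s(1)] inj img by simp
  qed
qed

text \<open>If \<open>k\<close> is the size of the orbit of \<open>r\<close>, then
  \<open>r = (\<sigma> ^^ k) r\<close> is congruent to \<open>r ^ (p ^ k)\<close>, so
  \<open>r\<close> has a representative in \<open>teich p k\<close>. Taking representatives is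
  equivariant, and injective by the separation of the roots.\<close>

lemma count_cycle_type_frobenius:
  assumes "prime_over_alg_ints M p" "frobenius_at L p (M \<inter> L) \<sigma>"
    and sep: "\<And>r s. r \<in> R \<Longrightarrow> s \<in> R \<Longrightarrow> r - s \<in> M \<Longrightarrow> r = s" and "i > 0"
  shows "count (cycle_type \<sigma> R) i \<le> card (frob_orbits p i)"
proof -
  interpret M: prime_over_alg_ints M p by fact
  have s: "\<sigma> \<in> G" "\<And>x. x \<in> \<O> \<Longrightarrow> \<sigma> x - x ^ p \<in> M" using assms(2) by (auto simp: frobenius_at_def)
  interpret R: fin_perm \<sigma> R by (rule fin_perm_R[OF s(1)])
  have pow: "(\<sigma> ^^ k) r - r ^ (p ^ k) \<in> M" if r: "r \<in> R" for r k
  proof (induction k)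
    case (Suc k)
    have O: "(\<sigma> ^^ k) r \<in> \<O>" using R.funpow_in[OF r] R_O by blast
    have "\<sigma> ((\<sigma> ^^ k) r) - ((\<sigma> ^^ k) r) ^ p \<in> M" by (rule s(2)[OF O])
    moreover have "((\<sigma> ^^ k) r) ^ p - (r ^ (p ^ k)) ^ p \<in> M"
      using Suc O algebraic_int_power_complex[OF R_algebraic_int[OF r]]
      by (intro M.cong_power_P) (auto simp: ring_of_integers_def)
    ultimately have "\<sigma> ((\<sigma> ^^ k) r) - (r ^ (p ^ k)) ^ p \<in> M" by (rule M.trans_P)
    thus ?case by (simp add: power_mult[symmetric] mult.commute)
  qed simp
  let ?k = "\<lambda>r. card (orbit \<sigma> r)"
  have "\<exists>t\<in>teich p (?k r). r - t \<in> M" if r: "r \<in> R" for r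
  proof (rule M.teich_complete)
    show "?k r > 0" by (rule R.card_orbit_pos[OF r])
    show "algebraic_int r" by (rule R_algebraic_int[OF r])
    have "(\<sigma> ^^ ?k r) r = r" using R.funpow_fix_iff[OF r] by simp
    thus "r ^ (p ^ ?k r) - r \<in> M" using M.sym_P[OF pow[OF r, of "?k r"]] by simp
  qed
  then obtain h where h: "\<And>r. r \<in> R \<Longrightarrow> h r \<in> teich p (?k r)" "\<And>r. r \<in> R \<Longrightarrow> r - h r \<in> M" by metis
  show ?thesis
  proof (rule count_cycle_type_le[OF M.p_gt_1 R.fin_perm_axioms, of h])
    show "inj_on h R"
    proof (rule inj_onI)
      fix r s assume rs: "r \<in> R" "s \<in> R" "h r = h s"
      have "r - s \<in> M" using M.trans_P[OF h(2)[OF rs(1)], of s] M.sym_P[OF h(2)[OF rs(2)]] rs(3) by simp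
      thus "r = s" using sep rs by blast
    qed
    fix r assume r: "r \<in> R"
    have k: "?k r > 0" by (rule R.card_orbit_pos[OF r])
    show "\<exists>m>0. h r \<in> teich p m" using h(1)[OF r] k by blast
    have "h (\<sigma> r) - \<sigma> r \<in> M" by (rule M.sym_P[OF h(2)[OF G_R[OF s(1) r]]])
    moreover have "\<sigma> r - r ^ p \<in> M" by (rule s(2)[OF R_O[OF r]])
    moreover have "r ^ p - h r ^ p \<in> M"
      using h(2)[OF r] R_algebraic_int[OF r] teich_algebraic_int[OF M.p_gt_1 k h(1)[OF r]]
      by (intro M.cong_power_P) auto
    ultimately have "h (\<sigma> r) - h r ^ p \<in> M" using M.trans_P by blast
    moreover have "h (\<sigma> r) \<in> teich p (?k r)" using h(1)[OF G_R[OF s(1) r]] R.f_orbit[OF r] by simp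
    moreover have "h r ^ p \<in> teich p (?k r)"
      using fin_perm.f_in[OF fin_perm_teich[OF M.p_gt_1 k] h(1)[OF r]] .
    ultimately show "h (\<sigma> r) = h r ^ p" using M.teich_inj[OF k] by blast
  qed (rule assms(4))
qed

end

section \<open>Discriminants\<close>

lemma field_trace_bilinear:
  fixes w :: "nat \<Rightarrow> complex" and a b :: "nat \<Rightarrow> int"
  assumes "subfield_set K" "\<And>k. k < m \<Longrightarrow> w k \<in> K"
  shows "field_trace K ((\<Sum>k<m. of_int (a k) * w k) * (\<Sum>l<m. of_int (b l) * w l)) =
    (\<Sum>k<m. \<Sum>l<m. of_int (a k) * of_int (b l) * field_trace K (w k * w l))"
proof -
  interpret K: subfield_set K by fact
  have "\<phi> ((\<Sum>k<m. of_int (a k) * w k) * (\<Sum>l<m. of_int (b l) * w l)) =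
      (\<Sum>k<m. \<Sum>l<m. of_int (a k) * of_int (b l) * \<phi> (w k * w l))" if "\<phi> \<in> embeddings K" for \<phi>
  proof -
    interpret h: subfield_hom K \<phi> using that embeddings_iff[OF assms(1)] by blast
    have lin: "\<phi> (\<Sum>k<m. of_int (c k) * w k) = (\<Sum>k<m. of_int (c k) * \<phi> (w k))" for c :: "nat \<Rightarrow> int"
      using assms(2) by (subst h.hom_sum) (auto simp: h.hom_mult h.hom_of_int)
    have "\<phi> ((\<Sum>k<m. of_int (a k) * w k) * (\<Sum>l<m. of_int (b l) * w l)) =
        (\<Sum>k<m. of_int (a k) * \<phi> (w k)) * (\<Sum>l<m. of_int (b l) * \<phi> (w l))"
      using assms(2) by (subst h.hom_mult) (auto simp: lin)
    also have "\<dots> = (\<Sum>k<m. \<Sum>l<m. of_int (a k) * of_int (b l) * (\<phi> (w k) * \<phi> (w l)))"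
      unfolding sum_product by (intro sum.cong refl) (simp add: mult_ac)
    also have "\<dots> = (\<Sum>k<m. \<Sum>l<m. of_int (a k) * of_int (b l) * \<phi> (w k * w l))"
      using assms(2) by (intro sum.cong refl) (auto simp: h.hom_mult)
    finally show ?thesis .
  qed
  hence "field_trace K ((\<Sum>k<m. of_int (a k) * w k) * (\<Sum>l<m. of_int (b l) * w l)) =
      (\<Sum>\<phi>\<in>embeddings K. \<Sum>k<m. \<Sum>l<m. of_int (a k) * of_int (b l) * \<phi> (w k * w l))"
    unfolding field_trace_def by (intro sum.cong) auto
  also have "\<dots> = (\<Sum>k<m. \<Sum>\<phi>\<in>embeddings K. \<Sum>l<m. of_int (a k) * of_int (b l) * \<phi> (w k * w l))"
    by (rule sum.swap)
  also have "\<dots> = (\<Sum>k<m. \<Sum>l<m. \<Sum>\<phi>\<in>embeddings K. of_int (a k) * of_int (b l) * \<phi> (w k * w l))"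
    by (intro sum.cong refl sum.swap)
  finally show ?thesis by (simp add: field_trace_def sum_distrib_left)
qed

lemma mat_mult_entry:
  "A \<in> carrier_mat n k \<Longrightarrow> B \<in> carrier_mat k m \<Longrightarrow> i < n \<Longrightarrow> j < m \<Longrightarrow>
    (A * B) $$ (i, j) = (\<Sum>l<k. A $$ (i, l) * B $$ (l, j))"
  by (simp add: scalar_prod_def atLeast0LessThan)

lemma nth_eq_int_sum:
  "i < length ws \<Longrightarrow> ws ! i = (\<Sum>k<length ws. of_int (if k = i then 1 else 0) * ws ! k)" for ws :: "complex list"
  by (simp add: if_distrib if_distribR cong: if_cong)

lemma nth_in_int_span: "i < length ws \<Longrightarrow> ws ! i \<in> int_span ws"
  unfolding int_span_def mem_Collect_eq
  by (intro exI[of _ "\<lambda>k. if k = i then 1 else 0"] conjI TrueI nth_eq_int_sum)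

lemma int_basis_coords:
  assumes "int_basis A ws" "int_basis A ws'"
  shows "\<exists>c :: nat \<Rightarrow> nat \<Rightarrow> int. \<forall>i<length ws'. ws' ! i = (\<Sum>k<length ws. of_int (c i k) * ws ! k)"
proof -
  have "\<exists>c :: nat \<Rightarrow> int. ws' ! i = (\<Sum>k<length ws. of_int (c k) * ws ! k)" if i: "i < length ws'" for i
  proof -
    have "ws' ! i \<in> int_span ws" using nth_in_int_span[OF i] assms by (simp add: int_basis_def)
    thus ?thesis unfolding int_span_def by auto
  qed
  thus ?thesis by metis
qed

lemma int_basis_coords_inverse:
  assumes "int_basis A ws'"
    and c: "\<And>i. i < m' \<Longrightarrow> ws' ! i = (\<Sum>k<m. of_int (c i k) * ws ! k)"
    and d: "\<And>k. k < m \<Longrightarrow> ws ! k = (\<Sum>j<m'. of_int (d k j) * ws' ! j)"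
    and "m' = length ws'" "i < m'" "j < m'"
  shows "(\<Sum>k<m. c i k * d k j) = (if i = j then 1 else 0)"
proof -
  have "ws' ! i = (\<Sum>k<m. \<Sum>j<m'. of_int (c i k) * (of_int (d k j) * ws' ! j))"
    using c[OF assms(5)] d by (simp add: sum_distrib_left)
  also have "\<dots> = (\<Sum>j<m'. \<Sum>k<m. of_int (c i k) * (of_int (d k j) * ws' ! j))" by (rule sum.swap)
  also have "\<dots> = (\<Sum>j<m'. of_int (\<Sum>k<m. c i k * d k j) * ws' ! j)"
    by (simp add: sum_distrib_right mult.assoc)
  finally have 1: "ws' ! i = (\<Sum>j<m'. of_int (\<Sum>k<m. c i k * d k j) * ws' ! j)" .
  have "ws' ! i = (\<Sum>j<m'. of_int (if j = i then 1 else 0) * ws' ! j)"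
    using assms(4,5) nth_eq_int_sum by blast
  hence *: "(\<Sum>j<m'. of_int ((\<Sum>k<m. c i k * d k j) - (if j = i then 1 else 0)) * ws' ! j) = 0"
    using 1 by (simp add: left_diff_distrib sum_subtractf)
  have "\<forall>a :: nat \<Rightarrow> int. (\<Sum>i<length ws'. of_int (a i) * ws' ! i) = 0 \<longrightarrow> (\<forall>i<length ws'. a i = 0)"
    using assms(1) by (simp add: int_basis_def)
  from spec[OF this, of "\<lambda>j. (\<Sum>k<m. c i k * d k j) - (if j = i then 1 else 0)"]
  have "(\<Sum>k<m. c i k * d k j) - (if j = i then 1 else 0) = 0"
    using * assms(4,6) by blast
  thus ?thesis by auto
qed

text \<open>The change of basis \<open>U\<close> is an invertible integer matrix, so its determinant
  has square \<open>1\<close>, and the trace matrices are related by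
  \<open>?T' = ?U * ?T * transpose_mat ?U\<close>.\<close>

lemma basis_disc_unique:
  assumes K: "subfield_set K" and A: "A \<subseteq> K" and ws: "int_basis A ws" and ws': "int_basis A ws'"
  shows "basis_disc K ws = basis_disc K ws'"
proof -
  let ?m = "length ws" and ?m' = "length ws'"
  obtain c where c: "\<And>i. i < ?m' \<Longrightarrow> ws' ! i = (\<Sum>k<?m. of_int (c i k) * ws ! k)"
    using int_basis_coords[OF ws ws'] by blast
  obtain d where d: "\<And>i. i < ?m \<Longrightarrow> ws ! i = (\<Sum>k<?m'. of_int (d i k) * ws' ! k)"
    using int_basis_coords[OF ws' ws] by blast
  have cd: "(\<Sum>k<?m. c i k * d k j) = (if i = j then 1 else 0)" if "i < ?m'" "j < ?m'" for i j
    using int_basis_coords_inverse[OF ws' c d refl that] by simp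
  have dc: "(\<Sum>k<?m'. d i k * c k j) = (if i = j then 1 else 0)" if "i < ?m" "j < ?m" for i j
    using int_basis_coords_inverse[OF ws d c refl that] by simp
  \<comment> \<open>The traces of the two products of the coordinate matrices agree, so the two
    bases have the same length.\<close>
  have "int ?m' = (\<Sum>i<?m'. \<Sum>k<?m. c i k * d k i)" using cd by simp
  also have "\<dots> = (\<Sum>k<?m. \<Sum>i<?m'. d k i * c i k)" by (subst sum.swap) (simp add: mult.commute)
  also have "\<dots> = int ?m" using dc by simp
  finally have len: "?m' = ?m" by simp
  define U where "U = mat ?m ?m (\<lambda>(i, j). c i j)"
  define V where "V = mat ?m ?m (\<lambda>(i, j). d i j)"
  have "U * V = 1\<^sub>m ?m"
    by (rule eq_matI) (auto simp: U_def V_def scalar_prod_def atLeast0LessThan cd len)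
  hence "det U * det V = 1" using det_mult[of U ?m V] by (simp add: U_def V_def)
  hence "det U dvd 1" by (metis dvd_triv_left)
  hence detU: "det U * det U = 1" by (auto simp: zdvd1_eq abs_if split: if_splits)
  let ?U = "map_mat complex_of_int U"
  let ?T = "mat ?m ?m (\<lambda>(i, j). field_trace K (ws ! i * ws ! j))"
  let ?T' = "mat ?m ?m (\<lambda>(i, j). field_trace K (ws' ! i * ws' ! j))"
  have wsK: "ws ! k \<in> K" if "k < ?m" for k
    using nth_in_int_span[OF that] ws A by (auto simp: int_basis_def)
  have cU: "?U \<in> carrier_mat ?m ?m" "transpose_mat ?U \<in> carrier_mat ?m ?m" by (simp_all add: U_def)
  have cT: "?T \<in> carrier_mat ?m ?m" by simp
  have cUT: "?U * ?T \<in> carrier_mat ?m ?m" using cU(1) cT by (rule mult_carrier_mat)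
  have "?T' = ?U * ?T * transpose_mat ?U"
  proof (rule eq_matI)
    fix i j assume ij: "i < dim_row (?U * ?T * transpose_mat ?U)" "j < dim_col (?U * ?T * transpose_mat ?U)"
    hence ij': "i < ?m" "j < ?m" by (auto simp: U_def)
    have "?T' $$ (i, j) = field_trace K (ws' ! i * ws' ! j)" using ij' by simp
    also have "\<dots> = (\<Sum>k<?m. \<Sum>l<?m. of_int (c i k) * of_int (c j l) * field_trace K (ws ! k * ws ! l))"
      using c[of i] c[of j] ij' len field_trace_bilinear[of K ?m "\<lambda>k. ws ! k" "c i" "c j"] K wsK by simp
    also have "\<dots> = (\<Sum>l<?m. \<Sum>k<?m. of_int (c i k) * of_int (c j l) * field_trace K (ws ! k * ws ! l))"
      by (rule sum.swap)
    also have "\<dots> = (\<Sum>l<?m. (\<Sum>k<?m. of_int (c i k) * field_trace K (ws ! k * ws ! l)) * of_int (c j l))"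
      unfolding sum_distrib_right by (intro sum.cong refl) (simp only: mult_ac)
    also have "\<dots> = (\<Sum>l<?m. (?U * ?T) $$ (i, l) * transpose_mat ?U $$ (l, j))"
    proof (rule sum.cong[OF refl])
      fix l assume "l \<in> {..<?m}"
      hence l: "l < ?m" by simp
      have "transpose_mat ?U $$ (l, j) = of_int (c j l)" using l ij' by (simp add: U_def)
      moreover have "(?U * ?T) $$ (i, l) = (\<Sum>k<?m. of_int (c i k) * field_trace K (ws ! k * ws ! l))"
        unfolding mat_mult_entry[OF cU(1) cT ij'(1) l]
        by (intro sum.cong refl) (use l ij' in \<open>simp add: U_def\<close>)
      ultimately show "(\<Sum>k<?m. of_int (c i k) * field_trace K (ws ! k * ws ! l)) * of_int (c j l) =
          (?U * ?T) $$ (i, l) * transpose_mat ?U $$ (l, j)" by simp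
    qed
    also have "\<dots> = (?U * ?T * transpose_mat ?U) $$ (i, j)"
      by (rule mat_mult_entry[OF cUT cU(2) ij', symmetric])
    finally show "?T' $$ (i, j) = (?U * ?T * transpose_mat ?U) $$ (i, j)" .
  qed (auto simp: U_def)
  hence "det ?T' = det ?U * det ?T * det (transpose_mat ?U)"
    using det_mult[OF cUT cU(2)] det_mult[OF cU(1) cT] by (simp only:)
  also have "\<dots> = (det ?U * det ?U) * det ?T"
    unfolding det_transpose[OF cU(1)] by (simp only: mult_ac)
  also have "det ?U * det ?U = of_int (det U * det U)"
    by (simp add: of_int_hom.hom_det)
  finally show ?thesis using detU len by (simp add: basis_disc_def)
qed

lemma order_disc_eq:
  assumes "subfield_set K" "A \<subseteq> K" "int_basis A ws" "of_int d = basis_disc K ws"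
  shows "order_disc K A = d"
  unfolding order_disc_def
proof (rule the_equality)
  show "\<exists>ws. int_basis A ws \<and> of_int d = basis_disc K ws" using assms by blast
  fix e assume "\<exists>ws. int_basis A ws \<and> of_int e = basis_disc K ws"
  then obtain ws' where "int_basis A ws'" "of_int e = basis_disc K ws'" by blast
  hence "complex_of_int e = of_int d" using basis_disc_unique[OF assms(1-3)] assms(4) by metis
  thus "e = d" by simp
qed

section \<open>Determinants modulo a prime ideal\<close>

context prime_set
begin

lemma det_in_S:
  assumes "A \<in> carrier_mat n n" "\<And>i j. i < n \<Longrightarrow> j < n \<Longrightarrow> A $$ (i, j) \<in> S"
  shows "det A \<in> S"
proof -
  have "(\<Sum>q | q permutes {0..<n}. signof q * (\<Prod>i = 0..<n. A $$ (i, q i))) \<in> S"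
  proof (rule sum_S)
    fix q assume "q \<in> {q. q permutes {0..<n}}"
    hence "q i < n" if "i < n" for i using permutes_in_image[of q "{0..<n}" i] that by auto
    hence "(\<Prod>i = 0..<n. A $$ (i, q i)) \<in> S" using assms(2) by auto
    thus "signof q * (\<Prod>i = 0..<n. A $$ (i, q i)) \<in> S" by (intro mult_S of_int_S)
  qed
  thus ?thesis using assms(1) by (subst det_def') auto
qed

lemma det_cong_P:
  assumes "A \<in> carrier_mat n n" "B \<in> carrier_mat n n"
    and "\<And>i j. i < n \<Longrightarrow> j < n \<Longrightarrow> A $$ (i, j) \<in> S \<and> B $$ (i, j) \<in> S \<and> A $$ (i, j) - B $$ (i, j) \<in> P"
  shows "det A - det B \<in> P"
proof -
  have "(\<Sum>q | q permutes {0..<n}. signof q * (\<Prod>i = 0..<n. A $$ (i, q i))) -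
      (\<Sum>q | q permutes {0..<n}. signof q * (\<Prod>i = 0..<n. B $$ (i, q i))) \<in> P"
  proof (rule cong_sum_P)
    fix q assume "q \<in> {q. q permutes {0..<n}}"
    hence q: "q i < n" if "i < n" for i using permutes_in_image[of q "{0..<n}" i] that by auto
    have "(\<Prod>i = 0..<n. A $$ (i, q i)) - (\<Prod>i = 0..<n. B $$ (i, q i)) \<in> P"
    proof (rule cong_prod_P)
      fix i assume i: "i \<in> {0..<n}"
      show "A $$ (i, q i) - B $$ (i, q i) \<in> P \<and> A $$ (i, q i) \<in> S \<and> B $$ (i, q i) \<in> S"
        using assms(3)[of i "q i"] q[of i] i by simp
    qed
    hence "signof q * ((\<Prod>i = 0..<n. A $$ (i, q i)) - (\<Prod>i = 0..<n. B $$ (i, q i))) \<in> P"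
      by (rule mult_P) (rule of_int_S)
    thus "signof q * (\<Prod>i = 0..<n. A $$ (i, q i)) - signof q * (\<Prod>i = 0..<n. B $$ (i, q i)) \<in> P"
      by (simp add: right_diff_distrib)
  qed
  thus ?thesis using assms(1,2) by (subst (1 2) det_def') auto
qed

end

definition vandermonde :: "nat \<Rightarrow> (nat \<Rightarrow> complex) \<Rightarrow> complex mat" where
  "vandermonde n r = mat n n (\<lambda>(i, j). r j ^ i)"

lemma vandermonde_carrier [simp]: "vandermonde n r \<in> carrier_mat n n"
  by (simp add: vandermonde_def)

text \<open>Multiplying by the coefficient matrix of the polynomials \<open>\<Prod>\<^sub>j\<^sub>\<noteq>\<^sub>k (X - r\<^sub>j)\<close> diagonalises the
  Vandermonde matrix.\<close>

lemma det_vandermonde_in_prime: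
  assumes "prime_set {x :: complex. algebraic_int x} M" "\<And>j. j < n \<Longrightarrow> algebraic_int (r j)"
  shows "det (vandermonde n r) \<in> M \<longleftrightarrow> (\<exists>i<n. \<exists>j<n. i \<noteq> j \<and> r i - r j \<in> M)"
proof
  interpret M: prime_set "{x :: complex. algebraic_int x}" M by fact
  let ?A = "{x :: complex. algebraic_int x}"
  let ?V = "vandermonde n r"
  {
    assume V: "det ?V \<in> M"
    define l where "l k = (\<Prod>j\<in>{..<n} - {k}. [:- r j, 1:])" for k
    define C where "C = mat n n (\<lambda>(k, i). coeff (l k) i)"
    interpret pol: subring_set "polys_over ?A" by (rule M.subring_polys_over)
    have "l k \<in> polys_over ?A" for k unfolding l_def
      using assms(2) by (intro pol.prod_S) (auto simp: polys_over_def coeff_pCons split: nat.split)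
    hence C_in: "det C \<in> ?A"
      by (intro M.det_in_S[of C n]) (auto simp: C_def polys_over_def)
    have deg: "degree (l k) < n" if "k < n" for k
      unfolding l_def using that by (subst degree_prod_eq_sum_degree) auto
    have ev: "(\<Sum>i<n. coeff (l k) i * x ^ i) = poly (l k) x" if "k < n" for k x
      using deg[OF that] by (subst poly_altdef, intro sum.mono_neutral_right) (auto simp: coeff_eq_0 not_le)
    have CV: "(C * ?V) $$ (k, j) = poly (l k) (r j)" if "k < n" "j < n" for k j
      using that ev[of k "r j"] by (simp add: C_def vandermonde_def scalar_prod_def atLeast0LessThan)
    have zero: "poly (l k) (r j) = 0" if "j < n" "j \<noteq> k" for k j
      using that by (auto simp: l_def poly_prod intro!: prod_zero bexI[of _ j])
    have cC: "C \<in> carrier_mat n n" by (simp add: C_def)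
    have dim: "C * ?V \<in> carrier_mat n n" using cC vandermonde_carrier by (rule mult_carrier_mat)
    have "upper_triangular (C * ?V)"
      using dim CV zero by (intro upper_triangularI) auto
    hence "det (C * ?V) = prod_list (diag_mat (C * ?V))" using det_upper_triangular dim by blast
    also have "\<dots> = (\<Prod>k = 0..<n. (C * ?V) $$ (k, k))" using cC by (simp add: prod_list_diag_prod)
    also have "\<dots> = (\<Prod>k = 0..<n. poly (l k) (r k))" using CV by (intro prod.cong) auto
    finally have "(\<Prod>k = 0..<n. poly (l k) (r k)) = det C * det ?V"
      using det_mult[of C n ?V] by (simp add: C_def)
    hence "(\<Prod>k = 0..<n. poly (l k) (r k)) \<in> M" using M.mult_P[OF V C_in] by simp
    moreover have diffA: "r k - r j \<in> ?A" if "k < n" "j < n" for k j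
      using M.diff_S[of "r k" "r j"] assms(2) that by simp
    have ev2: "poly (l k) (r k) = (\<Prod>j\<in>{..<n} - {k}. r k - r j)" for k by (simp add: l_def poly_prod)
    have "poly (l k) (r k) \<in> ?A" if "k < n" for k unfolding ev2 using diffA that by (intro M.prod_S) auto
    ultimately obtain k where k: "k < n" "(\<Prod>j\<in>{..<n} - {k}. r k - r j) \<in> M"
      using M.prod_in_P[of "{0..<n}" "\<lambda>k. poly (l k) (r k)"] ev2 by auto
    then obtain j where "j \<in> {..<n} - {k}" "r k - r j \<in> M"
      using M.prod_in_P[of "{..<n} - {k}" "\<lambda>j. r k - r j"] diffA by auto
    thus "\<exists>i<n. \<exists>j<n. i \<noteq> j \<and> r i - r j \<in> M" using k by auto
  next
    assume "\<exists>i<n. \<exists>j<n. i \<noteq> j \<and> r i - r j \<in> M"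
    then obtain a b where ab: "a < n" "b < n" "a \<noteq> b" "r a - r b \<in> M" by blast
    \<comment> \<open>Replacing one of two congruent nodes by the other creates equal columns and
      changes the determinant only modulo \<open>M\<close>.\<close>
    define W where "W = vandermonde n (r(a := r b))"
    have "det W = 0"
    proof (rule det_identical_columns[of W n a b])
      show "col W a = col W b" using ab by (intro eq_vecI) (auto simp: W_def vandermonde_def)
    qed (use ab in \<open>auto simp: W_def\<close>)
    moreover have "det ?V - det W \<in> M"
    proof (rule M.det_cong_P[of _ n])
      fix i j assume ij: "i < n" "j < n"
      show "?V $$ (i, j) \<in> ?A \<and> W $$ (i, j) \<in> ?A \<and> ?V $$ (i, j) - W $$ (i, j) \<in> M"
        using ij ab assms(2) M.cong_power_P[OF ab(4), of i]
        by (auto simp: vandermonde_def W_def intro: algebraic_int_power_complex)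
    qed (auto simp: W_def)
    ultimately show "det ?V \<in> M" by simp
  }
qed

section \<open>The Galois group as a permutation group of the roots\<close>

context galois_roots
begin

lemma cycle_type_conjugate:
  assumes "\<sigma> \<in> G" "\<tau> \<in> G"
  shows "cycle_type (compose L \<tau> (compose L \<sigma> (ginv \<tau>))) R = cycle_type \<sigma> R"
proof -
  interpret T: fin_perm \<tau> R by (rule fin_perm_R[OF assms(2)])
  have "\<tau> (\<sigma> r) = compose L \<tau> (compose L \<sigma> (ginv \<tau>)) (\<tau> r)" if "r \<in> R" for r
  proof -
    have "r \<in> L" "\<tau> r \<in> L" using that R_L G_in[OF assms(2)] by auto
    thus ?thesis using ginv_apply(1)[OF assms(2)] by simp
  qed
  moreover have "inj_on \<tau> R" "\<tau> ` R = R" using T.bij_A by (auto simp: bij_betw_def)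
  ultimately show ?thesis
    using cycle_type_equivariant[of \<sigma> R \<tau> "compose L \<tau> (compose L \<sigma> (ginv \<tau>))"] fin_perm_R[OF assms(1)]
    by simp
qed

lemma frobenius_type_at_other_prime:
  assumes "prime p" "P \<in> primes_above L p" "Q \<in> primes_above L p" "frobenius_at L p P \<sigma>"
  shows "\<exists>\<rho>. frobenius_at L p Q \<rho> \<and> cycle_type \<rho> R = cycle_type \<sigma> R"
proof -
  obtain \<tau> where t: "\<tau> \<in> G" "Q = \<tau> ` P" using primes_above_conjugate[OF assms(1-3)] by blast
  have "\<sigma> \<in> G" using assms(4) by (simp add: frobenius_at_def)
  thus ?thesis using frobenius_conjugate[OF assms(1,2,4) t(1)] cycle_type_conjugate[OF _ t(1)] t(2) by blast
qed

text \<open>An automorphism carrying \<open>Q\<close> to \<open>P\<close> permutes the roots, so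
  congruent roots modulo \<open>Q\<close> give congruent roots modulo \<open>P\<close>.\<close>

lemma separated_at_other_prime:
  assumes "prime p" "P \<in> primes_above L p" "Q \<in> primes_above L p"
    and sep: "\<And>r s. r \<in> R \<Longrightarrow> s \<in> R \<Longrightarrow> r - s \<in> P \<Longrightarrow> r = s"
    and rs: "r \<in> R" "s \<in> R" "r - s \<in> Q"
  shows "r = s"
proof -
  obtain \<tau> where t: "\<tau> \<in> G" "P = \<tau> ` Q" using primes_above_conjugate[OF assms(1,3,2)] by blast
  have L: "r \<in> L" "s \<in> L" using rs R_L by auto
  have "\<tau> r - \<tau> s = \<tau> (r - s)" using subfield_hom.hom_diff[OF G_hom[OF t(1)] L] by simp
  hence "\<tau> r - \<tau> s \<in> P" using rs(3) t(2) by blast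
  hence "\<tau> r = \<tau> s" using sep G_R[OF t(1)] rs by blast
  thus ?thesis using G_inj[OF t(1) L] by blast
qed

definition full_symmetric :: bool where
  "full_symmetric \<longleftrightarrow> (\<forall>\<pi>. \<pi> permutes R \<longrightarrow> (\<exists>\<sigma>\<in>G. \<forall>r\<in>R. \<sigma> r = \<pi> r))"

lemma full_symmetricD:
  assumes full_symmetric "bij_betw h R R"
  shows "\<exists>\<sigma>\<in>G. \<forall>r\<in>R. \<sigma> r = h r"
proof -
  define \<pi> where "\<pi> x = (if x \<in> R then h x else x)" for x
  have "bij_betw \<pi> R R" using assms(2) by (subst bij_betw_cong[of R \<pi> h]) (auto simp: \<pi>_def)
  hence "\<pi> permutes R" by (rule bij_imp_permutes) (simp add: \<pi>_def)
  then obtain \<sigma> where "\<sigma> \<in> G" "\<forall>r\<in>R. \<sigma> r = \<pi> r" using assms(1) unfolding full_symmetric_def by blast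
  thus ?thesis by (auto simp: \<pi>_def)
qed

lemma artin_symbol_eq:
  assumes p: "prime p" and P: "P \<in> primes_above L p" and full: full_symmetric
    and type: "\<And>\<sigma>. frobenius_at L p P \<sigma> \<Longrightarrow> cycle_type \<sigma> R = \<nu>"
  shows "artin_symbol L p = {\<sigma> \<in> G. cycle_type \<sigma> R = \<nu>}"
proof (intro equalityI subsetI)
  fix \<sigma> assume "\<sigma> \<in> artin_symbol L p"
  then obtain Q where Q: "Q \<in> primes_above L p" "frobenius_at L p Q \<sigma>" by (auto simp: artin_symbol_def)
  obtain \<rho> where "frobenius_at L p P \<rho>" "cycle_type \<rho> R = cycle_type \<sigma> R"
    using frobenius_type_at_other_prime[OF p Q(1) P Q(2)] by blast
  thus "\<sigma> \<in> {\<sigma> \<in> G. cycle_type \<sigma> R = \<nu>}" using type Q(2) by (auto simp: frobenius_at_def)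
next
  fix \<sigma> assume "\<sigma> \<in> {\<sigma> \<in> G. cycle_type \<sigma> R = \<nu>}"
  hence s: "\<sigma> \<in> G" "cycle_type \<sigma> R = \<nu>" by auto
  obtain \<sigma>\<^sub>0 where s0: "frobenius_at L p P \<sigma>\<^sub>0" using frobenius_exists[OF p P] by blast
  hence s0G: "\<sigma>\<^sub>0 \<in> G" "cycle_type \<sigma>\<^sub>0 R = \<nu>" using type by (auto simp: frobenius_at_def)
  obtain h where h: "bij_betw h R R" "\<forall>x\<in>R. h (\<sigma>\<^sub>0 x) = \<sigma> (h x)"
    using cycle_type_eq_imp_conjugate[OF fin_perm_R[OF s0G(1)] fin_perm_R[OF s(1)]] s(2) s0G(2) by auto
  obtain \<tau> where t: "\<tau> \<in> G" "\<forall>r\<in>R. \<tau> r = h r" using full_symmetricD[OF full h(1)] by blast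
  have "\<sigma> = compose L \<tau> (compose L \<sigma>\<^sub>0 (ginv \<tau>))"
  proof (rule G_eq_on_R)
    fix r assume r: "r \<in> R"
    interpret T: fin_perm \<tau> R by (rule fin_perm_R[OF t(1)])
    obtain q where q: "q \<in> R" "r = \<tau> q" using T.bij_A r by (auto simp: bij_betw_def)
    have "q \<in> L" "r \<in> L" using q r R_L by auto
    hence "compose L \<tau> (compose L \<sigma>\<^sub>0 (ginv \<tau>)) r = \<tau> (\<sigma>\<^sub>0 q)" using q ginv_apply(1)[OF t(1), of q] by simp
    also have "\<dots> = \<sigma> r" using t(2) h(2) q G_R[OF s0G(1)] by simp
    finally show "\<sigma> r = compose L \<tau> (compose L \<sigma>\<^sub>0 (ginv \<tau>)) r" by simp
  qed (use s t s0G in \<open>auto intro!: compose_G ginv_G\<close>)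
  hence "frobenius_at L p (\<tau> ` P) \<sigma>" using frobenius_conjugate[OF p P s0 t(1)] by simp
  thus "\<sigma> \<in> artin_symbol L p" using image_primes_above[OF P t(1)] by (auto simp: artin_symbol_def)
qed

definition root_perm :: "(complex \<Rightarrow> complex) \<Rightarrow> complex \<Rightarrow> complex" where
  "root_perm \<sigma> x = (if x \<in> R then \<sigma> x else x)"

lemma root_perm_permutes: "\<sigma> \<in> G \<Longrightarrow> root_perm \<sigma> permutes R"
proof (rule bij_imp_permutes)
  assume "\<sigma> \<in> G"
  hence "bij_betw \<sigma> R R" using fin_perm.bij_A[OF fin_perm_R] by blast
  thus "bij_betw (root_perm \<sigma>) R R" by (subst bij_betw_cong[of R _ \<sigma>]) (auto simp: root_perm_def)
qed (simp add: root_perm_def)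

lemma inj_root_perm: "inj_on root_perm G"
proof (rule inj_onI)
  fix \<sigma> \<tau> assume st: "\<sigma> \<in> G" "\<tau> \<in> G" "root_perm \<sigma> = root_perm \<tau>"
  show "\<sigma> = \<tau>"
  proof (rule G_eq_on_R[OF st(1,2)])
    fix r assume "r \<in> R"
    thus "\<sigma> r = \<tau> r" using fun_cong[OF st(3), of r] by (simp add: root_perm_def)
  qed
qed

lemma full_symmetric_iff_image: "full_symmetric \<longleftrightarrow> root_perm ` G = {\<pi>. \<pi> permutes R}"
proof
  assume full: full_symmetric
  have "\<pi> \<in> root_perm ` G" if \<pi>: "\<pi> permutes R" for \<pi>
  proof -
    obtain \<sigma> where "\<sigma> \<in> G" "\<forall>r\<in>R. \<sigma> r = \<pi> r" using full \<pi> unfolding full_symmetric_def by blast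
    hence "\<pi> = root_perm \<sigma>" using permutes_not_in[OF \<pi>] by (auto simp: root_perm_def fun_eq_iff)
    thus ?thesis using \<open>\<sigma> \<in> G\<close> by blast
  qed
  thus "root_perm ` G = {\<pi>. \<pi> permutes R}" using root_perm_permutes by auto
next
  assume eq: "root_perm ` G = {\<pi>. \<pi> permutes R}"
  show full_symmetric unfolding full_symmetric_def
  proof (intro allI impI)
    fix \<pi> assume "\<pi> permutes R"
    hence "\<pi> \<in> root_perm ` G" using eq by simp
    then obtain \<sigma> where "\<sigma> \<in> G" "\<pi> = root_perm \<sigma>" by blast
    thus "\<exists>\<sigma>\<in>G. \<forall>r\<in>R. \<sigma> r = \<pi> r" by (auto simp: root_perm_def)
  qed
qed

text \<open>From right to left an abstract isomorphism supplies only the group order, the factorial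
  of \<open>card R\<close>. This suffices because the group acts faithfully on
  \<open>R\<close>.\<close>

lemma full_symmetric_iff_iso: "full_symmetric \<longleftrightarrow> gal_group L \<cong> sym_group (card R)"
proof
  let ?n = "card R"
  assume full: full_symmetric
  obtain b where b: "bij_betw b {1..?n} R" using ex_bij_betw_nat_finite_1[OF finite_R] by blast
  let ?c = "inv_into {1..?n} b"
  define \<Psi> where "\<Psi> \<sigma> i = (if i \<in> {1..?n} then ?c (\<sigma> (b i)) else i)" for \<sigma> i
  have c: "bij_betw ?c R {1..?n}" by (rule bij_betw_inv_into[OF b])
  have bR: "b i \<in> R" if "i \<in> {1..?n}" for i using b that by (auto simp: bij_betw_def)
  have cb: "?c (b i) = i" if "i \<in> {1..?n}" for i using bij_betw_inv_into_left[OF b that] .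
  have bc: "b (?c r) = r" if "r \<in> R" for r using bij_betw_inv_into_right[OF b that] .
  have cR: "?c r \<in> {1..?n}" if "r \<in> R" for r using bij_betwE[OF c] that by blast
  have perm: "\<Psi> \<sigma> permutes {1..?n}" if s: "\<sigma> \<in> G" for \<sigma>
  proof (rule bij_imp_permutes)
    have "bij_betw (?c \<circ> (\<sigma> \<circ> b)) {1..?n} {1..?n}"
      using bij_betw_trans[OF bij_betw_trans[OF b fin_perm.bij_A[OF fin_perm_R[OF s]]] c] .
    thus "bij_betw (\<Psi> \<sigma>) {1..?n} {1..?n}"
      by (subst bij_betw_cong[of _ _ "?c \<circ> (\<sigma> \<circ> b)"]) (auto simp: \<Psi>_def)
  qed (auto simp: \<Psi>_def)
  have "\<Psi> \<in> Group.iso (gal_group L) (sym_group ?n)"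
  proof (rule Group.isoI)
    show "\<Psi> \<in> Group.hom (gal_group L) (sym_group ?n)"
    proof (rule homI)
      fix \<sigma> assume "\<sigma> \<in> G"
      thus "\<Psi> \<sigma> \<in> carrier (sym_group ?n)" using perm by (simp add: sym_group_carrier)
    next
      fix \<sigma> \<tau> assume st: "\<sigma> \<in> G" "\<tau> \<in> G"
      have "\<Psi> (compose L \<sigma> \<tau>) = \<Psi> \<sigma> \<circ> \<Psi> \<tau>"
      proof
        fix i
        show "\<Psi> (compose L \<sigma> \<tau>) i = (\<Psi> \<sigma> \<circ> \<Psi> \<tau>) i"
        proof (cases "i \<in> {1..?n}")
          case True
          have tb: "\<tau> (b i) \<in> R" by (rule G_R[OF st(2) bR[OF True]])
          have "b i \<in> L" using bR[OF True] R_L by blast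
          thus ?thesis using True cR[OF tb] bc[OF tb] by (simp add: \<Psi>_def)
        qed (auto simp: \<Psi>_def)
      qed
      thus "\<Psi> (\<sigma> \<otimes>\<^bsub>gal_group L\<^esub> \<tau>) = \<Psi> \<sigma> \<otimes>\<^bsub>sym_group ?n\<^esub> \<Psi> \<tau>"
        using gal_mult[OF st] by (simp add: sym_group_mult)
    qed
    show "bij_betw \<Psi> G (carrier (sym_group ?n))"
    proof (rule bij_betw_imageI)
      show "inj_on \<Psi> G"
      proof (rule inj_onI)
        fix \<sigma> \<tau> assume st: "\<sigma> \<in> G" "\<tau> \<in> G" "\<Psi> \<sigma> = \<Psi> \<tau>"
        show "\<sigma> = \<tau>"
        proof (rule G_eq_on_R[OF st(1,2)])
          fix r assume r: "r \<in> R"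
          have "?c (\<sigma> r) = ?c (\<tau> r)" using fun_cong[OF st(3), of "?c r"] cR[OF r] bc[OF r] by (simp add: \<Psi>_def)
          hence "b (?c (\<sigma> r)) = b (?c (\<tau> r))" by simp
          thus "\<sigma> r = \<tau> r" using bc G_R st r by simp
        qed
      qed
      show "\<Psi> ` G = carrier (sym_group ?n)"
      proof
        show "\<Psi> ` G \<subseteq> carrier (sym_group ?n)" using perm by (auto simp: sym_group_carrier)
        show "carrier (sym_group ?n) \<subseteq> \<Psi> ` G"
        proof
          fix q assume "q \<in> carrier (sym_group ?n)"
          hence q: "q permutes {1..?n}" by (simp add: sym_group_carrier)
          have "bij_betw (b \<circ> (q \<circ> ?c)) R R"
            using bij_betw_trans[OF bij_betw_trans[OF c permutes_imp_bij[OF q]] b] .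
          then obtain \<sigma> where s: "\<sigma> \<in> G" "\<forall>r\<in>R. \<sigma> r = (b \<circ> (q \<circ> ?c)) r"
            using full_symmetricD[OF full] by blast
          have "q = \<Psi> \<sigma>"
          proof
            fix i
            show "q i = \<Psi> \<sigma> i"
            proof (cases "i \<in> {1..?n}")
              case True
              have "q i \<in> {1..?n}" using permutes_in_image[OF q] True by blast
              thus ?thesis using True s(2) bR[OF True] cb[OF True] cb[of "q i"] by (simp add: \<Psi>_def)
            qed (auto simp: \<Psi>_def permutes_not_in[OF q])
          qed
          thus "q \<in> \<Psi> ` G" using s(1) by blast
        qed
      qed
    qed
  qed
  thus "gal_group L \<cong> sym_group ?n" by (auto simp: is_iso_def)
next
  assume "gal_group L \<cong> sym_group (card R)"
  then obtain h where "bij_betw h G (carrier (sym_group (card R)))" by (auto simp: is_iso_def Group.iso_def)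
  hence "card G = card {q. q permutes {1..card R}}"
    using bij_betw_same_card by (auto simp: sym_group_def)
  also have "\<dots> = fact (card R)" by (rule card_permutations) auto
  also have "\<dots> = card {\<pi>. \<pi> permutes R}" by (rule card_permutations[symmetric, OF refl finite_R])
  finally have "card (root_perm ` G) = card {\<pi>. \<pi> permutes R}" using card_image[OF inj_root_perm] by simp
  moreover have "root_perm ` G \<subseteq> {\<pi>. \<pi> permutes R}" using root_perm_permutes by auto
  ultimately have "root_perm ` G = {\<pi>. \<pi> permutes R}"
    using finite_permutations[OF finite_R] by (intro card_subset_eq) auto
  thus full_symmetric using full_symmetric_iff_image by blast
qed

text \<open>Iterates of \<open>\<sigma>\<close> restricted to \<open>L\<close> are in the group. The
  second conjunct yields elements of a point stabiliser, as the proof of double transitivity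
  needs.\<close>

lemma orbit_imp_G:
  assumes "\<sigma> \<in> G" "r \<in> R" "s \<in> orbit \<sigma> r"
  shows "\<exists>g\<in>G. g r = s \<and> (\<forall>x\<in>L. \<sigma> x = x \<longrightarrow> g x = x)"
proof -
  obtain k where k: "s = (\<sigma> ^^ k) r" using fin_perm.orbit_funpow[OF fin_perm_R[OF assms(1)] assms(2,3)] by blast
  have "(\<sigma> ^^ k) x = x" if "\<sigma> x = x" for x using that by (induction k) auto
  thus ?thesis using restrict_funpow_G[OF assms(1), of k] k R_L assms(2)
    by (intro bexI[of _ "restrict (\<sigma> ^^ k) L"]) auto
qed

text \<open>The first two cycle types make the group doubly transitive, so the third one yields all
  transpositions.\<close>

lemma full_symmetricI:
  assumes s1: "\<sigma>\<^sub>1 \<in> G" "cycle_type \<sigma>\<^sub>1 R = {#card R#}"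
    and s2: "\<sigma>\<^sub>2 \<in> G" "cycle_type \<sigma>\<^sub>2 R = {#1, card R - 1#}"
    and s3: "\<sigma>\<^sub>3 \<in> G" "cycle_type \<sigma>\<^sub>3 R = add_mset 2 (replicate_mset (card R - 2) 1)"
  shows full_symmetric
proof -
  have trans: "\<exists>g\<in>G. g r = s" if "r \<in> R" "s \<in> R" for r s
    using orbit_imp_G[OF s1(1) that(1), of s] fin_perm.cycle_type_singleton[OF fin_perm_R[OF s1(1)] s1(2) that(1)] that(2)
    by blast
  obtain a where a: "a \<in> R" "\<sigma>\<^sub>2 a = a" "\<forall>x\<in>R - {a}. orbit \<sigma>\<^sub>2 x = R - {a}"
    using fin_perm.fixed_and_cycle[OF fin_perm_R[OF s2(1)] s2(2)] by blast
  obtain u v where uv: "u \<in> R" "v \<in> R" "u \<noteq> v" "\<sigma>\<^sub>3 u = v" "\<sigma>\<^sub>3 v = u" "\<forall>x\<in>R - {u, v}. \<sigma>\<^sub>3 x = x"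
    using fin_perm.transposition_of_type[OF fin_perm_R[OF s3(1)] s3(2)] by blast
  \<comment> \<open>Move \<open>u\<close> and \<open>x\<close> to the fixed point \<open>a\<close>
    of \<open>\<sigma>\<^sub>2\<close>; an iterate of \<open>\<sigma>\<^sub>2\<close> then connects
    the images of \<open>v\<close> and \<open>y\<close> without moving \<open>a\<close>.\<close>
  have two_trans: "\<exists>g\<in>G. g u = x \<and> g v = y" if xy: "x \<in> R" "y \<in> R" "x \<noteq> y" for x y
  proof -
    obtain g1 where g1: "g1 \<in> G" "g1 u = a" using trans[OF uv(1) a(1)] by blast
    obtain g2 where g2: "g2 \<in> G" "g2 x = a" using trans[OF xy(1) a(1)] by blast
    have RL: "u \<in> L" "v \<in> L" "x \<in> L" "y \<in> L" "a \<in> L" using uv xy a R_L by auto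
    have v': "g1 v \<in> R - {a}" using G_R[OF g1(1) uv(2)] G_inj[OF g1(1) RL(2,1)] g1(2) uv(3) by auto
    have y': "g2 y \<in> R - {a}" using G_R[OF g2(1) xy(2)] G_inj[OF g2(1) RL(4,3)] g2(2) xy(3) by auto
    have "g2 y \<in> orbit \<sigma>\<^sub>2 (g1 v)" using a(3) v' y' by blast
    then obtain g where g: "g \<in> G" "g (g1 v) = g2 y" "g a = a"
      using orbit_imp_G[OF s2(1), of "g1 v" "g2 y"] v' a(2) RL(5) by blast
    have "ginv g2 a = x" using ginv_apply(1)[OF g2(1) RL(3)] unfolding g2(2) .
    moreover have "ginv g2 (g2 y) = y" by (rule ginv_apply(1)[OF g2(1) RL(4)])
    ultimately have "compose L (ginv g2) (compose L g g1) u = x" "compose L (ginv g2) (compose L g g1) v = y"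
      using RL(1,2) by (simp_all only: compose_apply g1(2) g(2,3))
    thus ?thesis using g g1 g2 by (intro bexI[of _ "compose L (ginv g2) (compose L g g1)"]) auto
  qed
  have swap: "\<exists>g\<in>G. root_perm g = Transposition.transpose x y" if xy: "x \<in> R" "y \<in> R" "x \<noteq> y" for x y
  proof -
    obtain g where g: "g \<in> G" "g u = x" "g v = y" using two_trans[OF xy] by blast
    \<comment> \<open>Conjugating the transposition of \<open>u\<close> and \<open>v\<close> by
      \<open>g\<close> gives the transposition of \<open>x\<close> and \<open>y\<close>.\<close>
    define t where "t = compose L g (compose L \<sigma>\<^sub>3 (ginv g))"
    have tG: "t \<in> G" unfolding t_def using g s3(1) by auto
    have tg: "t (g r) = g (\<sigma>\<^sub>3 r)" if "r \<in> R" for r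
      using that R_L g(1) ginv_apply(1)[OF g(1), of r] G_in[OF g(1), of r] by (auto simp: t_def)
    have "root_perm t z = Transposition.transpose x y z" for z
    proof (cases "z \<in> R")
      case True
      obtain r where r: "r \<in> R" "z = g r"
        using fin_perm.bij_A[OF fin_perm_R[OF g(1)]] True by (auto simp: bij_betw_def)
      have inj: "g r = g s \<longleftrightarrow> r = s" if "s \<in> R" for s using G_inj[OF g(1), of r s] r that R_L by auto
      have "root_perm t z = g (\<sigma>\<^sub>3 r)" using tg[OF r(1)] r True by (simp add: root_perm_def)
      moreover consider "r = u" | "r = v" | "r \<noteq> u" "r \<noteq> v" by blast
      hence "g (\<sigma>\<^sub>3 r) = Transposition.transpose x y z"
      proof cases
        case 3
        hence "z \<noteq> x" "z \<noteq> y" using r inj[OF uv(1)] inj[OF uv(2)] g by auto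
        thus ?thesis using 3 uv(6) r by (simp add: Transposition.transpose_def)
      qed (use r g uv in \<open>auto simp: Transposition.transpose_def\<close>)
      ultimately show ?thesis by simp
    qed (use xy in \<open>auto simp: root_perm_def Transposition.transpose_def\<close>)
    thus ?thesis using tG by blast
  qed
  have comp: "root_perm (compose L g h) = root_perm g \<circ> root_perm h" if "g \<in> G" "h \<in> G" for g h
    using that R_L G_R by (auto simp: root_perm_def fun_eq_iff)
  have "\<pi> \<in> root_perm ` G" if "\<pi> permutes R" for \<pi>
    using that finite_R
  proof (induction rule: permutes_induct)
    case id
    have "root_perm gid = id" using R_L by (auto simp: root_perm_def fun_eq_iff)
    thus ?case by (metis gid_G image_eqI)
  next
    case (swap x y q)
    then obtain h where h: "h \<in> G" "q = root_perm h" by blast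
    obtain g where g: "g \<in> G" "root_perm g = Transposition.transpose x y"
      using \<open>\<And>x y. \<lbrakk>x \<in> R; y \<in> R; x \<noteq> y\<rbrakk> \<Longrightarrow> \<exists>g\<in>G. root_perm g = Transposition.transpose x y\<close> swap by blast
    have "Transposition.transpose x y \<circ> q = root_perm (compose L g h)" using comp[OF g(1) h(1)] g(2) h(2) by simp
    thus ?case using compose_G[OF g(1) h(1)] by blast
  qed
  thus ?thesis unfolding full_symmetric_iff_image using root_perm_permutes by auto
qed

end

section \<open>Simple extensions and their Galois closure\<close>

text \<open>The product of \<open>X - s\<close> over the distinct images \<open>s\<close> of
  \<open>\<theta>\<close> under the group of \<open>F\<close> has fixed, hence rational,
  coefficients. It is divisible by \<open>m\<close>, so every conjugate of \<open>\<theta>\<close>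
  is one of these images. The set of images is finite as it consists of roots of
  \<open>m\<close>.\<close>

lemma galois_contains_conjugates:
  assumes "galois_over_Q F" "\<theta> \<in> F" "is_minpoly m \<theta>" "qeval m a = 0"
  shows "a \<in> F"
proof -
  let ?H = "carrier (gal_group F)"
  have sf: "subfield_set F" using assms(1) subfield_CC_iff by (auto simp: galois_over_Q_def number_field_def)
  interpret F: subfield_set F by fact
  interpret pol: subring_set "polys_over F" by (rule F.subring_polys_over)
  define S where "S = (\<lambda>\<sigma>. \<sigma> \<theta>) ` ?H"
  have hom: "subfield_hom F \<sigma>" "bij_betw \<sigma> F F" if "\<sigma> \<in> ?H" for \<sigma> using that gal_iff[OF sf] by blast+
  have SF: "S \<subseteq> F" unfolding S_def using hom(2) assms(2) by (auto simp: bij_betw_def)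
  have "S \<subseteq> {a. qeval m a = 0}"
  proof
    fix s assume "s \<in> S"
    then obtain \<sigma> where s: "\<sigma> \<in> ?H" "s = \<sigma> \<theta>" by (auto simp: S_def)
    interpret h: subfield_hom F \<sigma> by (rule hom(1)[OF s(1)])
    show "s \<in> {a. qeval m a = 0}"
      using h.hom_qeval[OF assms(2), of m] is_minpolyD(4)[OF assms(3)] h.hom_0 s by simp
  qed
  hence finS: "finite S" using card_roots_minpoly(2)[OF assms(3)] finite_subset by blast
  let ?g = "\<Prod>s\<in>S. [:- s, 1:]"
  have lin: "[:- s, 1:] \<in> polys_over F" if "s \<in> S" for s
    using that SF by (auto simp: polys_over_def coeff_pCons split: nat.split)
  have gF: "?g \<in> polys_over F" using lin by (rule pol.prod_S)
  have coeff_fixed: "\<sigma> (coeff ?g i) = coeff ?g i" if s: "\<sigma> \<in> ?H" for \<sigma> i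
  proof -
    interpret h: subfield_hom F \<sigma> by (rule hom(1)[OF s])
    interpret hh: ring_hom_on F \<sigma> by unfold_locales (auto simp: h.hom_0 h.hom_1 h.hom_add h.hom_mult)
    interpret hp: ring_hom_on "polys_over F" "map_poly \<sigma>" by (rule hh.ring_hom_on_polys)
    have "\<sigma> ` S \<subseteq> S"
    proof
      fix y assume "y \<in> \<sigma> ` S"
      then obtain \<tau> where t: "\<tau> \<in> ?H" "y = \<sigma> (\<tau> \<theta>)" by (auto simp: S_def)
      hence "y = compose F \<sigma> \<tau> \<theta>" using assms(2) by (simp add: compose_def)
      thus "y \<in> S" using gal_compose[OF sf s t(1)] by (auto simp: S_def)
    qed
    moreover have inj: "inj_on \<sigma> S" by (rule inj_on_subset[OF h.hom_inj SF])
    ultimately have "bij_betw \<sigma> S S" using finS by (simp add: bij_betw_def endo_inj_surj)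
    have "map_poly \<sigma> ?g = (\<Prod>s\<in>S. map_poly \<sigma> [:- s, 1:])" using lin by (rule hp.h_prod)
    also have "\<dots> = (\<Prod>s\<in>S. [:- \<sigma> s, 1:])"
    proof (rule prod.cong[OF refl])
      fix s assume "s \<in> S"
      hence "\<sigma> (- s) = - \<sigma> s" using h.hom_uminus SF by blast
      thus "map_poly \<sigma> [:- s, 1:] = [:- \<sigma> s, 1:]"
        by (intro poly_eqI) (auto simp: hh.coeff_map_h coeff_pCons h.hom_0 h.hom_1 split: nat.split)
    qed
    also have "\<dots> = ?g" using prod.reindex_bij_betw[OF \<open>bij_betw \<sigma> S S\<close>, of "\<lambda>s. [:- s, 1:]"] .
    finally have "coeff (map_poly \<sigma> ?g) i = coeff ?g i" by simp
    thus ?thesis by (simp only: hh.coeff_map_h)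
  qed
  have "coeff ?g i \<in> \<rat>" for i
  proof -
    have "coeff ?g i \<in> {x \<in> F. \<forall>\<sigma>\<in>?H. \<sigma> x = x}" using coeff_fixed gF by (simp add: polys_over_def)
    thus ?thesis using assms(1) unfolding galois_over_Q_def by blast
  qed
  hence "\<forall>i. \<exists>r. coeff ?g i = of_rat r" by (metis Rats_cases)
  then obtain r where r: "\<And>i. coeff ?g i = of_rat (r i)" by metis
  define g' where "g' = (\<Sum>i\<le>degree ?g. monom (r i) i)"
  have "coeff g' i = r i" for i
  proof (cases "i \<le> degree ?g")
    case False
    hence "of_rat (r i) = (0 :: complex)" using r[of i] by (simp add: coeff_eq_0)
    thus ?thesis using False by (simp add: g'_def coeff_sum)
  qed (simp add: g'_def coeff_sum)
  hence "map_poly of_rat g' = ?g" by (intro poly_eqI) (simp add: coeff_map_poly r)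
  hence ev: "qeval g' x = (\<Prod>s\<in>S. x - s)" for x by (simp add: qeval_def poly_prod)
  have "(\<lambda>x\<in>F. x) \<in> ?H" using gal_iff[OF sf]
    by (auto simp: bij_betw_def inj_on_def subfield_hom_def subfield_hom_axioms_def sf)
  hence "\<theta> \<in> S" unfolding S_def using assms(2) by (intro image_eqI[of _ _ "\<lambda>x\<in>F. x"]) auto
  hence "qeval g' \<theta> = 0" unfolding ev using finS by (auto intro!: prod_zero bexI[of _ \<theta>])
  hence "m dvd g'" using is_minpolyD(3)[OF assms(3)] by blast
  hence "qeval g' a = 0" using assms(4) by (auto elim!: dvdE)
  hence "a \<in> S" unfolding ev using finS by (simp add: prod_zero_iff)
  thus ?thesis using SF by blast
qed

locale simple_galois_roots = galois_roots L R f for L R f +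
  fixes \<theta> :: complex
  assumes minpoly: "is_minpoly (rat_poly f) \<theta>"
begin

lemma R_qeval: "R = {a. qeval (rat_poly f) a = 0}"
  by (simp add: R_eq qeval_rat_poly)

lemma \<theta>_R: "\<theta> \<in> R"
  using is_minpolyD(4)[OF minpoly] by (simp add: R_qeval)

lemma card_R: "card R = degree f"
  using card_roots_minpoly(1)[OF minpoly] by (simp add: R_qeval)

lemma subfield_K: "subfield_set (adj \<theta>)"
  by (rule subfield_adj[OF minpoly])

lemma K_sub_L: "adj \<theta> \<subseteq> L"
  using L.adj_subset \<theta>_R R_L by blast

text \<open>\<open>L\<close> is one of the fields in the intersection. Any other one contains the
  conjugates of \<open>\<theta>\<close>, which generate \<open>L\<close>.\<close>

lemma galois_closure_K: "galois_closure (adj \<theta>) = L"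
proof
  show "galois_closure (adj \<theta>) \<subseteq> L"
    unfolding galois_closure_def using galois K_sub_L by blast
  show "L \<subseteq> galois_closure (adj \<theta>)" unfolding galois_closure_def
  proof (rule Inter_greatest)
    fix F assume F: "F \<in> {F. galois_over_Q F \<and> adj \<theta> \<subseteq> F}"
    hence "subfield_set F" using subfield_CC_iff by (auto simp: galois_over_Q_def number_field_def)
    moreover have "R \<subseteq> F"
      using F galois_contains_conjugates[OF _ _ minpoly] adj_self by (auto simp: R_qeval)
    ultimately show "L \<subseteq> F" by (rule R_gen)
  qed
qed

text \<open>Evaluation at \<open>\<theta>\<close> is an equivariant bijection from the embeddings to
  the roots. This links \<open>cycle_class\<close> to the action on \<open>R\<close>.\<close>

lemma cycle_type_embeddings:
  assumes "\<sigma> \<in> G"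
  shows "cycle_type (compose (adj \<theta>) \<sigma>) (embeddings (adj \<theta>)) = cycle_type \<sigma> R"
proof -
  note bij = embeddings_adj(1)[OF minpoly, folded R_qeval]
  define h where "h = inv_into (embeddings (adj \<theta>)) (\<lambda>\<phi>. \<phi> \<theta>)"
  have hb: "bij_betw h R (embeddings (adj \<theta>))" unfolding h_def by (rule bij_betw_inv_into[OF bij])
  have hE: "h r \<in> embeddings (adj \<theta>)" "h r \<theta> = r" if "r \<in> R" for r
    using bij_betwE[OF hb] that bij_betw_inv_into_right[OF bij that] by (auto simp: h_def)
  interpret s: subfield_hom L \<sigma> by (rule G_hom[OF assms])
  have "h (\<sigma> r) = compose (adj \<theta>) \<sigma> (h r)" if r: "r \<in> R" for r
  proof -
    interpret e: subfield_hom "adj \<theta>" "h r" using hE[OF r] embeddings_iff[OF subfield_K] by blast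
    have into: "h r x \<in> L" if "x \<in> adj \<theta>" for x
    proof -
      obtain g where "x = qeval g \<theta>" using \<open>x \<in> adj \<theta>\<close> by (auto simp: adj_def)
      hence "h r x = qeval g r" using e.hom_qeval[of \<theta> g] hE[OF r] by simp
      thus ?thesis using r R_L by auto
    qed
    have "subfield_hom (adj \<theta>) (compose (adj \<theta>) \<sigma> (h r))"
      by unfold_locales (auto simp: compose_def e.hom_1 s.hom_1 e.hom_add e.hom_mult into s.hom_add s.hom_mult
          e.plus_S e.mult_S)
    hence "compose (adj \<theta>) \<sigma> (h r) \<in> embeddings (adj \<theta>)" using embeddings_iff[OF subfield_K] by simp
    moreover have "compose (adj \<theta>) \<sigma> (h r) \<theta> = \<sigma> r" using hE[OF r] by (simp add: compose_def)
    moreover have sr: "\<sigma> r \<in> R" by (rule G_R[OF assms r])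
    ultimately show ?thesis using hE[OF sr] bij unfolding bij_betw_def inj_on_def by metis
  qed
  thus ?thesis
    using cycle_type_equivariant[of \<sigma> R h "compose (adj \<theta>) \<sigma>"] fin_perm_R[OF assms] hb
    by (auto simp: bij_betw_def)
qed

lemma cycle_class_eq: "cycle_class (adj \<theta>) \<mu> = {\<sigma> \<in> G. cycle_type \<sigma> R = \<mu>}"
  unfolding cycle_class_def galois_closure_K using cycle_type_embeddings by auto

lemma Sn_iff: "Sn_number_field (degree f) (adj \<theta>) \<longleftrightarrow> full_symmetric"
  unfolding Sn_number_field_def galois_closure_K full_symmetric_iff_iso card_R
  using number_field_adj[OF minpoly] dimension_adj[OF minpoly] by simp

abbreviation powers :: "complex list" where
  "powers \<equiv> map (\<lambda>i. \<theta> ^ i) [0..<degree f]"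

lemma int_span_powers: "int_span powers = int_comb (\<lambda>i. \<theta> ^ i) {..<degree f}"
  by (auto simp: int_span_def int_comb_def)

lemma degree_pos: "degree f > 0"
  using is_minpolyD(5)[OF minpoly] by simp

lemma int_basis_powers: "int_basis (int_span powers) powers"
  unfolding int_basis_def
proof (intro conjI allI impI)
  fix a :: "nat \<Rightarrow> int" and i
  assume "(\<Sum>i<length powers. of_int (a i) * powers ! i) = 0" and i: "i < length powers"
  hence "(\<Sum>i<length powers. of_rat (of_int (a i)) * powers ! i) = 0" by simp
  moreover have "qindep powers" using adj_eq_qspan(2)[OF minpoly] by simp
  ultimately have "\<forall>i<length powers. (of_int (a i) :: rat) = 0"
    using spec[of _ "\<lambda>i. of_int (a i)"] unfolding qindep_def by blast
  thus "a i = 0" using i by simp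
qed simp

lemma subring_powers: "subring_set (int_span powers)"
proof -
  let ?A = "int_comb (\<lambda>i. \<theta> ^ i) {..<degree f}"
  have "poly (map_poly of_int f) \<theta> = 0" using \<theta>_R R_eq by blast
  hence "(\<Sum>i\<le>degree f. of_int (coeff f i) * \<theta> ^ i) = 0" by (simp add: poly_altdef)
  also have "{..degree f} = insert (degree f) {..<degree f}" by auto
  finally have "\<theta> ^ degree f = (\<Sum>i<degree f. of_int (- coeff f i) * \<theta> ^ i)"
    using monic_f by (simp add: sum_negf eq_neg_iff_add_eq_0)
  hence top: "\<theta> ^ degree f \<in> ?A" unfolding int_comb_def by (auto intro!: exI[of _ "\<lambda>i. - coeff f i"])
  have "\<theta> * \<theta> ^ i \<in> ?A" if "i \<in> {..<degree f}" for i
  proof (cases "Suc i < degree f")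
    case True
    thus ?thesis using int_comb_gen[of "{..<degree f}" "Suc i" "\<lambda>i. \<theta> ^ i"] by simp
  next
    case False
    hence "degree f = Suc i" using that by auto
    thus ?thesis using top by simp
  qed
  hence mult: "\<theta> * y \<in> ?A" if "y \<in> ?A" for y using that by (rule int_comb_mult_closed)
  have pow: "\<theta> ^ k * y \<in> ?A" if "y \<in> ?A" for k y
    using that by (induction k) (auto simp: mult.assoc intro: mult)
  show ?thesis unfolding int_span_powers
  proof
    show "1 \<in> ?A" using int_comb_gen[of "{..<degree f}" 0 "\<lambda>i. \<theta> ^ i"] degree_pos by simp
    fix x y assume xy: "x \<in> ?A" "y \<in> ?A"
    show "x - y \<in> ?A" using int_comb_add[OF xy(1) int_comb_of_int_mult[OF xy(2), of "-1"]] by simp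
    have "y * x \<in> ?A" using int_comb_mult_closed[of "{..<degree f}" y "\<lambda>i. \<theta> ^ i" x] pow[OF xy(2)] xy(1)
      by (simp add: mult.commute)
    thus "x * y \<in> ?A" by (simp add: mult.commute)
  qed
qed

lemma powers_sub_K: "int_span powers \<subseteq> adj \<theta>"
proof -
  interpret K: subfield_set "adj \<theta>" by (rule subfield_K)
  show ?thesis unfolding int_span_def by auto
qed

lemma order_powers: "order_in (adj \<theta>) (int_span powers)"
  unfolding order_in_def
  using subring_powers subring_CC_iff powers_sub_K int_basis_powers dimension_adj[OF minpoly]
  by (intro conjI exI[of _ powers]) simp_all

lemma power_sum_int: "(\<Sum>a\<in>R. a ^ k) \<in> \<int>"
proof (rule fixed_imp_int)
  show "(\<Sum>a\<in>R. a ^ k) \<in> \<O>" using R_O by auto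
  fix \<sigma> assume s: "\<sigma> \<in> G"
  interpret h: subfield_hom L \<sigma> by (rule G_hom[OF s])
  have "\<sigma> (\<Sum>a\<in>R. a ^ k) = (\<Sum>a\<in>R. \<sigma> a ^ k)"
    using R_L by (subst h.hom_sum) (auto simp: h.hom_power subsetD)
  also have "\<dots> = (\<Sum>a\<in>R. a ^ k)"
    using sum.reindex_bij_betw[OF fin_perm.bij_A[OF fin_perm_R[OF s]], of "\<lambda>a. a ^ k"] .
  finally show "\<sigma> (\<Sum>a\<in>R. a ^ k) = (\<Sum>a\<in>R. a ^ k)" .
qed

text \<open>The trace matrix of the powers of \<open>\<theta>\<close> is a Vandermonde matrix times
  its transpose, so the discriminant is the square of the Vandermonde determinant, and
  \<open>M\<close> is prime.\<close>

lemma order_disc_dvd_iff: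
  assumes "prime_set_over {x :: complex. algebraic_int x} M p"
  shows "int p dvd order_disc (adj \<theta>) (int_span powers) \<longleftrightarrow> (\<exists>r\<in>R. \<exists>s\<in>R. r \<noteq> s \<and> r - s \<in> M)"
proof -
  interpret M: prime_set_over "{x :: complex. algebraic_int x}" M p by fact
  let ?n = "degree f"
  obtain e where e: "bij_betw e {..<?n} R"
    using ex_bij_betw_nat_finite[OF finite_R] card_R by (auto simp: atLeast0LessThan)
  let ?V = "vandermonde ?n e"
  have eR: "e j \<in> R" if "j < ?n" for j using e that by (auto simp: bij_betw_def)
  have tr: "field_trace (adj \<theta>) (\<theta> ^ i * \<theta> ^ j) = (\<Sum>a\<in>R. a ^ (i + j))" for i j
  proof -
    have "field_trace (adj \<theta>) (\<theta> ^ i * \<theta> ^ j) = (\<Sum>\<phi>\<in>embeddings (adj \<theta>). \<phi> \<theta> ^ (i + j))"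
      unfolding field_trace_def
    proof (rule sum.cong[OF refl])
      fix \<phi> assume "\<phi> \<in> embeddings (adj \<theta>)"
      then interpret h: subfield_hom "adj \<theta>" \<phi> using embeddings_iff[OF subfield_K] by blast
      show "\<phi> (\<theta> ^ i * \<theta> ^ j) = \<phi> \<theta> ^ (i + j)" by (simp add: h.hom_power flip: power_add)
    qed
    also have "\<dots> = (\<Sum>a\<in>R. a ^ (i + j))"
      using sum.reindex_bij_betw[OF embeddings_adj(1)[OF minpoly], of "\<lambda>a. a ^ (i + j)"] by (simp add: R_qeval)
    finally show ?thesis .
  qed
  let ?T = "mat ?n ?n (\<lambda>(i, j). field_trace (adj \<theta>) (powers ! i * powers ! j))"
  have "?T = ?V * transpose_mat ?V"
  proof (rule eq_matI)
    fix i j assume "i < dim_row (?V * transpose_mat ?V)" "j < dim_col (?V * transpose_mat ?V)"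
    hence ij: "i < ?n" "j < ?n" by (auto simp: vandermonde_def)
    have "?T $$ (i, j) = (\<Sum>a\<in>R. a ^ (i + j))" using ij tr by simp
    also have "\<dots> = (\<Sum>k<?n. e k ^ (i + j))"
      using sum.reindex_bij_betw[OF e, of "\<lambda>a. a ^ (i + j)"] by simp
    also have "\<dots> = (\<Sum>k<?n. ?V $$ (i, k) * transpose_mat ?V $$ (k, j))"
      using ij by (intro sum.cong) (auto simp: vandermonde_def power_add)
    also have "\<dots> = (?V * transpose_mat ?V) $$ (i, j)"
      using ij by (intro mat_mult_entry[of _ _ ?n, symmetric]) auto
    finally show "?T $$ (i, j) = (?V * transpose_mat ?V) $$ (i, j)" .
  qed (auto simp: vandermonde_def)
  hence disc: "basis_disc (adj \<theta>) powers = det ?V * det ?V"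
    using det_mult[of ?V ?n "transpose_mat ?V"] det_transpose[of ?V ?n] by (simp add: basis_disc_def)
  have "\<forall>k. \<exists>z. (\<Sum>a\<in>R. a ^ k) = of_int z" using power_sum_int by (metis Ints_cases)
  then obtain t where t: "\<And>k. (\<Sum>a\<in>R. a ^ k) = of_int (t k)" by metis
  \<comment> \<open>The entries of the trace matrix are power sums of the roots, hence integers, so
    the discriminant is an integer.\<close>
  define d where "d = det (mat ?n ?n (\<lambda>(i, j). t (i + j)))"
  have "?T = map_mat of_int (mat ?n ?n (\<lambda>(i, j). t (i + j)))" by (rule eq_matI) (auto simp: tr t)
  hence "det ?T = of_int d" unfolding d_def by (simp only: of_int_hom.hom_det)
  hence d: "of_int d = basis_disc (adj \<theta>) powers" by (simp add: basis_disc_def)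
  have "order_disc (adj \<theta>) (int_span powers) = d"
    by (rule order_disc_eq[OF subfield_K powers_sub_K int_basis_powers d])
  moreover have "int p dvd d \<longleftrightarrow> det ?V \<in> M"
  proof -
    have V: "det ?V \<in> {x. algebraic_int x}"
      using R_algebraic_int[OF eR] by (intro M.det_in_S[of ?V ?n]) (auto simp: vandermonde_def intro: algebraic_int_power_complex)
    have "int p dvd d \<longleftrightarrow> of_int d \<in> M" using M.of_int_P_iff by blast
    also have "\<dots> \<longleftrightarrow> det ?V * det ?V \<in> M" using d disc by simp
    also have "\<dots> \<longleftrightarrow> det ?V \<in> M" using M.prime_P[OF V V] M.mult_P[OF _ V] by blast
    finally show ?thesis .
  qed
  moreover have "det ?V \<in> M \<longleftrightarrow> (\<exists>i<?n. \<exists>j<?n. i \<noteq> j \<and> e i - e j \<in> M)"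
    using R_algebraic_int eR by (intro det_vandermonde_in_prime[OF M.prime_set_axioms]) auto
  moreover have "\<dots> \<longleftrightarrow> (\<exists>r\<in>R. \<exists>s\<in>R. r \<noteq> s \<and> r - s \<in> M)"
  proof
    assume "\<exists>i<?n. \<exists>j<?n. i \<noteq> j \<and> e i - e j \<in> M"
    then obtain i j where ij: "i < ?n" "j < ?n" "i \<noteq> j" "e i - e j \<in> M" by blast
    hence "e i \<noteq> e j" using e by (auto simp: bij_betw_def inj_on_def)
    thus "\<exists>r\<in>R. \<exists>s\<in>R. r \<noteq> s \<and> r - s \<in> M" using ij eR by blast
  next
    assume "\<exists>r\<in>R. \<exists>s\<in>R. r \<noteq> s \<and> r - s \<in> M"
    then obtain r s where rs: "r \<in> e ` {..<?n}" "s \<in> e ` {..<?n}" "r \<noteq> s" "r - s \<in> M"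
      using e by (auto simp: bij_betw_def)
    thus "\<exists>i<?n. \<exists>j<?n. i \<noteq> j \<and> e i - e j \<in> M" by blast
  qed
  ultimately show ?thesis by blast
qed

end

section \<open>Construction of the number fields\<close>

text \<open>For a partition of \<open>n\<close> and a prime \<open>q\<close> this is positivity of
  \<open>nu_star\<close> in the form of \<open>nu_star_pos_iff\<close>; it serves the given and the
  auxiliary primes alike.\<close>

definition realisable :: "nat \<Rightarrow> nat \<Rightarrow> nat multiset \<Rightarrow> bool" where
  "realisable n q \<nu> \<longleftrightarrow> prime q \<and> partition_of n \<nu> \<and> (\<forall>i\<in>{1..n}. count \<nu> i \<le> card (frob_orbits q i))"

lemma size_le_sum_mset: "0 \<notin># \<nu> \<Longrightarrow> size \<nu> \<le> sum_mset \<nu>" for \<nu> :: "nat multiset"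
  by (induction \<nu>) (auto simp: Suc_le_eq)

text \<open>There are \<open>q \<ge> n\<close> orbits of size \<open>1\<close>, which is enough for
  any number of parts \<open>1\<close>, and at least one orbit of each other size.\<close>

lemma realisable_at_large_prime:
  assumes "prime q" "q \<ge> n" "partition_of n \<nu>" "\<And>i. i \<noteq> 1 \<Longrightarrow> count \<nu> i \<le> 1"
  shows "realisable n q \<nu>"
proof -
  have q: "q > 1" using assms(1) prime_gt_1_nat by blast
  have "count \<nu> i \<le> card (frob_orbits q i)" if "i \<in> {1..n}" for i
  proof (cases "i = 1")
    case True
    have "count \<nu> 1 \<le> size \<nu>" by (rule count_le_size)
    also have "\<dots> \<le> n" using assms(3) size_le_sum_mset by (auto simp: partition_of_def)
    finally show ?thesis using assms(2) frob_orbits_1[OF q] True by simp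
  next
    case False
    have "card (frob_orbits q i) > 0" using that q by (intro frob_orbits_pos) auto
    thus ?thesis using assms(4)[OF False] by linarith
  qed
  thus ?thesis using assms by (simp add: realisable_def)
qed

text \<open>The Chinese remainder theorem is applied to each coefficient separately.\<close>

lemma ex_int_poly_with_types:
  assumes "finite Q" "\<And>q. q \<in> Q \<Longrightarrow> realisable n q (\<nu> q)"
  shows "\<exists>f :: int poly. lead_coeff f = 1 \<and> degree f = n \<and>
    (\<forall>q\<in>Q. \<exists>M m S. prime_over_alg_ints M q \<and> m > 0 \<and> S \<subseteq> teich q m \<and> fin_perm (frob q) S \<and>
       card S = n \<and> cycle_type (frob q) S = \<nu> q \<and>
       (\<forall>i. of_int (coeff f i) - coeff (\<Prod>s\<in>S. [:- s, 1:]) i \<in> M))"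
proof -
  have "\<exists>M m S c. prime_over_alg_ints M q \<and> m > 0 \<and> S \<subseteq> teich q m \<and> fin_perm (frob q) S \<and>
      cycle_type (frob q) S = \<nu> q \<and> (\<forall>i. of_nat (c i) - coeff (\<Prod>s\<in>S. [:- s, 1:]) i \<in> M)"
    if q: "q \<in> Q" for q
  proof -
    have r: "prime q" "partition_of n (\<nu> q)" "\<forall>i\<in>{1..n}. count (\<nu> q) i \<le> card (frob_orbits q i)"
      using assms(2)[OF q] by (auto simp: realisable_def)
    obtain M where M: "prime_over_alg_ints M q"
      using prime_over_exists[OF r(1)] by (auto simp: prime_over_alg_ints_def)
    obtain m S where S: "m > 0" "S \<subseteq> teich q m" "fin_perm (frob q) S" "cycle_type (frob q) S = \<nu> q"
      using ex_stable_set_of_type[OF prime_gt_1_nat[OF r(1)] r(2)] r(3) by blast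
    obtain c where "\<forall>i. of_nat (c i :: nat) - coeff (\<Prod>s\<in>S. [:- s, 1:]) i \<in> M"
      using prime_over_alg_ints.int_poly_of_stable_set[OF M S(1-3)] by blast
    thus ?thesis using M S by blast
  qed
  then obtain M m S c where d: "\<And>q. q \<in> Q \<Longrightarrow> prime_over_alg_ints (M q) q \<and> m q > 0 \<and> S q \<subseteq> teich q (m q) \<and>
      fin_perm (frob q) (S q) \<and> cycle_type (frob q) (S q) = \<nu> q \<and>
      (\<forall>i. of_nat (c q i :: nat) - coeff (\<Prod>s\<in>S q. [:- s, 1:]) i \<in> M q)"
    by metis
  have "\<exists>x. \<forall>q\<in>Q. [x = c q i] (mod q)" for i
  proof (rule chinese_remainder_nat[OF assms(1)])
    show "\<forall>q\<in>Q. \<forall>q'\<in>Q. q \<noteq> q' \<longrightarrow> coprime q q'"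
    proof (intro ballI impI)
      fix q q' assume "q \<in> Q" "q' \<in> Q" "q \<noteq> q'"
      moreover from this have "prime q" "prime q'" using assms(2) realisable_def by blast+
      ultimately show "coprime q q'" using primes_coprime by blast
    qed
  qed
  then obtain x where x: "\<And>i q. q \<in> Q \<Longrightarrow> [x i = c q i] (mod q)" by metis
  \<comment> \<open>The top coefficient is set to \<open>1\<close> instead of being glued: the local
    polynomials are all monic of degree \<open>n\<close>.\<close>
  define f :: "int poly" where "f = monom 1 n + (\<Sum>i<n. monom (int (x i)) i)"
  have cf: "coeff f i = (if i = n then 1 else if i < n then int (x i) else 0)" for i
    by (auto simp: f_def coeff_sum)
  have deg: "degree f = n"
    by (intro antisym degree_le le_degree) (auto simp: cf)
  have "\<exists>M m S. prime_over_alg_ints M q \<and> m > 0 \<and> S \<subseteq> teich q m \<and> fin_perm (frob q) S \<and>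
       card S = n \<and> cycle_type (frob q) S = \<nu> q \<and>
       (\<forall>i. of_int (coeff f i) - coeff (\<Prod>s\<in>S. [:- s, 1:]) i \<in> M)" if q: "q \<in> Q" for q
  proof -
    interpret M: prime_over_alg_ints "M q" q using d[OF q] by blast
    have card: "card (S q) = n"
      using fin_perm.sum_cycle_type[of "frob q" "S q"] d[OF q] assms(2)[OF q]
      by (simp add: realisable_def partition_of_def)
    let ?g = "\<Prod>s\<in>S q. [:- s, 1:]"
    have deg_g: "degree ?g = n" using card by (subst degree_prod_eq_sum_degree) auto
    have "lead_coeff ?g = 1" by (simp add: lead_coeff_prod)
    hence top: "coeff ?g n = 1" using deg_g by simp
    have "of_int (coeff f i) - coeff ?g i \<in> M q" for i
    proof (cases "i < n")
      case True
      have "[int (x i) = int (c q i)] (mod int q)" using x[OF q, of i] by (simp add: cong_int_iff)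
      hence "int q dvd int (x i) - int (c q i)" by (simp add: cong_iff_dvd_diff)
      hence "of_int (int (x i) - int (c q i)) \<in> M q" using M.of_int_P_iff by blast
      hence "of_nat (x i) - of_nat (c q i) \<in> M q" by simp
      moreover have "of_nat (c q i) - coeff ?g i \<in> M q" using d[OF q] by blast
      ultimately have "of_nat (x i) - coeff ?g i \<in> M q" by (rule M.trans_P)
      thus ?thesis using True by (simp add: cf)
    next
      case False
      thus ?thesis using top deg_g by (cases "i = n") (auto simp: cf coeff_eq_0)
    qed
    thus ?thesis using d[OF q] card by blast
  qed
  thus ?thesis using deg cf by (intro exI[of _ f]) auto
qed

lemma cycle_type_identity:
  assumes "finite A" "\<And>x. x \<in> A \<Longrightarrow> g x = x"
  shows "cycle_type g A = replicate_mset (card A) 1"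
proof -
  have "orbit g x = {x}" if "x \<in> A" for x using assms(2)[OF that] orbit_eq_singleton_iff by metis
  hence "orbit g ` A = (\<lambda>x. {x}) ` A" by auto
  hence "cycle_type g A = image_mset card (image_mset (\<lambda>x. {x}) (mset_set A))"
    by (simp add: cycle_type_def image_mset_mset_set)
  also have "\<dots> = image_mset (\<lambda>_. 1) (mset_set A)" by (simp add: multiset.map_comp o_def)
  also have "\<dots> = replicate_mset (card A) 1" by (simp add: image_mset_const_eq)
  finally show ?thesis .
qed

lemma minpoly_eq_rat_poly:
  assumes "is_minpoly m \<theta>" "lead_coeff f = 1" "qeval (rat_poly f) \<theta> = 0" "degree f \<le> degree m"
  shows "rat_poly f = m"
proof -
  note mD = is_minpolyD[OF assms(1)]
  obtain h where h: "rat_poly f = m * h" using mD(3) assms(3) by (auto elim: dvdE)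
  have lc: "lead_coeff (rat_poly f) = 1" using assms(2) by simp
  hence "h \<noteq> 0" using h by auto
  hence "degree h = 0" using h mD(2) assms(4) degree_mult_eq[of m h] degree_rat_poly[of f] by simp
  moreover have "lead_coeff h = 1" using h lc mD(1) by (simp add: lead_coeff_mult)
  ultimately have "h = 1" by (metis degree_0_id one_pCons)
  thus ?thesis using h by simp
qed

text \<open>Three primes outside \<open>Q\<close> force the full symmetric group. The last conjunct,
  membership of the identity in the class of type \<open>(1, ..., 1)\<close>, is recorded for the
  separation of fields.\<close>

lemma ex_Sn_field_with_types:
  assumes n: "n \<ge> 2" and Q: "finite Q" "\<And>q. q \<in> Q \<Longrightarrow> realisable n q (\<nu> q)"
  shows "\<exists>K \<theta>. Sn_number_field n K \<and> K = adj \<theta> \<and> (\<exists>m. is_minpoly m \<theta>) \<and>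
    order_in K (int_span (map (\<lambda>i. \<theta> ^ i) [0..<n])) \<and>
    (\<forall>q\<in>Q. \<not> int q dvd order_disc K (int_span (map (\<lambda>i. \<theta> ^ i) [0..<n])) \<and>
       unramified_at (galois_closure K) q \<and> artin_symbol (galois_closure K) q = cycle_class K (\<nu> q)) \<and>
    (\<lambda>x\<in>galois_closure K. x) \<in> cycle_class K (replicate_mset n 1)"
proof -
  \<comment> \<open>Primes beyond \<open>b\<close> are new and at least \<open>n\<close>, as
    \<open>realisable_at_large_prime\<close> requires.\<close>
  define b where "b = Max (insert n Q)"
  have b: "q \<le> b" if "q \<in> insert n Q" for q unfolding b_def using Q(1) that by (intro Max_ge) auto
  obtain q1 where q1: "prime q1" "q1 > b" using bigger_prime by blast
  obtain q2 where q2: "prime q2" "q2 > q1" using bigger_prime by blast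
  obtain q3 where q3: "prime q3" "q3 > q2" using bigger_prime by blast
  have "q \<noteq> q1 \<and> q \<noteq> q2 \<and> q \<noteq> q3" if "q \<in> Q" for q using b[of q] that q1(2) q2(2) q3(2) by simp
  hence notin: "q1 \<notin> Q" "q2 \<notin> Q" "q3 \<notin> Q" by blast+
  have ge: "q1 \<ge> n" "q2 \<ge> n" "q3 \<ge> n" using b[of n] q1 q2 q3 by auto
  \<comment> \<open>For \<open>n = 2\<close> the last two types read \<open>{#1, 1#}\<close> and
    \<open>{#2#}\<close>, which are still admissible.\<close>
  define \<nu>' where "\<nu>' = \<nu>(q1 := {#n#}, q2 := {#1, n - 1#}, q3 := add_mset 2 (replicate_mset (n - 2) 1))"
  let ?Q = "insert q1 (insert q2 (insert q3 Q))"
  have \<nu>': "\<nu>' q1 = {#n#}" "\<nu>' q2 = {#1, n - 1#}" "\<nu>' q3 = add_mset 2 (replicate_mset (n - 2) 1)"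
      "\<And>q. q \<in> Q \<Longrightarrow> \<nu>' q = \<nu> q"
    using q2 q3 notin by (auto simp: \<nu>'_def)
  have "realisable n q (\<nu>' q)" if q: "q \<in> ?Q" for q
  proof -
    consider "q = q1" | "q = q2" | "q = q3" | "q \<in> Q" using q by blast
    thus ?thesis
    proof cases
      case 1
      thus ?thesis unfolding 1 \<nu>' using n q1 ge
        by (intro realisable_at_large_prime) (auto simp: partition_of_def)
    next
      case 2
      thus ?thesis unfolding 2 \<nu>' using n q2 ge
        by (intro realisable_at_large_prime) (auto simp: partition_of_def)
    next
      case 3
      thus ?thesis unfolding 3 \<nu>' using n q3 ge
        by (intro realisable_at_large_prime) (auto simp: partition_of_def sum_mset_replicate_mset)
    next
      case 4
      thus ?thesis using \<nu>'(4) Q(2) by simp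
    qed
  qed
  then obtain f :: "int poly" where f: "lead_coeff f = 1" "degree f = n"
    and fQ: "\<And>q. q \<in> ?Q \<Longrightarrow> \<exists>M m S. prime_over_alg_ints M q \<and> m > 0 \<and> S \<subseteq> teich q m \<and> fin_perm (frob q) S \<and>
       card S = n \<and> cycle_type (frob q) S = \<nu>' q \<and>
       (\<forall>i. of_int (coeff f i) - coeff (\<Prod>s\<in>S. [:- s, 1:]) i \<in> M)"
    using ex_int_poly_with_types[of ?Q n \<nu>'] Q(1) by blast
  define R where "R = {a :: complex. poly (map_poly of_int f) a = 0}"
  have fin: "finite R" unfolding R_def by (rule poly_roots_finite) (use f(1) in auto)
  have alg: "algebraic_int r" if "r \<in> R" for r
    unfolding algebraic_int_altdef_ipoly using that f(1) by (auto simp: R_def)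
  obtain L where L: "galois_field L" "R \<subseteq> L" "\<And>F. subfield_set F \<Longrightarrow> R \<subseteq> F \<Longrightarrow> L \<subseteq> F"
    using splitting_field[of R "rat_poly f"] fin alg by (auto simp: R_def qeval_rat_poly)
  interpret galois_roots L R f
    using L f(1) by (auto simp: galois_roots_def galois_roots_axioms_def R_def)
  have local: "\<exists>M. prime_over_alg_ints M q \<and> card R = n \<and> (\<forall>r\<in>R. \<forall>s\<in>R. r - s \<in> M \<longrightarrow> r = s) \<and>
      (\<forall>\<sigma>. frobenius_at L q (M \<inter> L) \<sigma> \<longrightarrow> cycle_type \<sigma> R = \<nu>' q)" if q: "q \<in> ?Q" for q
  proof -
    obtain M m S where d: "prime_over_alg_ints M q" "m > 0" "S \<subseteq> teich q m" "fin_perm (frob q) S"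
       "card S = n" "cycle_type (frob q) S = \<nu>' q"
       "\<And>i. of_int (coeff f i) - coeff (\<Prod>s\<in>S. [:- s, 1:]) i \<in> M"
      using fQ[OF q] by blast
    have "degree f = card S" using f(2) d(5) by simp
    note t = cycle_type_from_stable_set[OF d(1-4) this d(7)]
    show ?thesis using d(1,6) t f(2) by (intro exI[of _ M]) auto
  qed
  have cR: "card R = n" using local[of q1] by blast
  have frob_ex: "\<exists>\<sigma>\<in>G. cycle_type \<sigma> R = \<nu>' q" if q: "q \<in> ?Q" for q
  proof -
    obtain M where M: "prime_over_alg_ints M q" "\<forall>\<sigma>. frobenius_at L q (M \<inter> L) \<sigma> \<longrightarrow> cycle_type \<sigma> R = \<nu>' q"
      using local[OF q] by blast
    have "prime q" using M(1) by (simp add: prime_over_alg_ints_def prime_set_over_def prime_set_over_axioms_def)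
    then obtain \<sigma> where "frobenius_at L q (M \<inter> L) \<sigma>"
      using frobenius_exists[OF _ prime_restrict_above[OF M(1)]] by blast
    thus ?thesis using M(2) by (auto simp: frobenius_at_def)
  qed
  obtain \<sigma>1 where s1: "\<sigma>1 \<in> G" "cycle_type \<sigma>1 R = {#n#}" using frob_ex[of q1] \<nu>'(1) by auto
  obtain \<sigma>2 where s2: "\<sigma>2 \<in> G" "cycle_type \<sigma>2 R = {#1, n - 1#}" using frob_ex[of q2] \<nu>'(2) by auto
  obtain \<sigma>3 where s3: "\<sigma>3 \<in> G" "cycle_type \<sigma>3 R = add_mset 2 (replicate_mset (n - 2) 1)"
    using frob_ex[of q3] \<nu>'(3) by auto
  have full: full_symmetric
    using full_symmetricI[OF s1(1) _ s2(1) _ s3(1)] s1(2) s2(2) s3(2) cR by simp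
  have "R \<noteq> {}" using cR n by auto
  then obtain \<theta> where \<theta>: "\<theta> \<in> R" by blast
  obtain m where m: "is_minpoly m \<theta>" using algebraic_int_minpoly[OF alg[OF \<theta>]] by blast
  note mD = is_minpolyD[OF m]
  have root: "qeval (rat_poly f) \<theta> = 0" using \<theta> by (simp add: R_def qeval_rat_poly)
  \<comment> \<open>The \<open>n\<close>-cycle makes the group transitive on \<open>R\<close>, so
    all \<open>n\<close> roots are conjugate to \<open>\<theta>\<close> and \<open>f\<close> is its
    minimal polynomial.\<close>
  have "R \<subseteq> {a. qeval m a = 0}"
  proof
    fix r assume r: "r \<in> R"
    have "r \<in> orbit \<sigma>1 \<theta>"
      using fin_perm.cycle_type_singleton[OF fin_perm_R[OF s1(1)] s1(2) \<theta>] r by simp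
    then obtain g where g: "g \<in> G" "g \<theta> = r" using orbit_imp_G[OF s1(1) \<theta>] by blast
    have "\<theta> \<in> L" using \<theta> L(2) by blast
    hence "qeval m (g \<theta>) = g (qeval m \<theta>)" using subfield_hom.hom_qeval[OF G_hom[OF g(1)], of \<theta> m] by simp
    thus "r \<in> {a. qeval m a = 0}" using g(2) mD(4) subfield_hom.hom_0[OF G_hom[OF g(1)]] by simp
  qed
  hence "n \<le> degree m"
    using card_roots_minpoly[OF m] cR by (metis card_mono)
  hence "is_minpoly (rat_poly f) \<theta>" using minpoly_eq_rat_poly[OF m f(1) root] m f(2) by simp
  then interpret simple_galois_roots L R f \<theta> by unfold_locales
  have at_q: "\<not> int q dvd order_disc (adj \<theta>) (int_span powers) \<and> unramified_at L q \<and>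
      artin_symbol L q = cycle_class (adj \<theta>) (\<nu> q)" if q: "q \<in> Q" for q
  proof -
    obtain M where M: "prime_over_alg_ints M q" "\<forall>r\<in>R. \<forall>s\<in>R. r - s \<in> M \<longrightarrow> r = s"
        "\<forall>\<sigma>. frobenius_at L q (M \<inter> L) \<sigma> \<longrightarrow> cycle_type \<sigma> R = \<nu> q"
      using local[of q] \<nu>'(4)[OF q] q by auto
    have Mp: "prime_set_over {x :: complex. algebraic_int x} M q" using M(1) by (simp add: prime_over_alg_ints_def)
    have q': "prime q" using Mp by (simp add: prime_set_over_def prime_set_over_axioms_def)
    note P = prime_restrict_above[OF M(1)]
    have "\<not> int q dvd order_disc (adj \<theta>) (int_span powers)" using order_disc_dvd_iff[OF Mp] M(2) by blast
    moreover have "unramified_at L q"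
    proof (rule unramified_at_L[OF q'])
      fix P' r s assume "P' \<in> primes_above L q" "r \<in> R" "s \<in> R" "r - s \<in> P'"
      thus "r = s" using separated_at_other_prime[OF q' P, of P' r s] M(2) by blast
    qed
    moreover have "artin_symbol L q = cycle_class (adj \<theta>) (\<nu> q)"
      unfolding cycle_class_eq using artin_symbol_eq[OF q' P full] M(3) by blast
    ultimately show ?thesis by blast
  qed
  have "cycle_type gid R = replicate_mset n 1"
    unfolding cR[symmetric] by (rule cycle_type_identity[OF fin]) (use L(2) in auto)
  hence "gid \<in> cycle_class (adj \<theta>) (replicate_mset n 1)" unfolding cycle_class_eq by simp
  hence id: "(\<lambda>x\<in>galois_closure (adj \<theta>). x) \<in> cycle_class (adj \<theta>) (replicate_mset n 1)"
    by (simp add: gid_def galois_closure_K)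
  show ?thesis
    using Sn_iff full order_powers at_q id minpoly f(2) galois_closure_K
    by (intro exI[of _ "adj \<theta>"] exI[of _ \<theta>]) auto
qed

text \<open>An isomorphism sends \<open>\<theta>\<close> to another root of its minimal polynomial,
  and a Galois field contains both roots or neither.\<close>

lemma iso_imp_same_galois_closure:
  assumes "is_minpoly m \<theta>" "K = adj \<theta>" "ring_on K \<simeq> ring_on K'"
  shows "galois_closure K = galois_closure K'"
proof -
  obtain h where h: "h \<in> ring_iso (ring_on K) (ring_on K')" using assms(3) by (auto simp: is_ring_iso_def)
  have sf: "subfield_set K" unfolding assms(2) by (rule subfield_adj[OF assms(1)])
  have hK': "h ` K = K'" using h by (auto simp: ring_iso_def bij_betw_def)
  have "subfield_hom K h"
    using h sf by (auto simp: ring_iso_def Ring.ring_hom_def subfield_hom_def subfield_hom_axioms_def)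
  then interpret h: subfield_hom K h .
  have \<theta>: "\<theta> \<in> K" using assms(2) by simp
  have root: "qeval m (h \<theta>) = 0"
    using h.hom_qeval[OF \<theta>, of m] is_minpolyD(4)[OF assms(1)] h.hom_0 by simp
  have K': "K' = adj (h \<theta>)"
  proof -
    have "K' = h ` range (\<lambda>g. qeval g \<theta>)" using hK' assms(2) by (simp add: adj_def)
    also have "\<dots> = range (\<lambda>g. qeval g (h \<theta>))" by (simp add: image_image h.hom_qeval[OF \<theta>])
    finally show ?thesis by (simp add: adj_def)
  qed
  have "K \<subseteq> F \<longleftrightarrow> K' \<subseteq> F" if F: "galois_over_Q F" for F
  proof -
    have sfF: "subfield_set F" using F subfield_CC_iff by (auto simp: galois_over_Q_def number_field_def)
    have "h \<theta> \<in> F" if "K \<subseteq> F" using galois_contains_conjugates[OF F _ assms(1) root] that \<theta> by blast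
    moreover have "\<theta> \<in> F" if "K' \<subseteq> F"
      using galois_contains_conjugates[OF F _ is_minpoly_conjugate[OF assms(1) root] is_minpolyD(4)[OF assms(1)]]
        that K' by auto
    ultimately show ?thesis using subfield_set.adj_subset[OF sfF] K' assms(2) by metis
  qed
  thus ?thesis unfolding galois_closure_def by (metis (mono_tags, lifting))
qed

section \<open>Monogenic orders\<close>

text \<open>Clearing denominators turns a rational relation into an integral one, so that a basis
  over the integers is independent over the rationals.\<close>

lemma common_denominator:
  fixes a :: "nat \<Rightarrow> rat"
  shows "\<exists>N :: int. N > 0 \<and> (\<forall>i<k. \<exists>z :: int. of_int N * a i = of_int z)"
proof (induction k)
  case 0
  show ?case by (intro exI[of _ 1]) auto
next
  case (Suc k)
  then obtain N :: int where N: "N > 0" "\<And>i. i < k \<Longrightarrow> \<exists>z :: int. of_int N * a i = of_int z" by blast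
  obtain u v where uv: "a k = of_int u / of_int v" "v > 0"
    by (metis quotient_of_div quotient_of_denom_pos surj_pair)
  have "\<exists>z :: int. of_int (N * v) * a i = of_int z" if i: "i < Suc k" for i
  proof (cases "i = k")
    case True
    have "of_int (N * v) * a i = of_int (N * u)" using uv True by simp
    thus ?thesis by blast
  next
    case False
    hence "i < k" using i by simp
    then obtain z :: int where "of_int N * a i = of_int z" using N(2) by blast
    hence "of_int (N * v) * a i = of_int (z * v)" by (simp add: mult_ac)
    thus ?thesis by blast
  qed
  thus ?case using N(1) uv(2) by (intro exI[of _ "N * v"]) auto
qed

lemma int_basis_imp_qindep:
  assumes "int_basis A ws"
  shows "qindep ws"
  unfolding qindep_def
proof (intro allI impI)
  fix a :: "nat \<Rightarrow> rat" and i
  assume 0: "(\<Sum>i<length ws. of_rat (a i) * ws ! i) = 0" and i: "i < length ws"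
  obtain N :: int where N: "N > 0" "\<And>i. i < length ws \<Longrightarrow> \<exists>z :: int. of_int N * a i = of_int z"
    using common_denominator[of "length ws" a] by blast
  then obtain z :: "nat \<Rightarrow> int" where z: "\<And>i. i < length ws \<Longrightarrow> of_int N * a i = of_int (z i)" by metis
  have "(\<Sum>i<length ws. of_int (z i) * ws ! i) = (\<Sum>i<length ws. of_int N * (of_rat (a i) * ws ! i))"
  proof (rule sum.cong[OF refl])
    fix i assume "i \<in> {..<length ws}"
    hence "of_rat (of_int N * a i) = (of_rat (of_int (z i)) :: complex)" using z by simp
    thus "of_int (z i) * ws ! i = of_int N * (of_rat (a i) * ws ! i)" by (simp add: of_rat_mult)
  qed
  also have "\<dots> = 0" using 0 by (simp flip: sum_distrib_left)
  finally have "\<forall>i<length ws. z i = 0" using assms unfolding int_basis_def by blast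
  hence "of_int N * a i = 0" using z[OF i] i by simp
  thus "a i = 0" using N(1) by simp
qed

text \<open>\<open>order_in\<close> supplies some integral basis \<open>ws\<close>, possibly
  different from the powers of \<open>\<theta>\<close>. Its \<open>n\<close> elements are
  independent over the rationals and lie in \<open>adj \<theta>\<close>, so \<open>\<theta>\<close>
  has degree at least \<open>n\<close>; closure of the order under products gives a monic integer
  equation of degree \<open>n\<close>.\<close>

lemma monogenic_order_minpoly:
  assumes "n \<ge> 2" "subfield_set K" "ring.dimension CC n \<rat> K" "order_in K (int_span (map (\<lambda>i. \<theta> ^ i) [0..<n]))"
  shows "\<exists>f :: int poly. lead_coeff f = 1 \<and> degree f = n \<and> is_minpoly (rat_poly f) \<theta> \<and> K = adj \<theta>"
proof -
  let ?A = "int_span (map (\<lambda>i. \<theta> ^ i) [0..<n])"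
  interpret A: subring_set ?A using assms(4) subring_CC_iff by (auto simp: order_in_def)
  have AK: "?A \<subseteq> K" using assms(4) by (simp add: order_in_def)
  obtain ws where ws: "int_basis ?A ws" "ring.dimension CC (length ws) \<rat> K"
    using assms(4) by (auto simp: order_in_def)
  have len: "length ws = n" using CC.dimension_is_inj[OF subfield_Rats ws(2) assms(3)] .
  have wA: "set ws \<subseteq> ?A" using ws(1) nth_in_int_span by (auto simp: int_basis_def in_set_conv_nth)
  have ind: "CC.independent \<rat> ws" using int_basis_imp_qindep[OF ws(1)] independent_iff_qindep by blast
  have \<theta>A: "\<theta> \<in> ?A" using nth_in_int_span[of 1 "map (\<lambda>i. \<theta> ^ i) [0..<n]"] assms(1) by simp
  have "\<theta> ^ n \<in> ?A" using \<theta>A by (rule A.power_S)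
  then obtain a :: "nat \<Rightarrow> int" where a: "\<theta> ^ n = (\<Sum>i<n. of_int (a i) * \<theta> ^ i)"
    by (auto simp: int_span_def)
  define f :: "int poly" where "f = monom 1 n + (\<Sum>i<n. monom (- a i) i)"
  have cf: "coeff f i = (if i = n then 1 else if i < n then - a i else 0)" for i
    by (auto simp: f_def coeff_sum)
  have deg: "degree f = n" by (intro antisym degree_le le_degree) (auto simp: cf)
  have lc: "lead_coeff f = 1" using cf deg by simp
  have "poly (map_poly of_int f) \<theta> = (\<Sum>i\<le>n. of_int (coeff f i) * \<theta> ^ i)" by (simp add: poly_altdef deg)
  also have "{..n} = insert n {..<n}" by auto
  also have "(\<Sum>i\<in>insert n {..<n}. of_int (coeff f i) * \<theta> ^ i) = \<theta> ^ n + (\<Sum>i<n. of_int (- a i) * \<theta> ^ i)"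
    by (simp add: cf)
  also have "\<dots> = 0" by (simp add: a sum_negf)
  finally have root: "qeval (rat_poly f) \<theta> = 0" by (simp add: qeval_rat_poly)
  have f0: "rat_poly f \<noteq> 0" using lc by (metis coeff_0 coeff_rat_poly degree_rat_poly of_int_1 zero_neq_one)
  obtain m where m: "is_minpoly m \<theta>" using ex_minpoly[OF f0 root] by blast
  interpret T: subfield_set "adj \<theta>" by (rule subfield_adj[OF m])
  have "?A \<subseteq> adj \<theta>" unfolding int_span_def by auto
  hence wT: "set ws \<subseteq> adj \<theta>" using wA by blast
  have "n \<le> degree m"
    using CC.independent_length_le_dimension[OF subfield_Rats dimension_adj[OF m] ind wT] len by simp
  hence fm: "rat_poly f = m" using minpoly_eq_rat_poly[OF m lc root] deg by simp
  hence min: "is_minpoly (rat_poly f) \<theta>" and dm: "degree m = n" using m deg by auto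
  have "CC.Span \<rat> ws = K"
    using CC.independent_length_eq_dimension[OF subfield_Rats assms(3) ind] wA AK len by blast
  moreover have "CC.Span \<rat> ws = adj \<theta>"
    using CC.independent_length_eq_dimension[OF subfield_Rats dimension_adj[OF m] ind wT] len dm by simp
  ultimately show ?thesis using lc deg min by blast
qed

section \<open>The equivalence\<close>

text \<open>The set \<open>E\<close> carries further prescribed types, which
  \<open>infinite_family\<close> uses to make fields differ.\<close>

lemma ex_field_with_extra_primes:
  fixes p :: "nat \<Rightarrow> nat"
  assumes n: "n \<ge> 2" and p: "\<And>i. i \<in> {1..r} \<Longrightarrow> prime (p i)" "inj_on p {1..r}"
    and \<mu>: "\<And>i. i \<in> {1..r} \<Longrightarrow> partition_of n (\<mu> i)"
    and pos: "\<forall>i\<in>{1..r}. nu_star n (p i) (\<mu> i) > 0"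
    and E: "finite E" "E \<inter> p ` {1..r} = {}" "\<And>q. q \<in> E \<Longrightarrow> realisable n q (\<nu> q)"
  shows "\<exists>K. Sn_number_field n K \<and> has_P1 n r p K \<and> has_P2 r p \<mu> K \<and> (\<exists>\<theta> m. is_minpoly m \<theta> \<and> K = adj \<theta>) \<and>
    (\<forall>q\<in>E. artin_symbol (galois_closure K) q = cycle_class K (\<nu> q)) \<and>
    (\<lambda>x\<in>galois_closure K. x) \<in> cycle_class K (replicate_mset n 1)"
proof -
  define \<nu>' where "\<nu>' q = (if q \<in> E then \<nu> q else \<mu> (inv_into {1..r} p q))" for q
  let ?Q = "E \<union> p ` {1..r}"
  have \<nu>'p: "\<nu>' (p i) = \<mu> i" if "i \<in> {1..r}" for i
    using that p(2) E(2) by (auto simp: \<nu>'_def)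
  have "realisable n q (\<nu>' q)" if q: "q \<in> ?Q" for q
  proof (cases "q \<in> E")
    case True
    thus ?thesis using E(3) by (simp add: \<nu>'_def)
  next
    case False
    then obtain i where i: "i \<in> {1..r}" "q = p i" using q by blast
    have "\<forall>j\<in>{1..n}. count (\<mu> i) j \<le> card (frob_orbits (p i) j)"
      using nu_star_pos_iff[OF p(1)[OF i(1)], of n "\<mu> i"] bspec[OF pos i(1)] n by simp
    thus ?thesis using i \<nu>'p[OF i(1)] p(1) \<mu> by (simp add: realisable_def)
  qed
  then obtain K \<theta> where K: "Sn_number_field n K" "K = adj \<theta>" "\<exists>m. is_minpoly m \<theta>"
    "order_in K (int_span (map (\<lambda>i. \<theta> ^ i) [0..<n]))"
    "\<And>q. q \<in> ?Q \<Longrightarrow> \<not> int q dvd order_disc K (int_span (map (\<lambda>i. \<theta> ^ i) [0..<n])) \<and>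
       unramified_at (galois_closure K) q \<and> artin_symbol (galois_closure K) q = cycle_class K (\<nu>' q)"
    "(\<lambda>x\<in>galois_closure K. x) \<in> cycle_class K (replicate_mset n 1)"
    using ex_Sn_field_with_types[OF n, of ?Q \<nu>'] E(1) by blast
  let ?d = "order_disc K (int_span (map (\<lambda>i. \<theta> ^ i) [0..<n]))"
  have "coprime ?d (\<Prod>i = 1..r. int (p i))"
  proof (rule prod_coprime_right)
    fix i assume i: "i \<in> {1..r}"
    have "prime (int (p i))" using p(1)[OF i] by simp
    moreover have "\<not> int (p i) dvd ?d" using K(5)[of "p i"] i by blast
    ultimately show "coprime ?d (int (p i))" using prime_imp_coprime coprime_commute by blast
  qed
  hence P1: "has_P1 n r p K" unfolding has_P1_def using K(4) by blast
  have P2: "has_P2 r p \<mu> K" unfolding has_P2_def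
  proof
    fix i assume i: "i \<in> {1..r}"
    thus "unramified_at (galois_closure K) (p i) \<and> artin_symbol (galois_closure K) (p i) = cycle_class K (\<mu> i)"
      using K(5)[of "p i"] \<nu>'p[OF i] by auto
  qed
  have "artin_symbol (galois_closure K) q = cycle_class K (\<nu> q)" if "q \<in> E" for q
    using K(5)[of q] that by (simp add: \<nu>'_def)
  thus ?thesis using K(1,2,3,6) P1 P2 by blast
qed

text \<open>The discriminant condition separates the roots modulo \<open>M\<close>, so a Frobenius
  element of type \<open>\<mu> i\<close> bounds the number of parts by the number of Frobenius
  orbits.\<close>

lemma nu_star_pos_if_field:
  fixes p :: "nat \<Rightarrow> nat"
  assumes n: "n \<ge> 2" and p: "\<And>i. i \<in> {1..r} \<Longrightarrow> prime (p i)"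
    and \<mu>: "\<And>i. i \<in> {1..r} \<Longrightarrow> partition_of n (\<mu> i)"
    and K: "Sn_number_field n K" "has_P1 n r p K" "has_P2 r p \<mu> K" and i: "i \<in> {1..r}"
  shows "nu_star n (p i) (\<mu> i) > 0"
proof -
  obtain \<theta> where \<theta>: "order_in K (int_span (map (\<lambda>i. \<theta> ^ i) [0..<n]))"
      "coprime (order_disc K (int_span (map (\<lambda>i. \<theta> ^ i) [0..<n]))) (\<Prod>i = 1..r. int (p i))"
    using K(2) unfolding has_P1_def by blast
  have sf: "subfield_set K" and dim: "ring.dimension CC n \<rat> K"
    using K(1) subfield_CC_iff by (auto simp: Sn_number_field_def number_field_def)
  obtain f :: "int poly" where f: "lead_coeff f = 1" "degree f = n" "is_minpoly (rat_poly f) \<theta>" "K = adj \<theta>"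
    using monogenic_order_minpoly[OF n sf dim \<theta>(1)] by blast
  define R where "R = {a :: complex. poly (map_poly of_int f) a = 0}"
  have R_qeval: "R = {a. qeval (rat_poly f) a = 0}" by (simp add: R_def qeval_rat_poly)
  have fin: "finite R" unfolding R_qeval by (rule card_roots_minpoly(2)[OF f(3)])
  have alg: "algebraic_int r" if "r \<in> R" for r
    unfolding algebraic_int_altdef_ipoly using that f(1) by (auto simp: R_def)
  obtain L where L: "galois_field L" "R \<subseteq> L" "\<And>F. subfield_set F \<Longrightarrow> R \<subseteq> F \<Longrightarrow> L \<subseteq> F"
    using splitting_field[OF fin alg R_qeval] by blast
  interpret simple_galois_roots L R f \<theta>
    using L f by (auto simp: simple_galois_roots_def simple_galois_roots_axioms_def
        galois_roots_def galois_roots_axioms_def R_def)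
  let ?p = "p i"
  have prime: "prime ?p" by (rule p[OF i])
  obtain M where M: "prime_set_over {x :: complex. algebraic_int x} M ?p" using prime_over_exists[OF prime] by blast
  hence M': "prime_over_alg_ints M ?p" by (simp add: prime_over_alg_ints_def)
  have "\<not> int ?p dvd order_disc K (int_span powers)"
  proof
    assume "int ?p dvd order_disc K (int_span powers)"
    moreover have "int ?p dvd (\<Prod>i = 1..r. int (p i))" using i by (intro dvd_prodI) auto
    ultimately have "is_unit (int ?p)" using \<theta>(2) f(2) by (meson coprime_common_divisor)
    thus False using prime prime_gt_1_nat[OF prime] by simp
  qed
  hence sep: "r = s" if "r \<in> R" "s \<in> R" "r - s \<in> M" for r s
    using order_disc_dvd_iff[OF M] f(4) that by blast
  have full: full_symmetric using Sn_iff K(1) f(2,4) by simp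
  \<comment> \<open>Full symmetry shows that \<open>cycle_class K (\<mu> i)\<close> is nonempty;
    only then does equality with the Artin symbol provide a Frobenius element.\<close>
  have "sum_mset (\<mu> i) = card R" "0 \<notin># \<mu> i" using \<mu>[OF i] card_R f(2) by (auto simp: partition_of_def)
  then obtain \<pi> where \<pi>: "fin_perm \<pi> R" "cycle_type \<pi> R = \<mu> i"
    using ex_perm_of_cycle_type[OF fin] by blast
  obtain \<sigma> where s: "\<sigma> \<in> G" "\<forall>r\<in>R. \<sigma> r = \<pi> r"
    using full_symmetricD[OF full fin_perm.bij_A[OF \<pi>(1)]] by blast
  have "cycle_type \<sigma> R = \<mu> i" using cycle_type_cong(1)[OF \<pi>(1), of \<sigma>] s(2) \<pi>(2) by simp
  hence "\<sigma> \<in> cycle_class K (\<mu> i)" using cycle_class_eq s(1) f(4) by simp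
  moreover have "artin_symbol L ?p = cycle_class K (\<mu> i)"
    using K(3) i galois_closure_K f(4) by (auto simp: has_P2_def)
  ultimately obtain P where P: "P \<in> primes_above L ?p" "frobenius_at L ?p P \<sigma>" by (auto simp: artin_symbol_def)
  obtain \<rho> where \<rho>: "frobenius_at L ?p (M \<inter> L) \<rho>" "cycle_type \<rho> R = cycle_type \<sigma> R"
    using frobenius_type_at_other_prime[OF prime P(1) prime_restrict_above[OF M'] P(2)] by blast
  have "count (\<mu> i) j \<le> card (frob_orbits ?p j)" if "j \<in> {1..n}" for j
    using count_cycle_type_frobenius[OF M' \<rho>(1) sep, of j] that \<rho>(2) \<open>cycle_type \<sigma> R = \<mu> i\<close> by simp
  thus ?thesis using nu_star_pos_iff[OF prime] n by simp
qed

text \<open>The field \<open>K j\<close> gets type \<open>(n)\<close> at the prime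
  \<open>s j\<close> and type \<open>(1, ..., 1)\<close> at all earlier \<open>s i\<close>, which
  makes the Galois closures pairwise different, and isomorphic fields have equal Galois
  closures.\<close>

lemma infinite_family:
  fixes p :: "nat \<Rightarrow> nat"
  assumes n: "n \<ge> 2" and p: "\<And>i. i \<in> {1..r} \<Longrightarrow> prime (p i)" "inj_on p {1..r}"
    and \<mu>: "\<And>i. i \<in> {1..r} \<Longrightarrow> partition_of n (\<mu> i)"
    and pos: "\<forall>i\<in>{1..r}. nu_star n (p i) (\<mu> i) > 0"
  shows "\<exists>F. infinite F \<and> pairwise (\<lambda>K L. \<not> ring_on K \<simeq> ring_on L) F \<and>
    (\<forall>K \<in> F. Sn_number_field n K \<and> has_P1 n r p K \<and> has_P2 r p \<mu> K)"
proof -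
  define b where "b = Max (insert n (p ` {1..r}))"
  have b: "q \<le> b" if "q \<in> insert n (p ` {1..r})" for q unfolding b_def using that by (intro Max_ge) auto
  define E where "E = {q. prime q \<and> q > b}"
  have "infinite E"
  proof
    assume "finite E"
    moreover have "{q::nat. prime q} \<subseteq> E \<union> {..b}" by (auto simp: E_def)
    ultimately show False using primes_infinite by (meson finite_UnI finite_atMost finite_subset)
  qed
  define s where "s = enumerate E"
  have sE: "s j \<in> E" for j unfolding s_def by (rule enumerate_in_set[OF \<open>infinite E\<close>])
  have s_inj: "s i = s j \<longleftrightarrow> i = j" for i j
    unfolding s_def using strict_mono_enumerate[OF \<open>infinite E\<close>] strict_mono_eq by blast
  have s_prime: "prime (s j)" and s_ge: "s j \<ge> n" and s_notin: "s j \<notin> p ` {1..r}" for j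
  proof -
    show "prime (s j)" using sE[of j] by (simp add: E_def)
    have "s j > b" using sE[of j] by (simp add: E_def)
    thus "s j \<ge> n" "s j \<notin> p ` {1..r}" using b[of n] b[of "s j"] by auto
  qed
  define \<nu> where "\<nu> j q = (if q = s j then {#n#} else replicate_mset n 1)" for j q
  have "\<exists>K. Sn_number_field n K \<and> has_P1 n r p K \<and> has_P2 r p \<mu> K \<and> (\<exists>\<theta> m. is_minpoly m \<theta> \<and> K = adj \<theta>) \<and>
      (\<forall>q\<in>s ` {..j}. artin_symbol (galois_closure K) q = cycle_class K (\<nu> j q)) \<and>
      (\<lambda>x\<in>galois_closure K. x) \<in> cycle_class K (replicate_mset n 1)" for j
  proof (rule ex_field_with_extra_primes[OF n p \<mu> pos])
    show "s ` {..j} \<inter> p ` {1..r} = {}" using s_notin by blast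
    fix q assume "q \<in> s ` {..j}"
    then obtain i where i: "q = s i" by blast
    show "realisable n q (\<nu> j q)" unfolding i
      using s_prime s_ge n
      by (intro realisable_at_large_prime) (auto simp: \<nu>_def partition_of_def sum_mset_replicate_mset)
  qed auto
  then obtain K where K: "\<And>j. Sn_number_field n (K j)" "\<And>j. has_P1 n r p (K j)" "\<And>j. has_P2 r p \<mu> (K j)"
      "\<And>j. \<exists>\<theta> m. is_minpoly m \<theta> \<and> K j = adj \<theta>"
      "\<And>j q. q \<in> s ` {..j} \<Longrightarrow> artin_symbol (galois_closure (K j)) q = cycle_class (K j) (\<nu> j q)"
      "\<And>j. (\<lambda>x\<in>galois_closure (K j). x) \<in> cycle_class (K j) (replicate_mset n 1)"
    by metis
  have closure_ne: "galois_closure (K i) \<noteq> galois_closure (K j)" if "i < j" for i j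
  proof
    assume eq: "galois_closure (K i) = galois_closure (K j)"
    \<comment> \<open>A common Galois closure would have one Artin symbol at \<open>s i\<close>,
      which belongs to type \<open>(n)\<close> through \<open>K i\<close> and contains the identity
      through \<open>K j\<close>; this is impossible for \<open>n \<ge> 2\<close>.\<close>
    have "cycle_class (K i) {#n#} = artin_symbol (galois_closure (K i)) (s i)"
      using K(5)[of "s i" i] by (simp add: \<nu>_def)
    also have "\<dots> = cycle_class (K j) (replicate_mset n 1)"
      using K(5)[of "s i" j] that eq s_inj by (simp add: \<nu>_def)
    finally have "(\<lambda>x\<in>galois_closure (K i). x) \<in> cycle_class (K i) {#n#}" using K(6)[of j] eq by simp
    hence "replicate_mset n 1 = {#n#}" using K(6)[of i] by (simp add: cycle_class_def)
    hence "size (replicate_mset n (1::nat)) = size {#n#}" by (rule arg_cong)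
    thus False using n by simp
  qed
  have closure_ne': "galois_closure (K i) \<noteq> galois_closure (K j)" if "i \<noteq> j" for i j
    using closure_ne[of i j] closure_ne[of j i] that by (metis nat_neq_iff)
  have "inj K" using closure_ne' by (intro injI) metis
  hence "infinite (range K)" using finite_imageD by blast
  moreover have "pairwise (\<lambda>K L. \<not> ring_on K \<simeq> ring_on L) (range K)"
  proof (rule pairwiseI)
    fix A B assume "A \<in> range K" "B \<in> range K" "A \<noteq> B"
    then obtain i j where ij: "A = K i" "B = K j" "i \<noteq> j" by blast
    obtain \<theta> m where "is_minpoly m \<theta>" "K i = adj \<theta>" using K(4) by blast
    thus "\<not> ring_on A \<simeq> ring_on B"
      using iso_imp_same_galois_closure[of m \<theta> "K i" "K j"] closure_ne'[OF ij(3)] ij by blast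
  qed
  ultimately show ?thesis using K(1-3) by (intro exI[of _ "range K"]) auto
qed

text \<open>Fields are counted up to ring isomorphism, since a number field may have several copies
  inside the complex numbers.\<close>

theorem theorem2p5:
  fixes n r :: nat and p :: "nat \<Rightarrow> nat" and \<mu> :: "nat \<Rightarrow> nat multiset"
  assumes "n \<ge> 2"
    and "\<And>i. i \<in> {1..r} \<Longrightarrow> prime (p i)"
    and "inj_on p {1..r}"
    and "\<And>i. i \<in> {1..r} \<Longrightarrow> partition_of n (\<mu> i)"
  shows "((\<forall>i \<in> {1..r}. nu_star n (p i) (\<mu> i) > 0)
            \<longleftrightarrow> (\<exists>K. Sn_number_field n K \<and> has_P1 n r p K \<and> has_P2 r p \<mu> K))
       \<and> ((\<exists>K. Sn_number_field n K \<and> has_P1 n r p K \<and> has_P2 r p \<mu> K)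
            \<longleftrightarrow> (\<exists>F. infinite F \<and> pairwise (\<lambda>K L. \<not> ring_on K \<simeq> ring_on L) F \<and>
                  (\<forall>K \<in> F. Sn_number_field n K \<and> has_P1 n r p K \<and> has_P2 r p \<mu> K)))"
proof -
  let ?good = "\<lambda>K. Sn_number_field n K \<and> has_P1 n r p K \<and> has_P2 r p \<mu> K"
  have "\<forall>i\<in>{1..r}. nu_star n (p i) (\<mu> i) > 0" if "?good K" for K
    using nu_star_pos_if_field[of n r p \<mu> K] assms(1,2,4) that by blast
  moreover have "\<exists>F. infinite F \<and> pairwise (\<lambda>K L. \<not> ring_on K \<simeq> ring_on L) F \<and> (\<forall>K\<in>F. ?good K)"
    if "\<forall>i\<in>{1..r}. nu_star n (p i) (\<mu> i) > 0"
    using infinite_family[of n r p \<mu>] assms that by blast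
  moreover have "\<exists>K. ?good K" if "infinite F" "\<forall>K\<in>F. ?good K" for F
    using that by (metis finite.emptyI ex_in_conv)
  ultimately show ?thesis by blast
qed

end
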